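(* The set of all $C^\infty$ diffeomorphisms $f\in \mathrm{Diff}^1_P([0,1])$ such that for every integer $k\ge 1$ there exists an orientation-preserving $C^\infty$ diffeomorphism $h$ of $[0,1]$ with $hfh^{-1}=f^k$ is dense in $\mathrm{Diff}^1_P([0,1])$.
   Context: $\mathrm{Diff}^1_+([0,1])$ is the group of orientation-preserving $C^1$ diffeomorphisms of $[0,1]$ (under composition; $f^k$ is the $k$-th iterate), with the $C^1$ topology given by the distance $\|f-g\|_1=\max_{x\in[0,1]}|Df(x)-Dg(x)|$. $\mathrm{Diff}^1_P([0,1])$ is the (closed) subspace of those $f\in\mathrm{Diff}^1_+([0,1])$ all of whose fixed points $a\in[0,1]$ (including $0$ and $1$) are parabolic, i.e. $Df(a)=1$, with the induced topology. *)

theory Defs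
  imports "HOL-Analysis.Analysis" "HOL-Library.Extended_Nat"
begin

text \<open>
  Derivatives on the closed unit interval \<open>I01\<close> are taken within \<open>I01\<close>, so they are
  one-sided at \<open>0\<close> and \<open>1\<close>.
\<close>

abbreviation I01 :: "real set" where
  "I01 \<equiv> {0..1}"

definition D01 :: "(real \<Rightarrow> real) \<Rightarrow> real \<Rightarrow> real" where
  "D01 f x = vector_derivative f (at x within I01)"

definition C_diff_on :: "enat \<Rightarrow> (real \<Rightarrow> real) \<Rightarrow> bool" where
  "C_diff_on r f \<longleftrightarrow>
     (\<forall>i::nat. enat i < r \<longrightarrow> (D01 ^^ i) f differentiable_on I01) \<and>
     (\<forall>i::nat. enat i \<le> r \<longrightarrow> continuous_on I01 ((D01 ^^ i) f))"

text \<open>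
  Orientation-preserving \<open>C\<^sup>r\<close> diffeomorphisms of \<open>I01\<close>, for \<open>r\<close> a natural number or
  \<open>\<infinity>\<close>.  Maps of \<open>I01\<close> are total functions on the reals that are \<^const>\<open>extensional\<close>
  on \<open>I01\<close>, so that two of them are equal iff they agree on \<open>I01\<close>.
\<close>

definition Diff_plus :: "enat \<Rightarrow> (real \<Rightarrow> real) set" where
  "Diff_plus r =
     {f \<in> extensional I01. bij_betw f I01 I01 \<and> strict_mono_on I01 f \<and>
        C_diff_on r f \<and> C_diff_on r (inv_into I01 f)}"

definition Diff1_P :: "(real \<Rightarrow> real) set" where
  "Diff1_P = {f \<in> Diff_plus 1. \<forall>a\<in>I01. f a = a \<longrightarrow> D01 f a = 1}"

text \<open>
  On pairs of \<open>C\<^sup>1\<close> diffeomorphisms the supremum is an attained maximum of a continuous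
  function.  The value \<open>0\<close> on other pairs is only there because the locale
  \<^locale>\<open>Metric_space\<close> asks for nonnegativity outside the carrier as well.
\<close>

definition C1_dist :: "(real \<Rightarrow> real) \<Rightarrow> (real \<Rightarrow> real) \<Rightarrow> real" where
  "C1_dist f g =
     (if f \<in> Diff_plus 1 \<and> g \<in> Diff_plus 1 then SUP x\<in>I01. \<bar>D01 f x - D01 g x\<bar> else 0)"

definition Diff1_topology :: "(real \<Rightarrow> real) topology" where
  "Diff1_topology = Metric_space.mtopology (Diff_plus 1) C1_dist"

definition Diff1_P_topology :: "(real \<Rightarrow> real) topology" where
  "Diff1_P_topology = subtopology Diff1_topology Diff1_P"

text \<open>
  \<open>h f h\<^sup>-\<^sup>1 = g\<close> as maps of \<open>I01\<close>.
\<close>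

definition conjugates_to :: "(real \<Rightarrow> real) \<Rightarrow> (real \<Rightarrow> real) \<Rightarrow> (real \<Rightarrow> real) \<Rightarrow> bool" where
  "conjugates_to h f g \<longleftrightarrow> (\<forall>x\<in>I01. h (f (inv_into I01 h x)) = g x)"

lemma Diff_plus_1D:
  assumes "f \<in> Diff_plus 1"
  shows "f \<in> extensional I01" "bij_betw f I01 I01" "strict_mono_on I01 f"
    "f differentiable_on I01" "continuous_on I01 (D01 f)"
proof -
  show "f \<in> extensional I01" "bij_betw f I01 I01" "strict_mono_on I01 f"
    using assms by (auto simp: Diff_plus_def)
  have C: "C_diff_on 1 f" using assms by (auto simp: Diff_plus_def)
  then have "(D01 ^^ 0) f differentiable_on I01" "continuous_on I01 ((D01 ^^ 1) f)"
    unfolding C_diff_on_def by (auto simp: one_enat_def)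
  then show "f differentiable_on I01" "continuous_on I01 (D01 f)" by auto
qed

lemma Diff_plus_1_has_derivative:
  assumes "f \<in> Diff_plus 1" "x \<in> I01"
  shows "(f has_real_derivative D01 f x) (at x within I01)"
  using Diff_plus_1D(4)[OF assms(1)] assms(2)
  by (simp add: D01_def differentiable_on_def vector_derivative_works
      has_real_derivative_iff_has_vector_derivative)

lemma Diff_plus_fixes_endpoints:
  assumes "f \<in> Diff_plus r"
  shows "f 0 = 0" "f 1 = 1"
proof -
  have b: "bij_betw f I01 I01" and m: "strict_mono_on I01 f"
    using assms by (auto simp: Diff_plus_def)
  have mono: "f x \<le> f y" if "x \<in> I01" "y \<in> I01" "x \<le> y" for x y
    using strict_mono_onD[OF m that(1,2)] that(3) by (cases "x = y") auto
  have im: "f ` I01 = I01" using b by (simp add: bij_betw_def)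
  have "0 \<in> f ` I01" unfolding im by simp
  then obtain u where u: "u \<in> I01" "f u = 0" by (elim imageE) simp
  have "1 \<in> f ` I01" unfolding im by simp
  then obtain v where v: "v \<in> I01" "f v = 1" by (elim imageE) simp
  have i01: "f 0 \<in> I01" "f 1 \<in> I01" using bij_betwE[OF b] by simp_all
  show "f 0 = 0" using mono[of 0 u] u i01 by auto
  show "f 1 = 1" using mono[of v 1] v i01 by auto
qed

lemma Diff_plus_1_eqI:
  assumes f: "f \<in> Diff_plus 1" and g: "g \<in> Diff_plus 1"
    and eq: "\<And>x. x \<in> I01 \<Longrightarrow> D01 f x = D01 g x"
  shows "f = g"
proof (rule extensionalityI[of _ I01])
  show "f \<in> extensional I01" "g \<in> extensional I01" using Diff_plus_1D(1) f g by auto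
  fix x assume x: "x \<in> I01"
  have "\<exists>c. \<forall>x\<in>I01. f x - g x = c"
  proof (rule has_field_derivative_zero_constant)
    show "convex I01" by simp
    fix y assume "y \<in> I01"
    then show "((\<lambda>x. f x - g x) has_field_derivative 0) (at y within I01)"
      using DERIV_diff[OF Diff_plus_1_has_derivative[OF f \<open>y \<in> I01\<close>]
          Diff_plus_1_has_derivative[OF g \<open>y \<in> I01\<close>]] eq[OF \<open>y \<in> I01\<close>] by simp
  qed
  then obtain c where c: "\<And>x. x \<in> I01 \<Longrightarrow> f x - g x = c" by blast
  have "c = 0" using c[of 0] Diff_plus_fixes_endpoints(1)[OF f]
      Diff_plus_fixes_endpoints(1)[OF g] by simp
  then show "f x = g x" using c[OF x] by simp
qed

lemma C1_dist_bdd: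
  assumes "f \<in> Diff_plus 1" "g \<in> Diff_plus 1"
  shows "bdd_above ((\<lambda>x. \<bar>D01 f x - D01 g x\<bar>) ` I01)"
proof -
  have "continuous_on I01 (\<lambda>x. \<bar>D01 f x - D01 g x\<bar>)"
    by (intro continuous_intros Diff_plus_1D assms)
  then have "compact ((\<lambda>x. \<bar>D01 f x - D01 g x\<bar>) ` I01)"
    by (intro compact_continuous_image) auto
  then show ?thesis by (intro bounded_imp_bdd_above compact_imp_bounded)
qed

lemma C1_dist_upper:
  assumes "f \<in> Diff_plus 1" "g \<in> Diff_plus 1" "x \<in> I01"
  shows "\<bar>D01 f x - D01 g x\<bar> \<le> C1_dist f g"
  using cSUP_upper[OF assms(3) C1_dist_bdd[OF assms(1,2)]] assms(1,2) by (simp add: C1_dist_def)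

lemma Metric_space_Diff_plus_1: "Metric_space (Diff_plus 1) C1_dist"
proof
  fix f g
  show "C1_dist f g = C1_dist g f"
    unfolding C1_dist_def by (auto simp: abs_minus_commute)
  show "0 \<le> C1_dist f g"
  proof (cases "f \<in> Diff_plus 1 \<and> g \<in> Diff_plus 1")
    case True
    then have "\<bar>D01 f 0 - D01 g 0\<bar> \<le> C1_dist f g"
      by (intro C1_dist_upper) auto
    then show ?thesis by linarith
  qed (auto simp: C1_dist_def)
  assume f: "f \<in> Diff_plus 1" and g: "g \<in> Diff_plus 1"
  show "C1_dist f g = 0 \<longleftrightarrow> f = g"
  proof
    assume z: "C1_dist f g = 0"
    show "f = g"
    proof (rule Diff_plus_1_eqI[OF f g])
      fix x assume "x \<in> I01"
      from C1_dist_upper[OF f g this] z show "D01 f x = D01 g x" by simp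
    qed
  qed (simp add: C1_dist_def)
  fix h assume h: "h \<in> Diff_plus 1"
  show "C1_dist f h \<le> C1_dist f g + C1_dist g h"
  proof -
    have "(SUP x\<in>I01. \<bar>D01 f x - D01 h x\<bar>) \<le> C1_dist f g + C1_dist g h"
    proof (rule cSUP_least)
      fix x assume x: "x \<in> I01"
      show "\<bar>D01 f x - D01 h x\<bar> \<le> C1_dist f g + C1_dist g h"
        using C1_dist_upper[OF f g x] C1_dist_upper[OF g h x] by linarith
    qed simp
    then show ?thesis using f h by (simp add: C1_dist_def)
  qed
qed

lemma topspace_Diff1_P_topology: "topspace Diff1_P_topology = Diff1_P"
  by (auto simp: Diff1_P_topology_def Diff1_topology_def Diff1_P_def
      Metric_space.topspace_mtopology[OF Metric_space_Diff_plus_1])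

end

theory Submission
  imports Defs "HOL-Complex_Analysis.Conformal_Mappings" "HOL-Real_Asymp.Real_Asymp"
begin

text \<open>
  On the real line, multiplication by \<open>k\<close> conjugates the translation \<open>T t = t + 1\<close> to its power
  \<open>T\<^sup>k t = t + k\<close>.  Let \<open>\<Phi>\<close> be a smooth diffeomorphism from the line onto an open interval which is, up
  to an affine map, \<open>-1 / ln (ln t)\<close> near \<open>+\<infinity>\<close> and the mirror image of this near \<open>-\<infinity>\<close>.  Seen through
  \<open>\<Phi>\<close>, both the translation and the dilations extend by the identity to smooth diffeomorphisms of the
  whole line; the double logarithm is what makes the dilations infinitely tangent to the identity
  at the two ends, and it does so for the translation as well (\<open>supported_diffeo_transport\<close>).  So
  \<open>g = \<Phi> T \<Phi>\<^sup>-\<^sup>1\<close> is smoothly conjugate to all its positive powers (\<open>transport_conjugacy\<close>), and such maps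
  can be placed side by side on disjoint intervals.  It remains to see that they approximate every
  parabolic diffeomorphism in the \<open>C\<^sup>1\<close> topology.

  Take \<open>f\<close> with \<open>f x > x\<close> between two consecutive fixed points \<open>a < b\<close>.  There \<open>f\<close> is \<open>C\<^sup>1\<close> conjugate to the
  translation by some parametrization \<open>\<phi>\<close> of \<open>(a, b)\<close>, built by prescribing it on one fundamental domain
  (locale \<open>pushing_map\<close>).  The derivative of \<open>\<Phi> T \<Phi>\<^sup>-\<^sup>1\<close> at \<open>\<Phi> t\<close> is \<open>\<Phi>' (t + 1) / \<Phi>' t\<close>, hence \<open>\<Phi> T \<Phi>\<^sup>-\<^sup>1\<close> is
  \<open>C\<^sup>1\<close> close to \<open>f\<close> as soon as \<open>\<Phi>\<close> is uniformly close to \<open>\<phi>\<close> and the increments \<open>w (t + 1) - w t\<close> of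
  \<open>w = ln \<Phi>'\<close> are uniformly close to those of \<open>l = ln \<phi>'\<close>.  The increments of \<open>l\<close> are \<open>ln (f' (\<phi> t))\<close>, and
  they tend to \<open>0\<close> at both ends exactly because \<open>a\<close> and \<open>b\<close> are parabolic.  The logarithm \<open>\<Lambda>\<close> of
  the derivative of \<open>-1 / ln (ln t)\<close> has the same property.  Vanishing increments force both functions to be
  \<open>o(t)\<close>, so one can pass from \<open>l\<close> on \<open>[-N, N]\<close> to \<open>\<Lambda>\<close> outside \<open>[-2 N, 2 N]\<close> by a convex combination
  whose weight has slope of order \<open>1 / N\<close>: the additional increment is \<open>o(N) / N\<close>
  (\<open>interpolate_to_model\<close>).  Replacing \<open>l\<close> by a polynomial on \<open>[-2 N, 2 N]\<close> makes the result smooth.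
  Convexity of the exponential bounds the mass of \<open>\<Phi>'\<close> in the tails, which keeps \<open>\<Phi>\<close> close to \<open>\<phi>\<close>
  (\<open>half_line_estimate\<close>, \<open>approximating_compactification\<close>).

  Globally, only finitely many of the intervals between consecutive fixed points have length at
  least a given \<open>\<delta>\<close>.  On these the approximation above is used.  Everywhere else \<open>f'\<close> is close to \<open>1\<close> by
  uniform continuity, since a fixed point is nearby, and the identity is a good approximation.
\<close>

section \<open>Smooth functions on open subsets of the line\<close>

text \<open>
  Only one-variable functions on open sets occur, so smoothness is the existence of a chain of
  derivatives.  Each closure property is an induction on the length of the chain.
\<close>

primrec n_diff :: "nat \<Rightarrow> (real \<Rightarrow> real) \<Rightarrow> real set \<Rightarrow> bool" where
  "n_diff 0 f S \<longleftrightarrow> True"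
| "n_diff (Suc n) f S \<longleftrightarrow>
     (\<exists>f'. (\<forall>x\<in>S. (f has_real_derivative f' x) (at x)) \<and> n_diff n f' S)"

definition smooth_on :: "real set \<Rightarrow> (real \<Rightarrow> real) \<Rightarrow> bool" where
  "smooth_on S f \<longleftrightarrow> (\<forall>n. n_diff n f S)"

lemma n_diff_SucI:
  assumes "\<And>x. x \<in> S \<Longrightarrow> (f has_real_derivative f' x) (at x)" "n_diff n f' S"
  shows "n_diff (Suc n) f S"
  using assms by auto

lemma n_diff_Suc_imp: "n_diff (Suc n) f S \<Longrightarrow> n_diff n f S"
proof (induction n arbitrary: f)
  case (Suc n)
  then obtain f' where "\<forall>x\<in>S. (f has_real_derivative f' x) (at x)" "n_diff (Suc n) f' S"
    by (auto simp del: n_diff.simps simp: n_diff.simps(2)[of "Suc n" f])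
  with Suc.IH show ?case by (auto simp only: n_diff.simps(2)[of n f])
qed simp

lemma n_diff_cong:
  assumes "open S" "\<And>x. x \<in> S \<Longrightarrow> f x = g x" "n_diff n f S"
  shows "n_diff n g S"
proof (cases n)
  case (Suc m)
  then obtain f' where f': "\<And>x. x \<in> S \<Longrightarrow> (f has_real_derivative f' x) (at x)" "n_diff m f' S"
    using assms(3) by auto
  have "(g has_real_derivative f' x) (at x)" if "x \<in> S" for x
    by (rule has_field_derivative_transform_within_open[OF f'(1)[OF that] assms(1) that])
       (use assms(2) in auto)
  with f'(2) Suc show ?thesis by auto
qed simp

lemma n_diff_subset: "n_diff n f S \<Longrightarrow> T \<subseteq> S \<Longrightarrow> n_diff n f T"
proof (induction n arbitrary: f)
  case (Suc n)
  then show ?case by (auto simp: subset_iff)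
qed simp

lemma n_diff_const: "n_diff n (\<lambda>_. c) S"
proof (induction n arbitrary: c)
  case (Suc n)
  show ?case by (rule n_diff_SucI[where f' = "\<lambda>_. 0"]) (auto intro: Suc)
qed simp

lemma n_diff_ident: "n_diff n (\<lambda>x. x) S"
proof (cases n)
  case (Suc n)
  show ?thesis unfolding Suc
    by (rule n_diff_SucI[where f' = "\<lambda>_. 1"]) (auto intro: n_diff_const)
qed simp

lemma n_diff_add: "n_diff n f S \<Longrightarrow> n_diff n g S \<Longrightarrow> n_diff n (\<lambda>x. f x + g x) S"
proof (induction n arbitrary: f g)
  case (Suc n)
  then obtain f' g' where *: "\<forall>x\<in>S. (f has_real_derivative f' x) (at x)" "n_diff n f' S"
    "\<forall>x\<in>S. (g has_real_derivative g' x) (at x)" "n_diff n g' S" by auto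
  show ?case
    by (rule n_diff_SucI[where f' = "\<lambda>x. f' x + g' x"]) (use * Suc.IH in \<open>auto intro: DERIV_add\<close>)
qed simp

lemma n_diff_mult: "n_diff n f S \<Longrightarrow> n_diff n g S \<Longrightarrow> n_diff n (\<lambda>x. f x * g x) S"
proof (induction n arbitrary: f g)
  case (Suc n)
  then obtain f' g' where *: "\<forall>x\<in>S. (f has_real_derivative f' x) (at x)" "n_diff n f' S"
    "\<forall>x\<in>S. (g has_real_derivative g' x) (at x)" "n_diff n g' S" by auto
  note n = n_diff_Suc_imp[OF Suc.prems(1)] n_diff_Suc_imp[OF Suc.prems(2)]
  show ?case
  proof (rule n_diff_SucI[where f' = "\<lambda>x. f' x * g x + g' x * f x"])
    show "n_diff n (\<lambda>x. f' x * g x + g' x * f x) S"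
      by (intro n_diff_add Suc.IH n *)
  qed (use * in \<open>auto intro: DERIV_mult\<close>)
qed simp

lemma n_diff_compose:
  assumes "n_diff n f T" "n_diff n g S" "\<And>x. x \<in> S \<Longrightarrow> g x \<in> T"
  shows "n_diff n (\<lambda>x. f (g x)) S"
  using assms(1,2)
proof (induction n arbitrary: f)
  case (Suc n)
  then obtain f' g' where *: "\<forall>x\<in>T. (f has_real_derivative f' x) (at x)" "n_diff n f' T"
    "\<forall>x\<in>S. (g has_real_derivative g' x) (at x)" "n_diff n g' S" by auto
  show ?case
  proof (rule n_diff_SucI[where f' = "\<lambda>x. f' (g x) * g' x"])
    fix x assume "x \<in> S"
    then show "((\<lambda>x. f (g x)) has_real_derivative f' (g x) * g' x) (at x)"
      using * assms(3) by (intro DERIV_chain2[of f _ g]) auto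
  next
    show "n_diff n (\<lambda>x. f' (g x) * g' x) S"
      by (rule n_diff_mult[OF Suc.IH[OF *(2) n_diff_Suc_imp[OF Suc.prems(2)]] *(4)])
  qed
qed simp

lemma n_diff_inverse: "n_diff n inverse (- {0})"
proof (induction n)
  case (Suc n)
  show ?case
  proof (rule n_diff_SucI[where f' = "\<lambda>x. (-1) * (inverse x * inverse x)"])
    show "n_diff n (\<lambda>x. (-1) * (inverse x * inverse x)) (- {0})"
      by (intro n_diff_mult n_diff_const Suc)
  qed (auto intro!: derivative_eq_intros)
qed simp

lemma smooth_onI_deriv:
  assumes "\<And>x. x \<in> S \<Longrightarrow> (f has_real_derivative f' x) (at x)" "smooth_on S f'"
  shows "smooth_on S f"
  unfolding smooth_on_def
proof
  fix n show "n_diff n f S"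
    using assms by (cases n) (auto simp: smooth_on_def)
qed

lemma smooth_on_deriv:
  assumes "open S" "smooth_on S f"
  shows "\<And>x. x \<in> S \<Longrightarrow> (f has_real_derivative deriv f x) (at x)" "smooth_on S (deriv f)"
proof -
  show *: "(f has_real_derivative deriv f x) (at x)" if x: "x \<in> S" for x
  proof -
    have "n_diff (Suc 0) f S" using assms(2) unfolding smooth_on_def ..
    then obtain f' where "\<forall>x\<in>S. (f has_real_derivative f' x) (at x)" by auto
    with x have "(f has_real_derivative f' x) (at x)" by blast
    then show ?thesis using DERIV_imp_deriv by metis
  qed
  show "smooth_on S (deriv f)"
    unfolding smooth_on_def
  proof
    fix n
    have "n_diff (Suc n) f S" using assms(2) unfolding smooth_on_def ..
    then obtain f' where f': "\<forall>x\<in>S. (f has_real_derivative f' x) (at x)" "n_diff n f' S" by auto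
    then show "n_diff n (deriv f) S"
      by (intro n_diff_cong[OF assms(1) _ f'(2)]) (metis DERIV_imp_deriv)
  qed
qed

lemma smooth_on_cong: "open S \<Longrightarrow> (\<And>x. x \<in> S \<Longrightarrow> f x = g x) \<Longrightarrow> smooth_on S f \<Longrightarrow> smooth_on S g"
  unfolding smooth_on_def by (intro allI, rule n_diff_cong[of S f]) auto

lemma smooth_on_subset: "smooth_on S f \<Longrightarrow> T \<subseteq> S \<Longrightarrow> smooth_on T f"
  unfolding smooth_on_def by (intro allI, rule n_diff_subset[of _ f S]) auto

text \<open>
  The choice of a derivative in \<open>n_diff\<close> depends on the neighbourhood; using \<open>deriv f\<close> makes the
  local choices agree.
\<close>

lemma n_diff_local:
  assumes "\<And>x. x \<in> S \<Longrightarrow> \<exists>U. open U \<and> x \<in> U \<and> smooth_on U f"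
  shows "n_diff n f S"
  using assms
proof (induction n arbitrary: f)
  case (Suc n)
  show ?case
  proof (rule n_diff_SucI[where f' = "deriv f"])
    show "(f has_real_derivative deriv f x) (at x)" if x: "x \<in> S" for x
    proof -
      obtain U where "open U" "smooth_on U f" "x \<in> U" using Suc.prems[OF x] by auto
      then show ?thesis by (rule smooth_on_deriv(1))
    qed
    show "n_diff n (deriv f) S"
    proof (rule Suc.IH)
      fix x assume "x \<in> S"
      then obtain U where "open U" "smooth_on U f" "x \<in> U" using Suc.prems by auto
      then show "\<exists>U. open U \<and> x \<in> U \<and> smooth_on U (deriv f)"
        by (intro exI[of _ U] conjI smooth_on_deriv(2))
    qed
  qed
qed simp

lemma smooth_on_local:
  assumes "\<And>x. x \<in> S \<Longrightarrow> \<exists>U. open U \<and> x \<in> U \<and> smooth_on U f"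
  shows "smooth_on S f"
  unfolding smooth_on_def
proof
  show "n_diff n f S" for n by (rule n_diff_local) (rule assms)
qed

named_theorems smooth_intros

lemma smooth_on_const [smooth_intros]: "smooth_on S (\<lambda>_. c)"
  by (simp add: smooth_on_def n_diff_const)

lemma smooth_on_ident [smooth_intros]: "smooth_on S (\<lambda>x. x)"
  by (simp add: smooth_on_def n_diff_ident)

lemma smooth_on_add [smooth_intros]:
  "smooth_on S f \<Longrightarrow> smooth_on S g \<Longrightarrow> smooth_on S (\<lambda>x. f x + g x)"
  by (simp add: smooth_on_def n_diff_add)

lemma smooth_on_mult [smooth_intros]:
  "smooth_on S f \<Longrightarrow> smooth_on S g \<Longrightarrow> smooth_on S (\<lambda>x. f x * g x)"
  by (simp add: smooth_on_def n_diff_mult)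

lemma smooth_on_compose:
  "smooth_on T f \<Longrightarrow> smooth_on S g \<Longrightarrow> (\<And>x. x \<in> S \<Longrightarrow> g x \<in> T) \<Longrightarrow> smooth_on S (\<lambda>x. f (g x))"
  unfolding smooth_on_def by (intro allI, rule n_diff_compose[of _ f T]) auto

lemma smooth_on_uminus [smooth_intros]: "smooth_on S f \<Longrightarrow> smooth_on S (\<lambda>x. - f x)"
  using smooth_on_mult[OF smooth_on_const[of S "-1"], of f] by simp

lemma smooth_on_diff [smooth_intros]:
  "smooth_on S f \<Longrightarrow> smooth_on S g \<Longrightarrow> smooth_on S (\<lambda>x. f x - g x)"
  using smooth_on_add[OF _ smooth_on_uminus, of S f g] by simp

lemma smooth_on_sum [smooth_intros]:
  "(\<And>i. i \<in> I \<Longrightarrow> smooth_on S (f i)) \<Longrightarrow> smooth_on S (\<lambda>x. \<Sum>i\<in>I. f i x)"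
  by (induction I rule: infinite_finite_induct) (simp_all add: smooth_on_const smooth_on_add)

lemma smooth_on_inverse [smooth_intros]:
  "smooth_on S f \<Longrightarrow> (\<And>x. x \<in> S \<Longrightarrow> f x \<noteq> 0) \<Longrightarrow> smooth_on S (\<lambda>x. inverse (f x))"
  by (rule smooth_on_compose[where T = "- {0}" and f = inverse]) (auto simp: smooth_on_def n_diff_inverse)

lemma smooth_on_divide [smooth_intros]:
  "smooth_on S f \<Longrightarrow> smooth_on S g \<Longrightarrow> (\<And>x. x \<in> S \<Longrightarrow> g x \<noteq> 0) \<Longrightarrow> smooth_on S (\<lambda>x. f x / g x)"
  unfolding divide_inverse by (intro smooth_intros)

lemma smooth_on_exp [smooth_intros]:
  assumes "smooth_on S f" shows "smooth_on S (\<lambda>x. exp (f x))"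
proof -
  have "n_diff n exp UNIV" for n
    by (induction n) (simp, rule n_diff_SucI[OF DERIV_exp])
  then have "smooth_on UNIV exp" by (simp add: smooth_on_def)
  from smooth_on_compose[OF this assms] show ?thesis by simp
qed

lemma smooth_on_ln [smooth_intros]:
  assumes "smooth_on S f" "\<And>x. x \<in> S \<Longrightarrow> 0 < f x" shows "smooth_on S (\<lambda>x. ln (f x))"
proof -
  have "smooth_on {0<..} (ln :: real \<Rightarrow> real)"
  proof (rule smooth_onI_deriv[where f' = "\<lambda>x. inverse x"])
    show "smooth_on {0<..} (\<lambda>x::real. inverse x)" by (intro smooth_intros) auto
  qed (auto intro: DERIV_ln)
  from smooth_on_compose[OF this assms(1)] assms(2) show ?thesis by simp
qed

lemma smooth_on_power [smooth_intros]: "smooth_on S f \<Longrightarrow> smooth_on S (\<lambda>x. f x ^ n)"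
  by (induction n) (simp_all add: smooth_on_const smooth_on_mult)

lemma smooth_on_real_polynomial_function:
  "real_polynomial_function p \<Longrightarrow> smooth_on S p"
proof (induction rule: real_polynomial_function.induct)
  case (linear f)
  then obtain c where "f = (\<lambda>x. x * c)" using real_bounded_linear by blast
  then show ?case by (simp add: smooth_on_mult smooth_on_const smooth_on_ident)
qed (simp_all add: smooth_on_mult smooth_on_const smooth_on_add)

text \<open>
  The formula \<open>g' = 1 / (f' \<circ> g)\<close> expresses the derivative of the inverse through \<open>g\<close> itself, so each
  order of differentiability of \<open>g\<close> yields the next one.
\<close>

lemma smooth_on_inverse_function:
  assumes T: "open T" and S: "open S" and f: "smooth_on S f"
    and gS: "\<And>y. y \<in> T \<Longrightarrow> g y \<in> S"
    and g: "\<And>y. y \<in> T \<Longrightarrow> (g has_real_derivative inverse (deriv f (g y))) (at y)"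
    and nz: "\<And>x. x \<in> S \<Longrightarrow> deriv f x \<noteq> 0"
  shows "smooth_on T g"
proof -
  have "n_diff n g T" for n
  proof (induction n)
    case (Suc n)
    show ?case
    proof (rule n_diff_SucI[OF g])
      show "n_diff n (\<lambda>y. inverse (deriv f (g y))) T"
      proof (rule n_diff_compose[OF _ Suc gS])
        show "n_diff n (\<lambda>x. inverse (deriv f x)) S"
          using smooth_on_inverse[OF smooth_on_deriv(2)[OF S f] nz] by (simp add: smooth_on_def)
      qed
    qed
  qed simp
  then show ?thesis by (simp add: smooth_on_def)
qed

lemma smooth_on_imp_continuous_on:
  assumes "open S" "smooth_on S f" shows "continuous_on S f"
  by (intro continuous_at_imp_continuous_on ballI DERIV_isCont[OF smooth_on_deriv(1)[OF assms]])

section \<open>The flat exponential\<close>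

text \<open>
  The function \<open>exp (- 1 / x)\<close> continued by \<open>0\<close> is flat at \<open>0\<close>.
\<close>

definition flat_exp :: "real \<Rightarrow> real" where
  "flat_exp x = (if 0 < x then exp (- inverse x) else 0)"

text \<open>
  The family \<open>x\<^sup>-\<^sup>m exp (- 1 / x)\<close>, continued by \<open>0\<close>, spans a space closed under differentiation, so
  one induction treats all its members at once.
\<close>

lemma smooth_flat_exp: "smooth_on UNIV flat_exp"
proof -
  define F where "F = (\<lambda>m x::real. if 0 < x then inverse x ^ m * exp (- inverse x) else 0)"
  have D: "(F m has_real_derivative F (m + 2) x - real m * F (m + 1) x) (at x)" for m x
  proof -
    consider "x > 0" | "x < 0" | "x = 0" by linarith
    then show ?thesis
    proof cases
      case 1
      have "((\<lambda>x. inverse x ^ m * exp (- inverse x)) has_real_derivative F (m + 2) x - real m * F (m + 1) x) (at x)"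
      proof -
        have I: "((\<lambda>x. inverse x) has_real_derivative - (inverse x * 1 * inverse x)) (at x)"
          using 1 by (intro DERIV_inverse' DERIV_ident) auto
        have "((\<lambda>x. inverse x ^ m * exp (- inverse x)) has_real_derivative
            (real m * (- (inverse x * 1 * inverse x) * inverse x ^ (m - 1))) * exp (- inverse x)
            + (exp (- inverse x) * - (- (inverse x * 1 * inverse x))) * inverse x ^ m) (at x)"
          by (rule DERIV_cong[OF DERIV_mult[OF DERIV_power[OF I, of m] DERIV_fun_exp[OF DERIV_minus[OF I]]]])
             (simp add: algebra_simps)
        moreover have "real m * (- (inverse x * 1 * inverse x) * inverse x ^ (m - 1)) * exp (- inverse x)
            + (exp (- inverse x) * - (- (inverse x * 1 * inverse x))) * inverse x ^ m
            = F (m + 2) x - real m * F (m + 1) x"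
          using 1 by (cases m) (simp_all add: F_def algebra_simps)
        ultimately show ?thesis by (rule DERIV_cong)
      qed
      then show ?thesis
        by (rule has_field_derivative_transform_within_open[where S = "{0<..}"]) (use 1 in \<open>auto simp: F_def\<close>)
    next
      case 2
      have "((\<lambda>x. 0) has_real_derivative F (m + 2) x - real m * F (m + 1) x) (at x)"
        using 2 by (auto simp: F_def)
      then show ?thesis
        by (rule has_field_derivative_transform_within_open[where S = "{..<0}"]) (use 2 in \<open>auto simp: F_def\<close>)
    next
      case 3
      \<comment> \<open>At the origin the difference quotient \<open>F m h / h\<close> is \<open>F (m + 1) h\<close> again.\<close>
      have "((\<lambda>h::real. F m h / h) \<longlongrightarrow> 0) (at_right 0)"
      proof -
        have "((\<lambda>s::real. s ^ (m+1) / exp s) \<longlongrightarrow> 0) at_top" by (rule tendsto_power_div_exp_0)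
        then have "((\<lambda>h::real. inverse h ^ (m+1) / exp (inverse h)) \<longlongrightarrow> 0) (at_right 0)"
          by (rule filterlim_compose[OF _ filterlim_inverse_at_top_right])
        then show ?thesis
        proof (rule Lim_transform_eventually)
          have "inverse h ^ (m + 1) / exp (inverse h) = F m h / h" if "0 < h" for h
            using that by (simp add: F_def exp_minus divide_inverse)
          then show "\<forall>\<^sub>F h in at_right 0. inverse h ^ (m + 1) / exp (inverse h) = F m h / h"
            by (simp add: eventually_at_filter)
        qed
      qed
      moreover have "((\<lambda>h::real. F m h / h) \<longlongrightarrow> 0) (at_left 0)"
        by (rule tendsto_eventually) (auto simp: eventually_at_filter F_def)
      ultimately have "((\<lambda>h::real. F m h / h) \<longlongrightarrow> 0) (at 0)" by (simp add: filterlim_split_at)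
      moreover have "F k 0 = 0" for k by (simp add: F_def)
      ultimately show ?thesis using 3 by (simp add: DERIV_def)
    qed
  qed
  have "n_diff n (F m) UNIV" for n m
  proof (induction n arbitrary: m)
    case (Suc n)
    show ?case
    proof (rule n_diff_SucI[OF D])
      have "n_diff n (\<lambda>x. F (m + 2) x + (- real m) * F (m + 1) x) UNIV"
        by (rule n_diff_add[OF Suc n_diff_mult[OF n_diff_const Suc]])
      then show "n_diff n (\<lambda>x. F (m + 2) x - real m * F (m + 1) x) UNIV" by simp
    qed
  qed simp
  then have "smooth_on UNIV (F 0)" unfolding smooth_on_def by blast
  moreover have "F 0 = flat_exp" by (auto simp: F_def flat_exp_def)
  ultimately show ?thesis by simp
qed

lemma smooth_on_flat_exp [smooth_intros]: "smooth_on S f \<Longrightarrow> smooth_on S (\<lambda>x. flat_exp (f x))"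
  by (rule smooth_on_compose[where T = UNIV and f = flat_exp, OF smooth_flat_exp]) auto

lemma flat_exp_bounds: "0 \<le> flat_exp x" "flat_exp x < 1" "x \<le> 0 \<Longrightarrow> flat_exp x = 0" "0 < x \<Longrightarrow> 0 < flat_exp x"
  by (auto simp: flat_exp_def)

section \<open>Inverses and reflections\<close>

lemma strict_mono_of_deriv_pos:
  assumes "smooth_on UNIV f" "\<And>x. 0 < deriv f x"
  shows "strict_mono f"
proof (rule strict_monoI)
  fix x y :: real assume "x < y"
  then show "f x < f y"
    by (rule DERIV_pos_imp_increasing) (use smooth_on_deriv(1)[OF open_UNIV assms(1)] assms(2) in blast)
qed

lemma has_derivative_inv:
  assumes "smooth_on UNIV f" "\<And>x. 0 < deriv f x" "y \<in> range f"
  shows "(inv f has_real_derivative inverse (deriv f (inv f y))) (at y)"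
proof (rule has_field_derivative_inverse_strong_x[where S = UNIV and f = f])
  show "(f has_real_derivative deriv f (inv f y)) (at (inv f y))"
    using smooth_on_deriv(1)[OF open_UNIV assms(1)] by simp
  show "deriv f (inv f y) \<noteq> 0" using assms(2)[of "inv f y"] by simp
  show "continuous_on UNIV f" by (rule smooth_on_imp_continuous_on[OF open_UNIV assms(1)])
  show "f (inv f y) = y" by (rule f_inv_into_f[OF assms(3)])
  show "inv f (f z) = z" for z
    using strict_mono_of_deriv_pos[OF assms(1,2)] by (simp add: strict_mono_imp_inj_on)
qed simp_all

lemma smooth_on_inv:
  assumes "smooth_on UNIV f" "\<And>x. 0 < deriv f x" "open T" "T \<subseteq> range f"
  shows "smooth_on T (inv f)"
proof (rule smooth_on_inverse_function[OF assms(3) open_UNIV assms(1)])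
  show "(inv f has_real_derivative inverse (deriv f (inv f y))) (at y)" if "y \<in> T" for y
    using has_derivative_inv[OF assms(1,2), of y] that assms(4) by auto
  show "deriv f x \<noteq> 0" for x using assms(2)[of x] by simp
qed simp

lemma DERIV_compose_reflect:
  assumes "(f has_real_derivative D) (at (- x))"
  shows "((\<lambda>x. - f (- x)) has_real_derivative D) (at x)"
proof -
  have "((\<lambda>x. f (- x)) has_real_derivative D * - 1) (at x)"
    by (rule DERIV_chain2[of f D uminus]) (use assms in \<open>auto intro: derivative_eq_intros\<close>)
  from DERIV_minus[OF this] show ?thesis by simp
qed

lemma smooth_on_reflect:
  assumes "smooth_on S f" shows "smooth_on (uminus ` S) (\<lambda>x. - f (- x))"
  by (rule smooth_on_uminus, rule smooth_on_compose[where f = f, OF assms])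
     (auto intro: smooth_on_uminus smooth_on_ident)

lemma deriv_reflect:
  assumes "smooth_on UNIV f" shows "deriv (\<lambda>x. - f (- x)) x = deriv f (- x)"
  by (rule DERIV_imp_deriv, rule DERIV_compose_reflect)
     (simp add: smooth_on_deriv(1)[OF open_UNIV assms])

section \<open>Transporting maps of the line to an interval\<close>

text \<open>
  A diffeomorphism from the line onto \<open>(a, b)\<close> that is affinely equivalent to \<open>-1 / ln (ln t)\<close> near
  \<open>+\<infinity>\<close> and to its mirror image near \<open>-\<infinity>\<close>, with one scale \<open>\<kappa>\<close> for both ends.
\<close>

definition compactification :: "real \<Rightarrow> real \<Rightarrow> real \<Rightarrow> (real \<Rightarrow> real) \<Rightarrow> bool" where
  "compactification a b \<kappa> \<Phi> \<longleftrightarrow> 0 < \<kappa> \<and> smooth_on UNIV \<Phi> \<and> (\<forall>t. 0 < deriv \<Phi> t) \<and>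
     (\<forall>\<^sub>F t in at_top. \<Phi> t = b - \<kappa> / ln (ln t) \<and> \<Phi> (- t) = a + \<kappa> / ln (ln t))"

lemma compactificationD:
  assumes "compactification a b \<kappa> \<Phi>"
  shows "0 < \<kappa>" "smooth_on UNIV \<Phi>" "\<And>t. 0 < deriv \<Phi> t"
    "\<forall>\<^sub>F t in at_top. \<Phi> t = b - \<kappa> / ln (ln t)" "\<forall>\<^sub>F t in at_top. \<Phi> (- t) = a + \<kappa> / ln (ln t)"
    "strict_mono \<Phi>"
proof -
  show 1: "0 < \<kappa>" "smooth_on UNIV \<Phi>" "\<And>t. 0 < deriv \<Phi> t"
    "\<forall>\<^sub>F t in at_top. \<Phi> t = b - \<kappa> / ln (ln t)" "\<forall>\<^sub>F t in at_top. \<Phi> (- t) = a + \<kappa> / ln (ln t)"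
    using assms by (auto simp: compactification_def eventually_conj_iff)
  show "strict_mono \<Phi>" by (rule strict_mono_of_deriv_pos[OF 1(2,3)])
qed

text \<open>
  Conjugation by \<open>x \<mapsto> - x\<close> exchanges the two ends, so that statements need to be proved at the right
  end only.
\<close>

lemma compactification_reflect:
  assumes "compactification a b \<kappa> \<Phi>"
  shows "compactification (- b) (- a) \<kappa> (\<lambda>t. - \<Phi> (- t))"
  using compactificationD[OF assms] smooth_on_reflect[of UNIV \<Phi>]
  by (auto simp: compactification_def eventually_conj_iff deriv_reflect surj_uminus elim: eventually_mono)

lemma compactification_less:
  assumes "compactification a b \<kappa> \<Phi>"
  shows "\<Phi> t < b"
proof -
  have "\<forall>\<^sub>F s in at_top. \<Phi> s = b - \<kappa> / ln (ln s) \<and> ln (ln s) > 0 \<and> s > t"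
    by (intro eventually_conj compactificationD(4)[OF assms] eventually_gt_at_top) real_asymp
  then obtain s where "\<Phi> s = b - \<kappa> / ln (ln s)" "ln (ln s) > 0" "s > t"
    using eventually_happens by fastforce
  moreover have "\<Phi> t < \<Phi> s" using compactificationD(6)[OF assms] \<open>s > t\<close> by (simp add: strict_mono_less)
  ultimately show ?thesis using compactificationD(1)[OF assms] by (smt (verit) divide_pos_pos)
qed

lemma compactification_approaches:
  assumes "compactification a b \<kappa> \<Phi>" "x < b"
  shows "\<exists>t. x < \<Phi> t"
proof -
  have "((\<lambda>s. b - \<kappa> / ln (ln s)) \<longlongrightarrow> b) at_top" by real_asymp
  then have "\<forall>\<^sub>F s in at_top. x < b - \<kappa> / ln (ln s)" using assms(2) by (rule order_tendstoD)
  then have "\<forall>\<^sub>F s in at_top. x < \<Phi> s"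
    using compactificationD(4)[OF assms(1)] by eventually_elim simp
  then show ?thesis using eventually_happens by fastforce
qed

lemma compactification_range:
  assumes "compactification a b \<kappa> \<Phi>"
  shows "range \<Phi> = {a<..<b}"
proof
  show "range \<Phi> \<subseteq> {a<..<b}"
    using compactification_less[OF assms] compactification_less[OF compactification_reflect[OF assms], of "- _"]
    by auto
  show "{a<..<b} \<subseteq> range \<Phi>"
  proof
    fix x assume x: "x \<in> {a<..<b}"
    obtain t where t: "x < \<Phi> t" using compactification_approaches[OF assms] x by auto
    obtain s where s: "\<Phi> (- s) < x"
      using compactification_approaches[OF compactification_reflect[OF assms], of "- x"] x by auto
    have "- s \<le> t"
      using s t compactificationD(6)[OF assms] by (meson less_trans order.strict_implies_order strict_mono_less)
    moreover have "continuous_on {-s..t} \<Phi>"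
      using smooth_on_imp_continuous_on[OF open_UNIV compactificationD(2)[OF assms]] continuous_on_subset by blast
    ultimately show "x \<in> range \<Phi>" using IVT'[of \<Phi> "-s" x t] s t by auto
  qed
qed

lemma compactification_inv:
  assumes "compactification a b \<kappa> \<Phi>"
  shows "inv \<Phi> (\<Phi> t) = t" "x \<in> {a<..<b} \<Longrightarrow> \<Phi> (inv \<Phi> x) = x"
  using strict_mono_imp_inj_on[OF compactificationD(6)[OF assms]] compactification_range[OF assms]
    f_inv_into_f[of x \<Phi> UNIV] by auto

definition transport :: "real \<Rightarrow> real \<Rightarrow> (real \<Rightarrow> real) \<Rightarrow> (real \<Rightarrow> real) \<Rightarrow> real \<Rightarrow> real" where
  "transport a b \<Phi> S x = (if x \<in> {a<..<b} then \<Phi> (S (inv \<Phi> x)) else x)"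

lemma transport_outside: "x \<notin> {a<..<b} \<Longrightarrow> transport a b \<Phi> S x = x"
  by (simp add: transport_def del: greaterThanLessThan_iff)

lemma transport_param:
  assumes "compactification a b \<kappa> \<Phi>"
  shows "transport a b \<Phi> S (\<Phi> t) = \<Phi> (S t)"
proof -
  have "\<Phi> t \<in> {a<..<b}" using compactification_range[OF assms] by blast
  then show ?thesis by (simp add: transport_def compactification_inv[OF assms] del: greaterThanLessThan_iff)
qed

lemma transport_cases:
  assumes "compactification a b \<kappa> \<Phi>"
  obtains t where "x = \<Phi> t" | "x \<notin> {a<..<b}"
  using compactification_range[OF assms] by blast

lemma transport_comp:
  assumes "compactification a b \<kappa> \<Phi>"
  shows "transport a b \<Phi> S (transport a b \<Phi> R x) = transport a b \<Phi> (\<lambda>t. S (R t)) x"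
  by (rule transport_cases[OF assms, of x]) (simp_all add: transport_param[OF assms] transport_outside del: greaterThanLessThan_iff)

lemma transport_reflect:
  assumes "compactification a b \<kappa> \<Phi>"
  shows "transport (- b) (- a) (\<lambda>t. - \<Phi> (- t)) (\<lambda>t. - S (- t)) = (\<lambda>x. - transport a b \<Phi> S (- x))"
proof
  fix x show "transport (- b) (- a) (\<lambda>t. - \<Phi> (- t)) (\<lambda>t. - S (- t)) x = - transport a b \<Phi> S (- x)"
  proof (rule transport_cases[OF assms, of "- x"])
  fix t assume t: "- x = \<Phi> t"
  then have x: "x = - \<Phi> (- (- t))" by simp
  show ?thesis
    using transport_param[OF compactification_reflect[OF assms], of "\<lambda>t. - S (- t)" "- t"] 
    unfolding x by (simp add: transport_param[OF assms])
next
  assume "- x \<notin> {a<..<b}"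
  then have "x \<notin> {-b<..<-a}" by auto
  with \<open>- x \<notin> {a<..<b}\<close> show ?thesis by (simp add: transport_outside del: greaterThanLessThan_iff)
  qed
qed

text \<open>
  The condition under which a map of the line becomes smooth at the right end of the interval:
  in the coordinate \<open>y = 1 / ln (ln t)\<close> the displacement of \<open>ln t\<close> is a smooth function up to \<open>y = 0\<close>.
\<close>

definition flat_at_top :: "(real \<Rightarrow> real) \<Rightarrow> bool" where
  "flat_at_top S \<longleftrightarrow> filterlim S at_top at_top \<and>
     (\<exists>u. smooth_on UNIV u \<and> (\<forall>\<^sub>F t in at_top. ln (S t) = ln t + u (1 / ln (ln t))))"

text \<open>
  This \<open>K\<close> is the map in the coordinate \<open>y\<close> (see \<open>loglog_shift\<close>).  It is given by one formula on both sides
  of \<open>0\<close>, and reduces to \<open>K y = y\<close> for \<open>y \<le> 0\<close> because \<open>flat_exp\<close> vanishes there.  Hence its smoothness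
  includes the smooth matching with the identity at the end of the interval.
\<close>

lemma flat_germ:
  assumes "smooth_on UNIV u"
  defines "K \<equiv> \<lambda>y. y / (1 + y * ln (1 + flat_exp y * u y))"
  shows "\<exists>V. open V \<and> {..0} \<subseteq> V \<and> smooth_on V K"
proof -
  define v where "v = (\<lambda>y. 1 + flat_exp y * u y)"
  define V where "V = v -` {0<..}"
  have v: "smooth_on UNIV v" unfolding v_def by (intro smooth_intros assms(1))
  have V: "open V" unfolding V_def
    using smooth_on_imp_continuous_on[OF open_UNIV v] by (intro open_vimage) auto
  define w where "w = (\<lambda>y. 1 + y * ln (v y))"
  define W where "W = V \<inter> w -` {0<..}"
  have w: "smooth_on V w" unfolding w_def
    by (intro smooth_intros smooth_on_subset[OF v]) (auto simp: V_def)
  have W: "open W" unfolding W_def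
    using smooth_on_imp_continuous_on[OF V w] by (intro continuous_open_preimage V) auto
  have "smooth_on W (\<lambda>y. y / w y)"
    by (intro smooth_intros smooth_on_subset[OF w]) (auto simp: W_def)
  moreover have "(\<lambda>y. y / w y) = K" by (simp add: K_def w_def v_def)
  moreover have "{..0} \<subseteq> W" by (auto simp: W_def V_def w_def v_def flat_exp_bounds)
  ultimately show ?thesis using W by auto
qed

text \<open>
  With \<open>y = 1 / ln (ln t)\<close> one has \<open>flat_exp y = 1 / ln t\<close>.  So adding \<open>u y\<close> to \<open>ln t\<close> multiplies it by
  \<open>1 + flat_exp y * u y\<close> and adds the logarithm of this factor to \<open>ln (ln t) = 1 / y\<close>.
\<close>

lemma loglog_shift:
  assumes "1 < ln t" "1 < ln s" "ln s = ln t + u (1 / ln (ln t))"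
  defines "y \<equiv> 1 / ln (ln t)"
  shows "1 / ln (ln s) = y / (1 + y * ln (1 + flat_exp y * u y))"
proof -
  have L: "ln (ln t) > 0" using assms(1) by simp
  then have e: "flat_exp y = 1 / ln t" using assms(1)
    by (simp add: flat_exp_def y_def exp_minus inverse_eq_divide)
  have "ln s = ln t * (1 + flat_exp y * u y)" using assms(1,3)
    unfolding e by (simp add: y_def algebra_simps)
  moreover from this have "1 + flat_exp y * u y > 0" using assms(1,2)
    by (smt (verit) zero_less_mult_pos)
  ultimately have "ln (ln s) = ln (ln t) + ln (1 + flat_exp y * u y)" using assms(1)
    by (simp add: ln_mult)
  also have "\<dots> = (1 + y * ln (1 + flat_exp y * u y)) / y" using L by (simp add: y_def field_simps)
  finally show ?thesis by simp
qed

text \<open>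
  Near \<open>b\<close>, on either side, the transported map is \<open>x \<mapsto> b - \<kappa> K ((b - x) / \<kappa>)\<close> with the germ \<open>K\<close> of
  \<open>flat_germ\<close>.
\<close>

lemma smooth_transport_right_end:
  assumes "compactification a b \<kappa> \<Phi>" "flat_at_top S"
  shows "\<exists>U. open U \<and> {b..} \<subseteq> U \<and> smooth_on U (transport a b \<Phi> S)"
proof -
  note C = compactificationD[OF assms(1)]
  obtain u where S: "filterlim S at_top at_top" and u: "smooth_on UNIV u"
    "\<forall>\<^sub>F t in at_top. ln (S t) = ln t + u (1 / ln (ln t))"
    using assms(2) by (auto simp: flat_at_top_def)
  define K where "K = (\<lambda>y. y / (1 + y * ln (1 + flat_exp y * u y)))"
  obtain V where V: "open V" "{..0} \<subseteq> V" "smooth_on V K"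
    using flat_germ[OF u(1)] unfolding K_def by blast
  have l: "\<forall>\<^sub>F t in at_top. 1 < ln (t::real)" by real_asymp
  have "\<forall>\<^sub>F t in at_top. \<Phi> t = b - \<kappa> / ln (ln t) \<and> ln (S t) = ln t + u (1 / ln (ln t))
    \<and> \<Phi> (S t) = b - \<kappa> / ln (ln (S t)) \<and> 1 < ln t \<and> 1 < ln (S t)"
    by (intro eventually_conj C u l eventually_compose_filterlim[OF C(4) S] eventually_compose_filterlim[OF l S])
  then obtain t0 where t0: "\<And>t. t \<ge> t0 \<Longrightarrow> \<Phi> t = b - \<kappa> / ln (ln t) \<and> ln (S t) = ln t + u (1 / ln (ln t))
    \<and> \<Phi> (S t) = b - \<kappa> / ln (ln (S t)) \<and> 1 < ln t \<and> 1 < ln (S t)"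
    unfolding eventually_at_top_linorder by blast
  \<comment> \<open>From \<open>b\<close> on, the coordinate \<open>(b - x) / \<kappa>\<close> is at most \<open>0\<close> and so remains in \<open>V\<close>.\<close>
  define U where "U = {\<Phi> t0<..} \<inter> (\<lambda>x. (b - x) / \<kappa>) -` V"
  have "open ((\<lambda>x. (b - x) / \<kappa>) -` V)"
    using V(1) C(1) by (intro open_vimage continuous_intros) auto
  then have U: "open U" by (auto simp: U_def)
  have bU: "{b..} \<subseteq> U"
  proof
    fix x assume "x \<in> {b..}"
    moreover from this have "(b - x) / \<kappa> \<le> 0" using C(1) by (simp add: divide_le_0_iff)
    ultimately show "x \<in> U" using V(2) compactification_less[OF assms(1), of t0] by (auto simp: U_def)
  qed
  have germ: "smooth_on U (\<lambda>x. b - \<kappa> * K ((b - x) / \<kappa>))"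
    by (intro smooth_intros smooth_on_compose[OF V(3)]) (use C(1) in \<open>auto simp: U_def\<close>)
  have "b - \<kappa> * K ((b - x) / \<kappa>) = transport a b \<Phi> S x" if x: "x \<in> U" for x
  proof (cases "x < b")
    case False
    then have "(b - x) / \<kappa> \<le> 0" using C(1) by (simp add: divide_le_0_iff)
    then have "K ((b - x) / \<kappa>) = (b - x) / \<kappa>" by (simp add: K_def flat_exp_bounds)
    then show ?thesis using False C(1) by (simp add: transport_outside)
  next
    case True
    have "\<Phi> t0 < x" using x by (simp add: U_def)
    moreover have "a < \<Phi> t0" using compactification_range[OF assms(1)] by (metis greaterThanLessThan_iff rangeI)
    ultimately obtain t where t: "x = \<Phi> t" using compactification_range[OF assms(1)] True 
      by (metis greaterThanLessThan_iff imageE less_trans)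
    then have "t \<ge> t0" using \<open>\<Phi> t0 < x\<close> C(6) by (simp add: strict_mono_less)
    note T = t0[OF this]
    have "(b - x) / \<kappa> = 1 / ln (ln t)" using T t C(1) by simp
    then have K: "K ((b - x) / \<kappa>) = 1 / ln (ln (S t))"
      using loglog_shift[of t "S t" u] T unfolding K_def by metis
    have "transport a b \<Phi> S x = b - \<kappa> / ln (ln (S t))"
      using T unfolding t transport_param[OF assms(1)] by blast
    then show ?thesis unfolding K by simp
  qed
  then have "smooth_on U (transport a b \<Phi> S)" by (rule smooth_on_cong[OF U _ germ])
  then show ?thesis using U bU by blast
qed

definition supported_diffeo :: "real \<Rightarrow> real \<Rightarrow> (real \<Rightarrow> real) \<Rightarrow> bool" where
  "supported_diffeo a b g \<longleftrightarrow> smooth_on UNIV g \<and> (\<forall>x. 0 < deriv g x) \<and> (\<forall>x. x \<notin> {a<..<b} \<longrightarrow> g x = x)"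

text \<open>
  At \<open>a\<close> and \<open>b\<close> themselves the derivative is computed from the side on which \<open>g\<close> is the identity.
\<close>

lemma deriv_eq_1_outside:
  assumes "smooth_on UNIV g" "\<And>x. x \<notin> {a<..<b} \<Longrightarrow> g x = x" "x \<notin> {a<..<b}"
  shows "deriv g x = 1"
proof -
  have D: "(g has_real_derivative deriv g x) (at x)" using smooth_on_deriv(1)[OF open_UNIV assms(1)] by simp
  have uniq: "deriv g x = 1" if "\<And>y. y \<in> S \<Longrightarrow> g y = y" "x \<in> S" "at x within S \<noteq> bot" for S
  proof -
    have "(g has_real_derivative deriv g x) (at x within S)" by (rule has_field_derivative_at_within[OF D])
    then have "((\<lambda>x. x) has_real_derivative deriv g x) (at x within S)"
      by (rule has_field_derivative_transform_within[where d = 1]) (use that in auto)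
    moreover have "((\<lambda>x. x) has_real_derivative 1) (at x within S)" by (rule DERIV_ident)
    ultimately show ?thesis
      unfolding has_real_derivative_iff_has_vector_derivative
      by (rule vector_derivative_unique_within[OF that(3)])
  qed
  consider "x \<ge> b" | "x \<le> a" using assms(3) by force
  then show ?thesis
  proof cases
    case 1
    then show ?thesis by (intro uniq[of "{x..}"] assms(2)) (auto simp: at_within_Ici_at_right)
  next
    case 2
    then show ?thesis by (intro uniq[of "{..x}"] assms(2)) (auto simp: at_within_Iic_at_left)
  qed
qed

lemma supported_diffeo_transport:
  assumes "compactification a b \<kappa> \<Phi>" "smooth_on UNIV S" "\<And>t. 0 < deriv S t"
    "flat_at_top S" "flat_at_top (\<lambda>t. - S (- t))"
  shows "supported_diffeo a b (transport a b \<Phi> S)"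
    and "(transport a b \<Phi> S has_real_derivative deriv \<Phi> (S t) * deriv S t / deriv \<Phi> t) (at (\<Phi> t))"
proof -
  note C = compactificationD[OF assms(1)]
  let ?F = "transport a b \<Phi> S"
  have sm: "smooth_on {a<..<b} ?F"
  proof (rule smooth_on_cong)
    show "smooth_on {a<..<b} (\<lambda>x. \<Phi> (S (inv \<Phi> x)))"
    proof (rule smooth_on_compose[where f = \<Phi>, OF C(2)])
      show "smooth_on {a<..<b} (\<lambda>x. S (inv \<Phi> x))"
      proof (rule smooth_on_compose[where f = S, OF assms(2)])
        show "smooth_on {a<..<b} (inv \<Phi>)"
          by (rule smooth_on_inv[OF C(2,3)]) (simp_all add: compactification_range[OF assms(1)])
      qed simp
    qed simp
  qed (auto simp: transport_def)
  obtain U where U: "open U" "{b..} \<subseteq> U" "smooth_on U ?F"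
    using smooth_transport_right_end[OF assms(1,4)] by blast
  obtain U' where U': "open U'" "{-a..} \<subseteq> U'" 
      "smooth_on U' (transport (- b) (- a) (\<lambda>t. - \<Phi> (- t)) (\<lambda>t. - S (- t)))"
    using smooth_transport_right_end[OF compactification_reflect[OF assms(1)] assms(5)] by blast
  have "smooth_on (uminus ` U') (\<lambda>x. - (- ?F (- (- x))))"
    by (rule smooth_on_reflect[where f = "\<lambda>x. - ?F (- x)"]) (use U'(3) in \<open>simp only: transport_reflect[OF assms(1)]\<close>)
  then have U'3: "smooth_on (uminus ` U') ?F" by simp
  have U'1: "open (uminus ` U')" using open_negations[OF U'(1)] by simp
  have smF: "smooth_on UNIV ?F"
  proof (rule smooth_on_local)
    fix x :: real
    consider "x \<in> {a<..<b}" | "x \<in> U" | "- x \<in> U'"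
      using subsetD[OF U(2), of x] subsetD[OF U'(2), of "- x"] by fastforce
    then show "\<exists>U. open U \<and> x \<in> U \<and> smooth_on U ?F"
    proof cases
      case 1
      then show ?thesis using sm by (intro exI[of _ "{a<..<b}"]) simp
    next
      case 2
      then show ?thesis using U by (intro exI[of _ U]) simp
    next
      case 3
      then have "x \<in> uminus ` U'" by (metis image_eqI minus_minus)
      with U'1 U'3 show ?thesis by (intro exI[of _ "uminus ` U'"]) simp
    qed
  qed
  show D: "(?F has_real_derivative deriv \<Phi> (S t) * deriv S t / deriv \<Phi> t) (at (\<Phi> t))" for t
  proof -
    have dP: "(\<Phi> has_real_derivative deriv \<Phi> x) (at x)" for x using smooth_on_deriv(1)[OF open_UNIV C(2)] by simp
    have dS: "(S has_real_derivative deriv S x) (at x)" for x using smooth_on_deriv(1)[OF open_UNIV assms(2)] by simp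
    have inv: "inv \<Phi> (\<Phi> t) = t" by (rule compactification_inv[OF assms(1)])
    have dI: "(inv \<Phi> has_real_derivative inverse (deriv \<Phi> t)) (at (\<Phi> t))"
      using has_derivative_inv[OF C(2,3), of "\<Phi> t"] by (simp add: inv)
    have "((\<lambda>x. S (inv \<Phi> x)) has_real_derivative deriv S t * inverse (deriv \<Phi> t)) (at (\<Phi> t))"
      by (rule DERIV_chain2[of S _ "inv \<Phi>", OF _ dI]) (simp add: inv dS)
    then have "((\<lambda>x. \<Phi> (S (inv \<Phi> x))) has_real_derivative deriv \<Phi> (S t) * (deriv S t * inverse (deriv \<Phi> t))) (at (\<Phi> t))"
      by (intro DERIV_chain2[of \<Phi> "deriv \<Phi> (S t)" "\<lambda>x. S (inv \<Phi> x)"]) (simp_all add: inv dP)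
    then have "(?F has_real_derivative deriv \<Phi> (S t) * (deriv S t * inverse (deriv \<Phi> t))) (at (\<Phi> t))"
      by (rule has_field_derivative_transform_within_open[where S = "{a<..<b}"])
         (use compactification_range[OF assms(1)] in \<open>auto simp: transport_def\<close>)
    then show ?thesis by (simp add: divide_inverse mult_ac)
  qed
  have "0 < deriv ?F x" for x
  proof (rule transport_cases[OF assms(1), of x])
    fix t assume "x = \<Phi> t"
    then show ?thesis using DERIV_imp_deriv[OF D[of t]] C(3) assms(3) by simp
  next
    assume "x \<notin> {a<..<b}"
    then show ?thesis using deriv_eq_1_outside[OF smF transport_outside] by simp
  qed
  then show "supported_diffeo a b ?F" using smF transport_outside by (auto simp: supported_diffeo_def)
qed

text \<open>
  The displacement \<open>ln (t \<plusminus> 1) - ln t = ln (1 \<plusminus> 1 / t)\<close> of a translation is smooth in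
  \<open>y = 1 / ln (ln t)\<close> because \<open>1 / t\<close> is.
\<close>

lemma flat_exp_flat_exp_loglog:
  assumes "0 < t" "1 < ln t" shows "flat_exp (flat_exp (1 / ln (ln t))) = 1 / t"
proof -
  have "0 < ln (ln t)" "exp (ln (ln t)) = ln t" using assms(2) by simp_all
  then show ?thesis using assms(1) by (simp add: flat_exp_def exp_minus inverse_eq_divide)
qed

lemma flat_at_top_plus_1: "flat_at_top (\<lambda>t. t + 1)"
  unfolding flat_at_top_def
proof (intro conjI exI[of _ "\<lambda>y. ln (1 + flat_exp (flat_exp y))"])
  show "filterlim (\<lambda>t::real. t + 1) at_top at_top" by real_asymp
  show "smooth_on UNIV (\<lambda>y. ln (1 + flat_exp (flat_exp y)))"
    by (intro smooth_intros) (auto simp: flat_exp_bounds add_pos_nonneg)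
  have "\<forall>\<^sub>F t in at_top. 1 < ln (t::real)" by real_asymp
  then show "\<forall>\<^sub>F t in at_top. ln (t + 1) = ln t + ln (1 + flat_exp (flat_exp (1 / ln (ln t))))"
    using eventually_gt_at_top[of 1]
  proof eventually_elim
    case (elim t)
    then have "t + 1 = t * (1 + 1 / t)" by (simp add: field_simps)
    moreover have "1 + 1 / t > 0" using elim by (simp add: add_pos_pos)
    ultimately show ?case using elim by (simp add: flat_exp_flat_exp_loglog ln_mult)
  qed
qed

lemma flat_at_top_minus_1: "flat_at_top (\<lambda>t. t - 1)"
  unfolding flat_at_top_def
proof (intro conjI exI[of _ "\<lambda>y. ln (1 - flat_exp (flat_exp y))"])
  show "filterlim (\<lambda>t::real. t - 1) at_top at_top" by real_asymp
  show "smooth_on UNIV (\<lambda>y. ln (1 - flat_exp (flat_exp y)))"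
    by (intro smooth_intros) (auto simp: flat_exp_bounds)
  have "\<forall>\<^sub>F t in at_top. 1 < ln (t::real)" by real_asymp
  then show "\<forall>\<^sub>F t in at_top. ln (t - 1) = ln t + ln (1 - flat_exp (flat_exp (1 / ln (ln t))))"
    using eventually_gt_at_top[of 1]
  proof eventually_elim
    case (elim t)
    then have "t - 1 = t * (1 - 1 / t)" by (simp add: field_simps)
    moreover have "1 - 1 / t > 0" using elim by (simp add: field_simps)
    ultimately show ?case using elim by (simp add: flat_exp_flat_exp_loglog ln_mult)
  qed
qed

lemma flat_at_top_scale: 
  assumes "0 < (c::real)" shows "flat_at_top (\<lambda>t. c * t)"
  unfolding flat_at_top_def
proof (intro conjI exI[of _ "\<lambda>y. ln c"])
  show "filterlim (\<lambda>t. c * t) at_top at_top" using assms by real_asymp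
  show "\<forall>\<^sub>F t in at_top. ln (c * t) = ln t + ln c"
    using eventually_gt_at_top[of 0] by eventually_elim (use assms in \<open>simp add: ln_mult\<close>)
qed (intro smooth_intros)

text \<open>
  The affine relation \<open>k (t + 1) = k t + k\<close>, transported to the interval.
\<close>

lemma transport_conjugacy:
  assumes C: "compactification a b \<kappa> \<Phi>"
  defines "g \<equiv> transport a b \<Phi> (\<lambda>t. t + 1)"
  shows "supported_diffeo a b g"
    and "\<And>t. (g has_real_derivative deriv \<Phi> (t + 1) / deriv \<Phi> t) (at (\<Phi> t))"
    and "\<And>x. x \<in> {a<..<b} \<Longrightarrow> g x \<noteq> x"
    and "\<And>k::nat. 1 \<le> k \<Longrightarrow> \<exists>h. supported_diffeo a b h \<and> (\<forall>x. h (g x) = (g ^^ k) (h x))"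
proof -
  have d: "deriv (\<lambda>t::real. t + 1) t = 1" for t
    by (rule DERIV_imp_deriv) (auto intro!: derivative_eq_intros)
  \<comment> \<open>Seen from \<open>-\<infinity>\<close> the translation moves towards the origin, hence the case of \<open>t - 1\<close>.\<close>
  have f: "flat_at_top (\<lambda>t. - (- t + 1))" using flat_at_top_minus_1 by (simp add: algebra_simps)
  have s: "smooth_on UNIV (\<lambda>t::real. t + 1)" by (intro smooth_intros)
  note T = supported_diffeo_transport[OF C s _ flat_at_top_plus_1 f, unfolded d]
  show "supported_diffeo a b g" unfolding g_def by (rule T) simp
  show "(g has_real_derivative deriv \<Phi> (t + 1) / deriv \<Phi> t) (at (\<Phi> t))" for t
    using T(2)[of t] by (simp add: g_def)
  show "g x \<noteq> x" if "x \<in> {a<..<b}" for x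
  proof -
    obtain t where t: "x = \<Phi> t" using \<open>x \<in> {a<..<b}\<close> compactification_range[OF C] by blast
    then have "g x = \<Phi> (t + 1)" by (simp only: g_def transport_param[OF C])
    then show ?thesis using t strict_mono_eq[OF compactificationD(6)[OF C], of "t + 1" t] by simp
  qed
  have it: "(g ^^ n) x = transport a b \<Phi> (\<lambda>t. t + real n) x" for n x
  proof (induction n)
    case 0
    show ?case by (rule transport_cases[OF C, of x]) 
      (simp_all add: transport_param[OF C] transport_outside del: greaterThanLessThan_iff)
  next
    case (Suc n)
    have "(g ^^ Suc n) x = transport a b \<Phi> (\<lambda>t. t + 1) (transport a b \<Phi> (\<lambda>t. t + real n) x)"
      by (simp add: Suc) (simp add: g_def)
    then show ?case by (simp add: transport_comp[OF C] algebra_simps)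
  qed
  fix k :: nat assume k: "1 \<le> k"
  have dk: "deriv (\<lambda>t::real. real k * t) t = real k" for t
    by (rule DERIV_imp_deriv) (auto intro!: derivative_eq_intros)
  have "supported_diffeo a b (transport a b \<Phi> (\<lambda>t. real k * t))"
    by (rule supported_diffeo_transport[OF C])
       (use k in \<open>auto simp: dk flat_at_top_scale intro!: smooth_intros\<close>)
  moreover have "transport a b \<Phi> (\<lambda>t. real k * t) (g x) = (g ^^ k) (transport a b \<Phi> (\<lambda>t. real k * t) x)" for x
    unfolding it by (simp add: g_def transport_comp[OF C] algebra_simps)
  ultimately show "\<exists>h. supported_diffeo a b h \<and> (\<forall>x. h (g x) = (g ^^ k) (h x))" by blast
qed

section \<open>Conjugating a map without interior fixed points to the translation\<close>

lemma DERIV_glue: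
  fixes p q :: "real \<Rightarrow> real"
  assumes "(p has_real_derivative D) (at c)" "(q has_real_derivative D) (at c)" "p c = q c"
  shows "((\<lambda>s. if s \<le> c then p s else q s) has_real_derivative D) (at c)"
proof -
  let ?h = "\<lambda>s. if s \<le> c then p s else q s"
  have "((\<lambda>y. (?h y - ?h c) / (y - c)) \<longlongrightarrow> D) (at_left c)"
  proof (rule Lim_transform_eventually)
    show "((\<lambda>y. (p y - p c) / (y - c)) \<longlongrightarrow> D) (at_left c)"
      using assms(1) by (simp add: has_field_derivative_iff filterlim_split_at)
         (simp add: filterlim_at_split)
    show "\<forall>\<^sub>F y in at_left c. (p y - p c) / (y - c) = (?h y - ?h c) / (y - c)"
      by (simp add: eventually_at_filter)
  qed
  moreover have "((\<lambda>y. (?h y - ?h c) / (y - c)) \<longlongrightarrow> D) (at_right c)"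
  proof (rule Lim_transform_eventually)
    show "((\<lambda>y. (q y - q c) / (y - c)) \<longlongrightarrow> D) (at_right c)"
      using assms(2) by (simp add: has_field_derivative_iff filterlim_at_split)
    show "\<forall>\<^sub>F y in at_right c. (q y - q c) / (y - c) = (?h y - ?h c) / (y - c)"
      using assms(3) by (simp add: eventually_at_filter)
  qed
  ultimately show ?thesis by (simp add: has_field_derivative_iff filterlim_at_split)
qed

text \<open>
  The conjugacy \<open>\<phi>\<close> to the translation constructed here is only \<open>C\<^sup>1\<close>, like \<open>f\<close>.
\<close>

locale pushing_map =
  fixes a b :: real and f f' :: "real \<Rightarrow> real"
  assumes ab: "a < b"
    and cont: "continuous_on {a..b} f" and fixed: "f a = a" "f b = b"
    and deriv: "\<And>x. x \<in> {a<..<b} \<Longrightarrow> (f has_real_derivative f' x) (at x)"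
    and pos: "\<And>x. x \<in> {a<..<b} \<Longrightarrow> 0 < f' x"
    and cont': "continuous_on {a<..<b} f'"
    and above: "\<And>x. x \<in> {a<..<b} \<Longrightarrow> x < f x"
begin

lemma mono: 
  assumes "a \<le> x" "x < y" "y \<le> b" shows "f x < f y"
proof (rule DERIV_pos_imp_increasing_open[OF assms(2)])
  show "\<exists>D. (f has_real_derivative D) (at z) \<and> 0 < D" if "x < z" "z < y" for z
    using deriv[of z] pos[of z] that assms by auto
  show "continuous_on {x..y} f" by (rule continuous_on_subset[OF cont]) (use assms in auto)
qed

lemma maps: "x \<in> {a<..<b} \<Longrightarrow> f x \<in> {a<..<b}"
  using mono[of a x] mono[of x b] fixed by auto

lemma bij: "bij_betw f {a<..<b} {a<..<b}"
  unfolding bij_betw_def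
proof
  show "inj_on f {a<..<b}"
  proof (rule inj_onI, rule ccontr)
    fix x y assume xy: "x \<in> {a<..<b}" "y \<in> {a<..<b}" "f x = f y" "x \<noteq> y"
    then consider "x < y" | "y < x" by linarith
    then show False by cases (use mono[of x y] mono[of y x] xy in auto)
  qed
  show "f ` {a<..<b} = {a<..<b}"
  proof
    show "f ` {a<..<b} \<subseteq> {a<..<b}" using maps by blast
    show "{a<..<b} \<subseteq> f ` {a<..<b}"
    proof
      fix y assume y: "y \<in> {a<..<b}"
      then obtain x where x: "a \<le> x" "x \<le> b" "f x = y"
        using IVT'[of f a y b] fixed cont by auto
      then have "x \<noteq> a" "x \<noteq> b" using y fixed by auto
      then show "y \<in> f ` {a<..<b}" using x by (auto intro!: image_eqI[of _ f x])
    qed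
  qed
qed

definition finv where "finv = inv_into {a<..<b} f"

lemma finv_maps: "y \<in> {a<..<b} \<Longrightarrow> finv y \<in> {a<..<b}"
  using bij inv_into_into[of y f "{a<..<b}"] unfolding finv_def bij_betw_def by simp

lemma f_finv: "y \<in> {a<..<b} \<Longrightarrow> f (finv y) = y"
  using bij f_inv_into_f[of y f "{a<..<b}"] unfolding finv_def bij_betw_def by simp

lemma finv_f: "x \<in> {a<..<b} \<Longrightarrow> finv (f x) = x"
  using bij inv_into_f_f[of f "{a<..<b}" x] unfolding finv_def bij_betw_def by simp

lemma finv_deriv:
  assumes "y \<in> {a<..<b}" shows "(finv has_real_derivative inverse (f' (finv y))) (at y)"
proof (rule has_field_derivative_inverse_strong_x[where S = "{a<..<b}" and f = f])
  show "(f has_real_derivative f' (finv y)) (at (finv y))" by (rule deriv[OF finv_maps[OF assms]])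
  show "f' (finv y) \<noteq> 0" using pos[OF finv_maps[OF assms]] by simp
  show "continuous_on {a<..<b} f" by (rule continuous_on_subset[OF cont]) auto
qed (simp_all add: finv_maps[OF assms] f_finv[OF assms] finv_f del: greaterThanLessThan_iff)

definition iter :: "int \<Rightarrow> real \<Rightarrow> real" where
  "iter n = (if 0 \<le> n then f ^^ nat n else finv ^^ nat (- n))"

lemma iter_maps: "x \<in> {a<..<b} \<Longrightarrow> iter n x \<in> {a<..<b}"
proof -
  assume x: "x \<in> {a<..<b}"
  have "(f ^^ m) x \<in> {a<..<b}" "(finv ^^ m) x \<in> {a<..<b}" for m
    by (induction m) (simp_all add: x maps finv_maps del: greaterThanLessThan_iff)
  then show ?thesis by (simp add: iter_def del: greaterThanLessThan_iff)
qed

lemma iter_plus_1: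
  assumes x: "x \<in> {a<..<b}" shows "iter (n + 1) x = f (iter n x)"
proof (cases "0 \<le> n")
  case True
  then have "nat (n + 1) = Suc (nat n)" by simp
  then show ?thesis using True by (simp add: iter_def)
next
  case False
  then have n: "nat (- n) = Suc (nat (- n - 1))" by simp
  have "iter n x = finv (iter (n + 1) x)" 
    using False n by (cases "n = -1") (auto simp: iter_def)
  then show ?thesis using f_finv[OF iter_maps[OF x, of "n + 1"]] by simp
qed

text \<open>
  On the fundamental domain \<open>[0, 1]\<close> the conjugacy is a quadratic polynomial.  Its three coefficients are
  determined by the values \<open>base\<close> and \<open>f base\<close> at the ends and by the relation
  \<open>seed' 1 = f' base * seed' 0\<close>, which makes the extension by \<open>f\<close> continuously differentiable at \<open>1\<close>.
\<close>

definition base :: real where "base = (a + b) / 2"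
definition slope :: real where "slope = 2 * (f base - base) / (1 + f' base)"
definition seed :: "real \<Rightarrow> real" where
  "seed t = base + slope * (t + (f' base - 1) * t\<^sup>2 / 2)"
definition seed' :: "real \<Rightarrow> real" where "seed' t = slope * (1 + (f' base - 1) * t)"

lemma base: "base \<in> {a<..<b}" using ab by (auto simp: base_def)

lemma slope_pos: "0 < slope"
  using above[OF base] pos[OF base] by (simp add: slope_def)

lemma seed_deriv: "(seed has_real_derivative seed' t) (at t)"
  unfolding seed_def[abs_def] seed'_def by (auto intro!: derivative_eq_intros simp: field_simps)

lemma seed'_pos: "0 \<le> t \<Longrightarrow> t \<le> 1 \<Longrightarrow> 0 < seed' t"
proof -
  assume t: "0 \<le> t" "t \<le> 1"
  have "0 < (1 - t) + f' base * t"
  proof (cases "t = 0")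
    case False
    then have "0 < f' base * t" using t pos[OF base] by simp
    then show ?thesis using t by linarith
  qed simp
  then have "0 < 1 + (f' base - 1) * t" by (simp add: algebra_simps)
  then show ?thesis using slope_pos by (simp add: seed'_def)
qed

lemma seed_ends: "seed 0 = base" "seed 1 = f base" "seed' 1 = f' base * seed' 0"
proof -
  show "seed 0 = base" "seed' 1 = f' base * seed' 0" by (simp_all add: seed_def seed'_def)
  have "1 + f' base \<noteq> 0" using pos[OF base] by simp
  then show "seed 1 = f base" by (simp add: seed_def slope_def field_simps)
qed

lemma seed_maps: 
  assumes "0 \<le> t" "t \<le> 1" shows "seed t \<in> {a<..<b}"
proof -
  have "seed 0 \<le> seed t"
    by (rule DERIV_nonneg_imp_nondecreasing[OF assms(1)]) 
       (metis assms(2) order_trans seed'_pos seed_deriv less_imp_le)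
  moreover have "seed t \<le> seed 1"
    by (rule DERIV_nonneg_imp_nondecreasing[OF assms(2)]) 
       (metis assms(1) order_trans seed'_pos seed_deriv less_imp_le)
  ultimately show ?thesis using base maps[OF base] by (auto simp: seed_ends)
qed

definition \<phi> :: "real \<Rightarrow> real" where "\<phi> t = iter \<lfloor>t\<rfloor> (seed (frac t))"

lemma \<phi>_maps: "\<phi> t \<in> {a<..<b}"
  unfolding \<phi>_def by (intro iter_maps seed_maps) (auto simp: frac_lt_1 less_imp_le)

lemma \<phi>_plus_1: "\<phi> (t + 1) = f (\<phi> t)"
proof -
  have "seed (frac t) \<in> {a<..<b}" by (intro seed_maps) (auto simp: frac_lt_1 less_imp_le)
  then show ?thesis unfolding \<phi>_def by (simp add: frac_1_eq iter_plus_1 del: greaterThanLessThan_iff)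
qed

lemma \<phi>_minus_1: "\<phi> t = finv (\<phi> (t + 1))"
  by (simp only: \<phi>_plus_1 finv_f[OF \<phi>_maps])

lemma \<phi>_eq_seed: "0 < t \<Longrightarrow> t \<le> 1 \<Longrightarrow> \<phi> t = seed t"
  and \<phi>_eq_f_seed: "1 \<le> t \<Longrightarrow> t < 2 \<Longrightarrow> \<phi> t = f (seed (t - 1))"
proof -
  have *: "\<phi> t = f (seed (t - 1))" if "1 \<le> t" "t < 2" for t
  proof -
    have "\<lfloor>t\<rfloor> = 1" using that by linarith
    then show ?thesis by (simp add: \<phi>_def frac_def iter_def)
  qed
  then show "1 \<le> t \<Longrightarrow> t < 2 \<Longrightarrow> \<phi> t = f (seed (t - 1))" .
  assume t: "0 < t" "t \<le> 1"
  show "\<phi> t = seed t"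
  proof (cases "t = 1")
    case True
    then show ?thesis using *[of 1] by (simp add: seed_ends)
  next
    case False
    then have "\<lfloor>t\<rfloor> = 0" using t by linarith
    then show ?thesis by (simp add: \<phi>_def frac_def iter_def)
  qed
qed

text \<open>
  Continuous differentiability is stated as a local property that the functional equation carries from
  \<open>t\<close> to \<open>t + 1\<close> and back, so that it only has to be checked on one fundamental domain.
\<close>

definition C1_near :: "real \<Rightarrow> bool" where
  "C1_near t \<longleftrightarrow> (\<exists>U u. open U \<and> t \<in> U \<and> continuous_on U u \<and>
      (\<forall>s\<in>U. 0 < u s \<and> (\<phi> has_real_derivative u s) (at s)))"

lemma C1_near_seed: 
  assumes "0 < t" "t \<le> 1" shows "C1_near t"
  unfolding C1_near_def
proof (intro exI conjI ballI)
  let ?U = "{0<..<2::real}"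
  let ?u = "\<lambda>s. if s \<le> 1 then seed' s else f' (seed (s - 1)) * seed' (s - 1)"
  let ?r = "\<lambda>s. f (seed (s - 1))"
  show "open ?U" "t \<in> ?U" using assms by auto
  have seed_cont: "continuous_on S seed" for S
    using DERIV_continuous_on seed_deriv has_field_derivative_at_within by metis
  have seed'_cont: "continuous_on S seed'" for S
    unfolding seed'_def[abs_def] by (intro continuous_intros)
  show "continuous_on ?U ?u"
  proof (rule continuous_on_cases_le)
    show "continuous_on {t \<in> ?U. 1 \<le> t} (\<lambda>s. f' (seed (s - 1)) * seed' (s - 1))"
      by (intro continuous_intros continuous_on_compose2[OF cont'] continuous_on_compose2[OF seed_cont[of UNIV]]
            continuous_on_compose2[OF seed'_cont[of UNIV]])
         (use seed_maps in auto)
    show "seed' t = f' (seed (t - 1)) * seed' (t - 1)" if "t \<in> ?U" "t = 1" for t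
      using that by (simp add: seed_ends)
  qed (use seed'_cont in \<open>auto intro: continuous_intros\<close>)
  fix s assume s: "s \<in> ?U"
  show "0 < ?u s"
    using s seed'_pos[of s] seed'_pos[of "s - 1"] pos[OF seed_maps[of "s - 1"]] by auto
  have r: "(?r has_real_derivative f' (seed (s - 1)) * seed' (s - 1)) (at s)" if "1 \<le> s"
  proof -
    have "((\<lambda>s. seed (s - 1)) has_real_derivative seed' (s - 1) * 1) (at s)"
      by (rule DERIV_chain2[of seed, OF seed_deriv]) (auto intro!: derivative_eq_intros)
    moreover have "(f has_real_derivative f' (seed (s - 1))) (at (seed (s - 1)))"
      using that s by (intro deriv seed_maps) auto
    ultimately show ?thesis using DERIV_chain2[of f _ "\<lambda>s. seed (s - 1)"] by simp
  qed
  have "((\<lambda>s. if s \<le> 1 then seed s else ?r s) has_real_derivative ?u s) (at s)"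
  proof -
    consider "s < 1" | "s = 1" | "1 < s" by linarith
    then show ?thesis
    proof cases
      case 1
      then show ?thesis
        using has_field_derivative_transform_within_open[OF seed_deriv[of s], of "{..<1}"] by simp
    next
      case 2
      have "((\<lambda>s. if s \<le> 1 then seed s else ?r s) has_real_derivative seed' 1) (at 1)"
      proof (rule DERIV_glue[OF seed_deriv])
        show "(?r has_real_derivative seed' 1) (at 1)" using r 2 by (simp add: seed_ends)
      qed (simp add: seed_ends)
      then show ?thesis using 2 by simp
    next
      case 3
      then show ?thesis
        using has_field_derivative_transform_within_open[OF r, of "{1<..}"] by simp
    qed
  qed
  then show "(\<phi> has_real_derivative ?u s) (at s)"
    by (rule has_field_derivative_transform_within_open[where S = ?U]) (use s \<phi>_eq_seed \<phi>_eq_f_seed in auto)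
qed

lemma C1_near_plus_1: "C1_near (t + 1) \<longleftrightarrow> C1_near t"
proof
  assume "C1_near t"
  then obtain U u where U: "open U" "t \<in> U" "continuous_on U u"
    "\<And>s. s \<in> U \<Longrightarrow> 0 < u s \<and> (\<phi> has_real_derivative u s) (at s)" unfolding C1_near_def by blast
  have \<phi>_cont: "continuous_on U \<phi>"
    by (rule DERIV_continuous_on[of _ _ u]) (use U(4) has_field_derivative_at_within in fast)
  show "C1_near (t + 1)"
    unfolding C1_near_def
  proof (intro exI conjI ballI)
    let ?V = "(\<lambda>s. s - 1) -` U"
    let ?u = "\<lambda>s. f' (\<phi> (s - 1)) * u (s - 1)"
    show "open ?V" by (intro open_vimage U continuous_intros)
    show "t + 1 \<in> ?V" using U by simp
    show "continuous_on ?V ?u"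
      by (intro continuous_intros continuous_on_compose2[OF cont'] continuous_on_compose2[OF U(3)]
            continuous_on_compose2[OF \<phi>_cont]) (use \<phi>_maps in auto)
    fix s assume s: "s \<in> ?V"
    show "0 < ?u s" using s U(4) pos[OF \<phi>_maps] by simp
    have "((\<lambda>s. \<phi> (s - 1)) has_real_derivative u (s - 1) * 1) (at s)"
      by (rule DERIV_chain2[of \<phi>]) (use s U(4) in \<open>auto intro!: derivative_eq_intros\<close>)
    then have "((\<lambda>s. f (\<phi> (s - 1))) has_real_derivative ?u s) (at s)"
      using DERIV_chain2[of f _ "\<lambda>s. \<phi> (s - 1)" s, OF deriv[OF \<phi>_maps]] by simp
    moreover have "f (\<phi> (s - 1)) = \<phi> s" for s using \<phi>_plus_1[of "s - 1"] by simp
    ultimately show "(\<phi> has_real_derivative ?u s) (at s)" by simp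
  qed
next
  assume "C1_near (t + 1)"
  then obtain U u where U: "open U" "t + 1 \<in> U" "continuous_on U u"
    "\<And>s. s \<in> U \<Longrightarrow> 0 < u s \<and> (\<phi> has_real_derivative u s) (at s)" unfolding C1_near_def by blast
  let ?V = "(\<lambda>s. s + 1) -` U"
  let ?u = "\<lambda>s. inverse (f' (\<phi> s)) * u (s + 1)"
  have D: "(\<phi> has_real_derivative ?u s) (at s)" if s: "s \<in> ?V" for s
  proof -
    have "((\<lambda>s. \<phi> (s + 1)) has_real_derivative u (s + 1) * 1) (at s)"
      by (rule DERIV_chain2[of \<phi>]) (use s U(4) in \<open>auto intro!: derivative_eq_intros\<close>)
    then have "((\<lambda>s. finv (\<phi> (s + 1))) has_real_derivative ?u s) (at s)"
      using DERIV_chain2[of finv _ "\<lambda>s. \<phi> (s + 1)" s, OF finv_deriv[OF \<phi>_maps]] by (simp add: \<phi>_minus_1[symmetric])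
    then show ?thesis by (simp add: \<phi>_minus_1[symmetric])
  qed
  have \<phi>_cont: "continuous_on ?V \<phi>"
    by (rule DERIV_continuous_on[OF has_field_derivative_at_within[OF D]])
  show "C1_near t"
    unfolding C1_near_def
  proof (intro exI conjI ballI)
    show "open ?V" by (intro open_vimage U continuous_intros)
    show "t \<in> ?V" using U by simp
    have "f' (\<phi> s) \<noteq> 0" for s using pos[OF \<phi>_maps[of s]] by simp
    then show "continuous_on ?V ?u"
      by (intro continuous_intros continuous_on_compose2[OF cont'] continuous_on_compose2[OF U(3)] \<phi>_cont)
         (use \<phi>_maps in auto)
    fix s assume s: "s \<in> ?V"
    show "0 < ?u s" using s U(4) pos[OF \<phi>_maps] by simp
    show "(\<phi> has_real_derivative ?u s) (at s)" by (rule D[OF s])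
  qed
qed

lemma C1_near: "C1_near t"
proof -
  have *: "C1_near (t + of_int n) \<longleftrightarrow> C1_near t" for n :: int and t
  proof (induction n rule: int_induct[where k = 0])
    case (step1 i)
    then show ?case using C1_near_plus_1[of "t + of_int i"] by (simp add: add.assoc)
  next
    case (step2 i)
    then show ?case using C1_near_plus_1[of "t + of_int (i - 1)"] by simp
  qed simp
  \<comment> \<open>Shifting by \<open>1 - \<lceil>t\<rceil>\<close> brings \<open>t\<close> into \<open>(0, 1]\<close>.\<close>
  have "C1_near (t + of_int (1 - \<lceil>t\<rceil>))"
    by (rule C1_near_seed) (linarith, linarith)
  then show ?thesis by (simp only: *)
qed

lemma \<phi>_deriv: "(\<phi> has_real_derivative deriv \<phi> t) (at t)" "0 < deriv \<phi> t"
  and \<phi>'_cont: "continuous_on UNIV (deriv \<phi>)"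
proof -
  have *: "(\<phi> has_real_derivative deriv \<phi> t) (at t) \<and> 0 < deriv \<phi> t \<and> isCont (deriv \<phi>) t" for t
  proof -
    obtain U u where U: "open U" "t \<in> U" "continuous_on U u"
      "\<And>s. s \<in> U \<Longrightarrow> 0 < u s \<and> (\<phi> has_real_derivative u s) (at s)" 
      using C1_near[of t] unfolding C1_near_def by blast
    have eq: "deriv \<phi> s = u s" if "s \<in> U" for s using U(4)[OF that] DERIV_imp_deriv by blast
    have "continuous_on U (deriv \<phi>)" using U(3) eq by (simp cong: continuous_on_cong)
    then have "isCont (deriv \<phi>) t" using U(1,2) by (simp add: continuous_on_eq_continuous_at)
    then show ?thesis using U(2) U(4)[OF U(2)] eq[OF U(2)] by simp
  qed
  show "(\<phi> has_real_derivative deriv \<phi> t) (at t)" "0 < deriv \<phi> t" using * by blast+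
  show "continuous_on UNIV (deriv \<phi>)" using * by (intro continuous_at_imp_continuous_on) blast
qed

lemma \<phi>'_plus_1: "deriv \<phi> (t + 1) = f' (\<phi> t) * deriv \<phi> t"
proof -
  have "((\<lambda>s. \<phi> (s + 1)) has_real_derivative deriv \<phi> (t + 1) * 1) (at t)"
    by (rule DERIV_chain2[of \<phi>, OF \<phi>_deriv(1)]) (auto intro!: derivative_eq_intros)
  then have "((\<lambda>s. f (\<phi> s)) has_real_derivative deriv \<phi> (t + 1)) (at t)" by (simp add: \<phi>_plus_1)
  moreover have "((\<lambda>s. f (\<phi> s)) has_real_derivative f' (\<phi> t) * deriv \<phi> t) (at t)"
    by (rule DERIV_chain2[OF deriv[OF \<phi>_maps] \<phi>_deriv(1)])
  ultimately show ?thesis by (rule DERIV_unique)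
qed

lemma \<phi>_mono: "s < t \<Longrightarrow> \<phi> s < \<phi> t"
  by (rule DERIV_pos_imp_increasing) (use \<phi>_deriv in blast)+

text \<open>
  A supremum \<open>L < b\<close> of the orbit would be the image of some \<open>y < L\<close>; a point of the orbit above \<open>y\<close> would then be
  mapped above \<open>L\<close>.
\<close>

lemma \<phi>_at_top: "(\<phi> \<longlongrightarrow> b) at_top"
proof (rule increasing_tendsto)
  show "\<forall>\<^sub>F t in at_top. \<phi> t \<le> b" using \<phi>_maps by (simp add: less_imp_le)
  fix x assume x: "x < b"
  have "\<exists>t. x < \<phi> t"
  proof (rule ccontr)
    assume "\<not> ?thesis"
    then have le: "\<phi> t \<le> x" for t by (simp add: not_less)
    define L where "L = Sup (range \<phi>)"
    have bdd: "bdd_above (range \<phi>)" using le by (intro bdd_aboveI[of _ x]) auto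
    have up: "\<phi> t \<le> L" for t unfolding L_def by (rule cSUP_upper[OF UNIV_I bdd])
    have "L \<le> x" unfolding L_def using le by (intro cSUP_least) auto
    then have L: "L \<in> {a<..<b}" using up[of 0] \<phi>_maps[of 0] x by auto
    define y where "y = finv L"
    have y: "y \<in> {a<..<b}" "f y = L" using finv_maps[OF L] f_finv[OF L] by (simp_all add: y_def)
    then have "y < Sup (range \<phi>)" using above[OF y(1)] by (simp add: L_def)
    then obtain t where "y < \<phi> t" using less_cSUP_iff[OF _ bdd, of y] by auto
    then have "L < \<phi> (t + 1)" using mono[of y "\<phi> t"] y \<phi>_maps[of t] by (auto simp: \<phi>_plus_1)
    then show False using up[of "t + 1"] by simp
  qed
  then obtain t where "x < \<phi> t" ..
  then have "x < \<phi> s" if "s \<ge> t" for s using \<phi>_mono[of t s] that by (cases "s = t") auto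
  then show "\<forall>\<^sub>F t in at_top. x < \<phi> t" unfolding eventually_at_top_linorder by blast
qed

lemma \<phi>_at_bot: "(\<phi> \<longlongrightarrow> a) at_bot"
proof (rule decreasing_tendsto)
  show "\<forall>\<^sub>F t in at_bot. a \<le> \<phi> t" using \<phi>_maps by (simp add: less_imp_le)
  fix x assume x: "a < x"
  have "\<exists>t. \<phi> t < x"
  proof (rule ccontr)
    assume "\<not> ?thesis"
    then have le: "x \<le> \<phi> t" for t by (simp add: not_less)
    define L where "L = Inf (range \<phi>)"
    have bdd: "bdd_below (range \<phi>)" using le by (intro bdd_belowI[of _ x]) auto
    have low: "L \<le> \<phi> t" for t unfolding L_def by (rule cINF_lower[OF bdd UNIV_I])
    have "x \<le> L" unfolding L_def using le by (intro cINF_greatest) auto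
    then have L: "L \<in> {a<..<b}" using low[of 0] \<phi>_maps[of 0] x by auto
    then have "Inf (range \<phi>) < f L" using above[OF L] by (simp add: L_def)
    then obtain t where "\<phi> t < f L" using cINF_less_iff[OF _ bdd, of "f L"] by auto
    then have "f (\<phi> (t - 1)) < f L" using \<phi>_plus_1[of "t - 1"] by simp
    moreover have "L = \<phi> (t - 1) \<or> L < \<phi> (t - 1)" using low[of "t - 1"] by auto
    moreover have "f L < f (\<phi> (t - 1))" if "L < \<phi> (t - 1)"
      using mono[OF _ that] L \<phi>_maps[of "t - 1"] by simp
    ultimately show False by auto
  qed
  then obtain t where "\<phi> t < x" ..
  then have "\<phi> s < x" if "s \<le> t" for s using \<phi>_mono[of s t] that by (cases "s = t") auto
  then show "\<forall>\<^sub>F t in at_bot. \<phi> t < x" unfolding eventually_at_bot_linorder by blast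
qed

end

section \<open>Interpolating between logarithms of derivatives\<close>

text \<open>
  The logarithm of the derivative of \<open>-1 / ln (ln t)\<close>.
\<close>

definition log_deriv_model :: "real \<Rightarrow> real" where
  "log_deriv_model t = - (ln t + ln (ln t) + 2 * ln (ln (ln t)))"

lemma iterated_ln_pos:
  assumes "exp 1 < (t::real)" shows "0 < t" "0 < ln t" "0 < ln (ln t)"
proof -
  show t: "0 < t" using assms exp_gt_zero[of "1::real"] by linarith
  then have "1 < ln t" using assms by (metis exp_less_cancel_iff exp_ln)
  then show "0 < ln t" "0 < ln (ln t)" by (linarith, simp)
qed

lemma DERIV_model:
  assumes "exp 1 < t"
  shows "((\<lambda>t. - 1 / ln (ln t)) has_real_derivative exp (log_deriv_model t)) (at t)"
proof -
  note t = iterated_ln_pos[OF assms]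
  have e: "exp (log_deriv_model t) = 1 / (t * ln t * (ln (ln t))\<^sup>2)"
    using t by (simp add: log_deriv_model_def exp_minus exp_add exp_diff exp_double field_simps power2_eq_square)
  show ?thesis unfolding e
    by (rule derivative_eq_intros refl | use t in \<open>simp add: power2_eq_square\<close>)+
qed

lemma smooth_log_deriv_model: "smooth_on {exp 1<..} log_deriv_model"
  unfolding log_deriv_model_def[abs_def]
  by (intro smooth_intros) (simp_all add: iterated_ln_pos del: ln_gt_zero_iff)

text \<open>
  Up to a bounded error, \<open>l t\<close> is a sum of about \<open>t\<close> increments, all but boundedly many of which are small.
\<close>

lemma sublinear_of_vanishing_increments:
  fixes l :: "real \<Rightarrow> real"
  assumes "continuous_on UNIV l" "((\<lambda>t. l (t + 1) - l t) \<longlongrightarrow> 0) at_top"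
  shows "((\<lambda>t. l t / t) \<longlongrightarrow> 0) at_top"
proof (rule tendstoI)
  fix e :: real assume e: "0 < e"
  have "\<forall>\<^sub>F t in at_top. dist (l (t + 1) - l t) 0 < e / 2"
    using assms(2) e by (intro tendstoD) auto
  then obtain M where M: "\<And>t. t \<ge> M \<Longrightarrow> \<bar>l (t + 1) - l t\<bar> < e / 2"
    unfolding eventually_at_top_linorder by auto
  have "compact (l ` {M..M + 1})"
    by (intro compact_continuous_image continuous_on_subset[OF assms(1)]) auto
  then obtain B where B: "\<And>t. t \<in> {M..M + 1} \<Longrightarrow> \<bar>l t\<bar> \<le> B"
    by (metis bounded_iff compact_imp_bounded image_eqI real_norm_def)
  have step: "\<bar>l t\<bar> \<le> B + e / 2 * real n" if "M + real n \<le> t" "t \<le> M + real n + 1" for n t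
    using that
  proof (induction n arbitrary: t)
    case 0
    then show ?case using B[of t] by simp
  next
    case (Suc n)
    have "\<bar>l (t - 1)\<bar> \<le> B + e / 2 * real n" using Suc.IH[of "t - 1"] Suc.prems by simp
    moreover have "\<bar>l t - l (t - 1)\<bar> < e / 2" using M[of "t - 1"] Suc.prems by simp
    ultimately have "\<bar>l t\<bar> \<le> B + e / 2 * real n + e / 2" by linarith
    then show ?case by (simp add: field_simps)
  qed
  have lin: "\<bar>l t\<bar> \<le> B + e / 2 * (t - M)" if "M \<le> t" for t
  proof -
    have "\<bar>l t\<bar> \<le> B + e / 2 * real (nat \<lfloor>t - M\<rfloor>)"
      by (rule step) (use that in linarith)+
    also have "\<dots> \<le> B + e / 2 * (t - M)" using e that by (intro add_left_mono mult_left_mono) auto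
    finally show ?thesis .
  qed
  have "((\<lambda>t. (B + e / 2 * (t - M)) / t) \<longlongrightarrow> e / 2) at_top" by real_asymp
  then have "\<forall>\<^sub>F t in at_top. (B + e / 2 * (t - M)) / t < e" by (rule order_tendstoD) (use e in simp)
  then show "\<forall>\<^sub>F t in at_top. dist (l t / t) 0 < e"
    using eventually_ge_at_top[of M] eventually_gt_at_top[of 0]
  proof eventually_elim
    case (elim t)
    have "\<bar>l t\<bar> / t \<le> (B + e / 2 * (t - M)) / t" using lin elim by (intro divide_right_mono) auto
    then show ?case using elim by simp
  qed
qed

text \<open>
  The Lipschitz constant is what matters: rescaled by \<open>N\<close>, the cutoff varies by at most \<open>C / N\<close> over a
  unit step.
\<close>

lemma smooth_cutoff:
  obtains \<tau> :: "real \<Rightarrow> real" and C where "smooth_on UNIV \<tau>" "\<And>x. 0 \<le> \<tau> x \<and> \<tau> x \<le> 1"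
    "\<And>x. \<bar>x\<bar> \<le> 1 \<Longrightarrow> \<tau> x = 0" "\<And>x. 2 \<le> \<bar>x\<bar> \<Longrightarrow> \<tau> x = 1"
    "0 < C" "\<And>x y. \<bar>\<tau> x - \<tau> y\<bar> \<le> C * \<bar>x - y\<bar>"
proof -
  define \<tau> where "\<tau> = (\<lambda>x::real. flat_exp (x\<^sup>2 - 1) / (flat_exp (x\<^sup>2 - 1) + flat_exp (2 - x\<^sup>2)))"
  have den: "0 < flat_exp (x\<^sup>2 - 1) + flat_exp (2 - x\<^sup>2)" for x :: real
    using flat_exp_bounds(1)[of "x\<^sup>2 - 1"] flat_exp_bounds(1)[of "2 - x\<^sup>2"]
      flat_exp_bounds(4)[of "x\<^sup>2 - 1"] flat_exp_bounds(4)[of "2 - x\<^sup>2"] by linarith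
  have sm: "smooth_on UNIV \<tau>" unfolding \<tau>_def
    by (intro smooth_intros) (use den in \<open>simp add: less_imp_neq[symmetric]\<close>)
  have r: "0 \<le> \<tau> x \<and> \<tau> x \<le> 1" for x
    unfolding \<tau>_def using den[of x] flat_exp_bounds(1) by simp
  have z: "\<tau> x = 0" if "\<bar>x\<bar> \<le> 1" for x
    using that by (simp add: \<tau>_def flat_exp_bounds abs_square_le_1)
  have o: "\<tau> x = 1" if "2 \<le> \<bar>x\<bar>" for x
  proof -
    have "2\<^sup>2 \<le> x\<^sup>2" using that by (metis abs_le_square_iff abs_numeral)
    then have "flat_exp (2 - x\<^sup>2) = 0" by (simp add: flat_exp_bounds)
    then show ?thesis using den[of x] by (simp add: \<tau>_def)
  qed
  have "continuous_on {-2..2} (deriv \<tau>)"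
    using smooth_on_imp_continuous_on[OF open_UNIV smooth_on_deriv(2)[OF open_UNIV sm]] 
    by (rule continuous_on_subset) auto
  then have "compact (deriv \<tau> ` {-2..2})" by (intro compact_continuous_image) auto
  then obtain C where C: "\<And>x. x \<in> {-2..2} \<Longrightarrow> \<bar>deriv \<tau> x\<bar> \<le> C"
    by (metis bounded_iff compact_imp_bounded image_eqI real_norm_def)
  have lip: "\<bar>\<tau> x - \<tau> y\<bar> \<le> C * \<bar>x - y\<bar>" if "x \<in> {-2..2}" "y \<in> {-2..2}" for x y
    using field_differentiable_bound[of "{-2..2}" \<tau> "deriv \<tau>" C x y] that C
      has_field_derivative_at_within[OF smooth_on_deriv(1)[OF open_UNIV sm]] by simp
  \<comment> \<open>Outside \<open>[-2, 2]\<close> the function is constant, so arguments may be clamped to this interval.\<close>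
  define cl where "cl = (\<lambda>x::real. max (- 2) (min 2 x))"
  have cl: "cl x \<in> {-2..2}" "\<tau> (cl x) = \<tau> x" "\<bar>cl x - cl y\<bar> \<le> \<bar>x - y\<bar>" for x y
    using o[of x] o[of 2] o[of "-2"] by (auto simp: cl_def max_def min_def)
  have "\<bar>\<tau> x - \<tau> y\<bar> \<le> (\<bar>C\<bar> + 1) * \<bar>x - y\<bar>" for x y
  proof -
    have "\<bar>\<tau> x - \<tau> y\<bar> \<le> C * \<bar>cl x - cl y\<bar>" using lip[OF cl(1) cl(1), of x y] by (simp add: cl(2))
    also have "\<dots> \<le> (\<bar>C\<bar> + 1) * \<bar>x - y\<bar>" using cl(3)[of x y] by (intro mult_mono) auto
    finally show ?thesis .
  qed
  then show ?thesis using that[OF sm r z o, of "\<bar>C\<bar> + 1"] by simp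
qed


definition increment :: "(real \<Rightarrow> real) \<Rightarrow> real \<Rightarrow> real" where
  "increment l t = l (t + 1) - l t"

text \<open>
  The interpolation is \<open>W = (1 - \<theta>) p + \<theta> \<Lambda>\<close> with a polynomial \<open>p\<close> close to \<open>l\<close> on \<open>[-2 N, 2 N]\<close> and a cutoff
  \<open>\<theta>\<close> rising from \<open>0\<close> to \<open>1\<close> between \<open>N\<close> and \<open>2 N\<close>.  With \<open>d = \<Lambda> - l\<close> the increment of \<open>W - l\<close> is, up to the
  error of \<open>p\<close>, the sum of \<open>\<theta> t (d (t + 1) - d t)\<close>, which is small where \<open>\<theta>\<close> does not vanish, and of
  \<open>(\<theta> (t + 1) - \<theta> t) d (t + 1)\<close>, which is at most \<open>C / N\<close> times \<open>o(N)\<close>.  The last conclusion is the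
  convexity of the exponential function; it will bound the tails of a primitive of \<open>exp W\<close>.
\<close>

lemma interpolate_to_model:
  assumes cont: "continuous_on UNIV l"
    and top: "(increment l \<longlongrightarrow> 0) at_top" and bot: "(increment l \<longlongrightarrow> 0) at_bot" and e: "0 < e"
  shows "\<forall>\<^sub>F N in at_top. \<exists>W. smooth_on UNIV W \<and> (\<forall>t. 2 * N \<le> \<bar>t\<bar> \<longrightarrow> W t = log_deriv_model \<bar>t\<bar>)
    \<and> (\<forall>t. \<bar>increment W t - increment l t\<bar> \<le> e) \<and> (\<forall>t. \<bar>t\<bar> \<le> N \<longrightarrow> \<bar>W t - l t\<bar> \<le> e)
    \<and> (\<forall>t. N \<le> \<bar>t\<bar> \<longrightarrow> exp (W t) \<le> exp e * exp (l t) + exp (log_deriv_model \<bar>t\<bar>))"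
proof -
  obtain \<tau> C where \<tau>: "smooth_on UNIV \<tau>" "\<And>x. 0 \<le> \<tau> x \<and> \<tau> x \<le> 1"
    "\<And>x. \<bar>x\<bar> \<le> 1 \<Longrightarrow> \<tau> x = 0" "\<And>x. 2 \<le> \<bar>x\<bar> \<Longrightarrow> \<tau> x = 1"
    "0 < C" "\<And>x y. \<bar>\<tau> x - \<tau> y\<bar> \<le> C * \<bar>x - y\<bar>"
    using smooth_cutoff by metis
  define d where "d = (\<lambda>t. log_deriv_model \<bar>t\<bar> - l t)"
  \<comment> \<open>The factor \<open>12\<close> gives \<open>(C / N) * (\<eta> * 3 N) = e / 4\<close>, one of the four error terms.\<close>
  define \<eta> where "\<eta> = e / (12 * C)"
  have \<eta>: "0 < \<eta>" using e \<tau>(5) by (simp add: \<eta>_def)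
  have small: "\<forall>\<^sub>F t in F. \<bar>d (t + 1) - d t\<bar> \<le> e / 4"
    if "((\<lambda>t. d (t + 1) - d t) \<longlongrightarrow> 0) F" for F
    using tendstoD[OF that, of "e / 4"] e by (auto elim: eventually_mono)
  have lin: "\<forall>\<^sub>F t in F. \<bar>f t\<bar> \<le> \<eta> * \<bar>t\<bar>"
    if "((\<lambda>t. f t / t) \<longlongrightarrow> 0) F" "\<forall>\<^sub>F t in F. t \<noteq> 0" for F and f :: "real \<Rightarrow> real"
    using tendstoD[OF that(1) \<eta>] that(2)
    by eventually_elim (simp add: abs_divide pos_divide_less_eq)
  have top_inc: "\<forall>\<^sub>F t in at_top. \<bar>d (t + 1) - d t\<bar> \<le> e / 4"
  proof (rule small)
    have "((\<lambda>t. log_deriv_model (t + 1) - log_deriv_model t) \<longlongrightarrow> 0) at_top" unfolding log_deriv_model_def by real_asymp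
    from tendsto_diff[OF this top] have "((\<lambda>t. (log_deriv_model (t + 1) - log_deriv_model t) - increment l t) \<longlongrightarrow> 0) at_top" by simp
    then show "((\<lambda>t. d (t + 1) - d t) \<longlongrightarrow> 0) at_top"
      by (rule Lim_transform_eventually)
         (use eventually_gt_at_top[of 0] in \<open>eventually_elim, simp add: d_def increment_def\<close>)
  qed
  have bot_inc: "\<forall>\<^sub>F t in at_bot. \<bar>d (t + 1) - d t\<bar> \<le> e / 4"
  proof (rule small)
    have "((\<lambda>t. log_deriv_model (- t - 1) - log_deriv_model (- t)) \<longlongrightarrow> 0) at_bot" unfolding log_deriv_model_def by real_asymp
    from tendsto_diff[OF this bot] have "((\<lambda>t. (log_deriv_model (- t - 1) - log_deriv_model (- t)) - increment l t) \<longlongrightarrow> 0) at_bot" by simp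
    then show "((\<lambda>t. d (t + 1) - d t) \<longlongrightarrow> 0) at_bot"
    proof (rule Lim_transform_eventually)
      show "\<forall>\<^sub>F t in at_bot. log_deriv_model (- t - 1) - log_deriv_model (- t) - increment l t = d (t + 1) - d t"
        using eventually_le_at_bot[of "-1"]
      proof eventually_elim
        case (elim t)
        then have "\<bar>t + 1\<bar> = - t - 1" "\<bar>t\<bar> = - t" by auto
        then show ?case by (simp add: d_def increment_def)
      qed
    qed
  qed
  have model_lin: "((\<lambda>t. log_deriv_model t / t) \<longlongrightarrow> 0) at_top" unfolding log_deriv_model_def by real_asymp
  have top_lin: "\<forall>\<^sub>F t in at_top. \<bar>d t\<bar> \<le> \<eta> * \<bar>t\<bar>"
  proof (rule lin)
    have "((\<lambda>t. l t / t) \<longlongrightarrow> 0) at_top"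
      by (rule sublinear_of_vanishing_increments[OF cont]) (use top in \<open>simp add: increment_def[abs_def]\<close>)
    from tendsto_diff[OF model_lin this] have "((\<lambda>t. log_deriv_model t / t - l t / t) \<longlongrightarrow> 0) at_top" by simp
    then show "((\<lambda>t. d t / t) \<longlongrightarrow> 0) at_top"
      by (rule Lim_transform_eventually)
         (use eventually_gt_at_top[of 0] in \<open>eventually_elim, simp add: d_def diff_divide_distrib\<close>)
    show "\<forall>\<^sub>F t::real in at_top. t \<noteq> 0" using eventually_gt_at_top[of 0] by eventually_elim simp
  qed
  have bot_lin: "\<forall>\<^sub>F t in at_top. \<bar>d (- t)\<bar> \<le> \<eta> * \<bar>t\<bar>"
  proof (rule lin)
    have "((\<lambda>t. l (- t) / t) \<longlongrightarrow> 0) at_top"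
    proof (rule sublinear_of_vanishing_increments)
      show "continuous_on UNIV (\<lambda>t. l (- t))"
        by (rule continuous_on_compose2[OF cont]) (auto intro: continuous_intros)
      have "((\<lambda>t. increment l (- t - 1)) \<longlongrightarrow> 0) at_top"
        by (rule filterlim_compose[OF bot]) real_asymp
      from tendsto_minus[OF this] show "((\<lambda>t. l (- (t + 1)) - l (- t)) \<longlongrightarrow> 0) at_top"
        by (simp add: increment_def algebra_simps)
    qed
    from tendsto_diff[OF model_lin this] have "((\<lambda>t. log_deriv_model t / t - l (- t) / t) \<longlongrightarrow> 0) at_top" by simp
    then show "((\<lambda>t. d (- t) / t) \<longlongrightarrow> 0) at_top"
      by (rule Lim_transform_eventually)
         (use eventually_gt_at_top[of 0] in \<open>eventually_elim, simp add: d_def diff_divide_distrib\<close>)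
    show "\<forall>\<^sub>F t::real in at_top. t \<noteq> 0" using eventually_gt_at_top[of 0] by eventually_elim simp
  qed
  obtain M1 where M1: "\<And>t. t \<ge> M1 \<Longrightarrow> \<bar>d (t + 1) - d t\<bar> \<le> e / 4"
    using top_inc unfolding eventually_at_top_linorder by blast
  obtain M2 where M2: "\<And>t. t \<le> M2 \<Longrightarrow> \<bar>d (t + 1) - d t\<bar> \<le> e / 4"
    using bot_inc unfolding eventually_at_bot_linorder by blast
  obtain M3 where M3: "\<And>t. t \<ge> M3 \<Longrightarrow> \<bar>d t\<bar> \<le> \<eta> * \<bar>t\<bar>"
    using top_lin unfolding eventually_at_top_linorder by blast
  obtain M4 where M4: "\<And>t. t \<ge> M4 \<Longrightarrow> \<bar>d (- t)\<bar> \<le> \<eta> * \<bar>t\<bar>"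
    using bot_lin unfolding eventually_at_top_linorder by blast
  \<comment> \<open>Beyond \<open>exp 1\<close> the iterated logarithms in the model are positive.\<close>
  define N0 where "N0 = Max {M1, - M2, M3 + 1, M4 + 1, exp 1 + 1}"
  have ex: "\<exists>W. smooth_on UNIV W \<and> (\<forall>t. 2 * N \<le> \<bar>t\<bar> \<longrightarrow> W t = log_deriv_model \<bar>t\<bar>)
    \<and> (\<forall>t. \<bar>increment W t - increment l t\<bar> \<le> e) \<and> (\<forall>t. \<bar>t\<bar> \<le> N \<longrightarrow> \<bar>W t - l t\<bar> \<le> e)
    \<and> (\<forall>t. N \<le> \<bar>t\<bar> \<longrightarrow> exp (W t) \<le> exp e * exp (l t) + exp (log_deriv_model \<bar>t\<bar>))" if "N \<ge> N0" for N
  proof -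
    have N': "M1 \<le> N" "- M2 \<le> N" "M3 + 1 \<le> N" "M4 + 1 \<le> N" "exp 1 + 1 \<le> N"
      using that by (auto simp: N0_def)
    moreover have "1 \<le> N" using N'(5) exp_gt_zero[of "1::real"] by linarith
    ultimately have N: "M1 \<le> N" "- M2 \<le> N" "M3 + 1 \<le> N" "M4 + 1 \<le> N" "exp 1 + 1 \<le> N" "1 \<le> N"
      by this+
    have d_inc: "\<bar>d (t + 1) - d t\<bar> \<le> e / 4" if "N \<le> \<bar>t\<bar>" for t
      using that M1[of t] M2[of t] N by (cases "0 \<le> t") auto
    have d_lin: "\<bar>d t\<bar> \<le> \<eta> * \<bar>t\<bar>" if "N - 1 \<le> \<bar>t\<bar>" for t
      using that M3[of t] M4[of "- t"] N by (cases "0 \<le> t") auto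
    obtain p where p: "real_polynomial_function p" "\<And>t. t \<in> {- 2 * N..2 * N} \<Longrightarrow> \<bar>l t - p t\<bar> < e / 4"
      using Stone_Weierstrass_real_polynomial_function[of "{- 2 * N..2 * N}" l "e / 4"] e
        continuous_on_subset[OF cont] by (metis compact_Icc divide_pos_pos top_greatest zero_less_numeral)
    define \<theta> where "\<theta> = (\<lambda>t. \<tau> (t / N))"
    have \<theta>01: "0 \<le> \<theta> t" "\<theta> t \<le> 1" for t using \<tau>(2) by (auto simp: \<theta>_def)
    have \<theta>0: "\<theta> t = 0" if "\<bar>t\<bar> \<le> N" for t
      using \<tau>(3)[of "t / N"] that N by (simp add: \<theta>_def abs_divide divide_le_eq)
    have \<theta>1: "\<theta> t = 1" if "2 * N \<le> \<bar>t\<bar>" for t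
      using \<tau>(4)[of "t / N"] that N by (simp add: \<theta>_def abs_divide le_divide_eq)
    have \<theta>_lip: "\<bar>\<theta> (t + 1) - \<theta> t\<bar> \<le> C / N" for t
      using \<tau>(6)[of "(t + 1) / N" "t / N"] N by (simp add: \<theta>_def diff_divide_distrib[symmetric] abs_divide)
    define W where "W = (\<lambda>t. (1 - \<theta> t) * p t + \<theta> t * log_deriv_model \<bar>t\<bar>)"
    define r where "r = (\<lambda>t. (1 - \<theta> t) * (p t - l t))"
    have r: "\<bar>r t\<bar> \<le> e / 4" for t
    proof (cases "\<bar>t\<bar> \<le> 2 * N")
      case True
      then have "\<bar>p t - l t\<bar> \<le> e / 4" using p(2)[of t] by (simp add: abs_minus_commute abs_le_iff)
      then have "\<bar>1 - \<theta> t\<bar> * \<bar>p t - l t\<bar> \<le> 1 * (e / 4)"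
        using \<theta>01[of t] by (intro mult_mono) auto
      then show ?thesis by (simp add: r_def abs_mult)
    next
      case False
      then show ?thesis using \<theta>1[of t] e by (simp add: r_def)
    qed
    have W_eq: "W t = l t + r t + \<theta> t * d t" for t
      by (simp add: W_def r_def d_def algebra_simps)
    have \<theta>_smooth: "smooth_on UNIV \<theta>"
      unfolding \<theta>_def by (rule smooth_on_compose[where f = \<tau>, OF \<tau>(1)]) (use N in \<open>auto intro!: smooth_intros\<close>)
    have p_smooth: "smooth_on UNIV p" by (rule smooth_on_real_polynomial_function[OF p(1)])
    have sm: "smooth_on UNIV W"
    proof (rule smooth_on_local)
      fix t :: real
      have "N < \<bar>t\<bar> + 1 \<Longrightarrow> exp 1 < \<bar>t\<bar>" using N by linarith
      then consider "t \<in> {-N<..<N}" | "t \<in> {exp 1<..}" | "t \<in> {..<-exp 1}" by (cases "\<bar>t\<bar> < N") (auto simp: abs_if split: if_splits)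
      then show "\<exists>U. open U \<and> t \<in> U \<and> smooth_on U W"
      proof cases
        case 1
        have "smooth_on {-N<..<N} W"
          by (rule smooth_on_cong[OF _ _ smooth_on_subset[OF p_smooth]]) (use \<theta>0 in \<open>auto simp: W_def abs_if\<close>)
        with 1 show ?thesis by (intro exI[of _ "{-N<..<N}"]) simp
      next
        case 2
        have "smooth_on {exp 1<..} (\<lambda>t. (1 - \<theta> t) * p t + \<theta> t * log_deriv_model t)"
          by (intro smooth_intros smooth_on_subset[OF p_smooth] smooth_on_subset[OF \<theta>_smooth] smooth_log_deriv_model) auto
        then have "smooth_on {exp 1<..} W"
        proof (rule smooth_on_cong[rotated 2])
          fix t :: real assume "t \<in> {exp 1<..}"
          then have "\<bar>t\<bar> = t" using iterated_ln_pos(1)[of t] by simp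
          then show "(1 - \<theta> t) * p t + \<theta> t * log_deriv_model t = W t" by (simp add: W_def)
        qed simp
        with 2 show ?thesis by (intro exI[of _ "{exp 1<..}"]) simp
      next
        case 3
        have "smooth_on {..<-exp 1} (\<lambda>t. log_deriv_model (- t))"
          by (rule smooth_on_compose[where f = log_deriv_model, OF smooth_log_deriv_model]) (auto intro!: smooth_intros)
        then have "smooth_on {..<-exp 1} (\<lambda>t. (1 - \<theta> t) * p t + \<theta> t * log_deriv_model (- t))"
          by (intro smooth_intros smooth_on_subset[OF p_smooth] smooth_on_subset[OF \<theta>_smooth]) auto
        then have "smooth_on {..<-exp 1} W"
        proof (rule smooth_on_cong[rotated 2])
          fix t :: real assume "t \<in> {..<-exp 1}"
          then have "\<bar>t\<bar> = - t" using iterated_ln_pos(1)[of "- t"] by simp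
          then show "(1 - \<theta> t) * p t + \<theta> t * log_deriv_model (- t) = W t" by (simp add: W_def)
        qed simp
        with 3 show ?thesis by (intro exI[of _ "{..<-exp 1}"]) simp
      qed
    qed
    have end_W: "W t = log_deriv_model \<bar>t\<bar>" if "2 * N \<le> \<bar>t\<bar>" for t using \<theta>1[OF that] by (simp add: W_def)
    have inc: "\<bar>increment W t - increment l t\<bar> \<le> e" for t
    proof -
      have eq: "increment W t - increment l t
          = r (t + 1) - r t + \<theta> t * (d (t + 1) - d t) + (\<theta> (t + 1) - \<theta> t) * d (t + 1)"
        by (simp add: increment_def W_eq algebra_simps)
      have 1: "\<bar>\<theta> t * (d (t + 1) - d t)\<bar> \<le> e / 4"
      proof (cases "N \<le> \<bar>t\<bar>")
        case True
        have "\<bar>\<theta> t\<bar> * \<bar>d (t + 1) - d t\<bar> \<le> 1 * (e / 4)"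
          using \<theta>01[of t] d_inc[OF True] by (intro mult_mono) auto
        then show ?thesis by (simp add: abs_mult)
      next
        case False
        then show ?thesis using \<theta>0[of t] e by simp
      qed
      \<comment> \<open>The weight changes only within the transition zone, where \<open>\<bar>t + 1\<bar> \<le> 3 N\<close>.\<close>
      have 2: "\<bar>(\<theta> (t + 1) - \<theta> t) * d (t + 1)\<bar> \<le> e / 4"
      proof (cases "N - 1 \<le> \<bar>t + 1\<bar> \<and> \<bar>t + 1\<bar> \<le> 2 * N + 1")
        case True
        have "\<bar>d (t + 1)\<bar> \<le> \<eta> * \<bar>t + 1\<bar>" using d_lin True by blast
        also have "\<dots> \<le> \<eta> * (3 * N)" using \<eta> True N by (intro mult_left_mono) auto
        finally have "\<bar>\<theta> (t + 1) - \<theta> t\<bar> * \<bar>d (t + 1)\<bar> \<le> C / N * (\<eta> * (3 * N))"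
          using \<theta>_lip[of t] \<tau>(5) N by (intro mult_mono) auto
        also have "\<dots> = e / 4" using \<tau>(5) N by (simp add: \<eta>_def)
        finally show ?thesis by (simp add: abs_mult)
      next
        case False
        then consider "\<bar>t + 1\<bar> < N - 1" | "2 * N + 1 < \<bar>t + 1\<bar>" by linarith
        then have "\<theta> (t + 1) = \<theta> t"
        proof cases
          case 1
          then have "\<bar>t + 1\<bar> \<le> N" "\<bar>t\<bar> \<le> N" by linarith+
          then show ?thesis by (simp add: \<theta>0)
        next
          case 2
          then have "2 * N \<le> \<bar>t + 1\<bar>" "2 * N \<le> \<bar>t\<bar>" by linarith+
          then show ?thesis by (simp add: \<theta>1)
        qed
        then show ?thesis using e by simp
      qed
      show ?thesis unfolding eq using 1 2 r[of t] r[of "t + 1"] by linarith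
    qed
    have mid: "\<bar>W t - l t\<bar> \<le> e" if "\<bar>t\<bar> \<le> N" for t
      using r[of t] e \<theta>0[OF that] by (simp add: W_eq)
    have tail: "exp (W t) \<le> exp e * exp (l t) + exp (log_deriv_model \<bar>t\<bar>)" for t
    proof -
      have "exp (W t) \<le> (1 - \<theta> t) * exp (p t) + \<theta> t * exp (log_deriv_model \<bar>t\<bar>)"
        using convex_onD[OF exp_convex \<theta>01(1)[of t] \<theta>01(2)[of t], of "p t" "log_deriv_model \<bar>t\<bar>"] by (simp add: W_def)
      moreover have "(1 - \<theta> t) * exp (p t) \<le> exp e * exp (l t)"
      proof (cases "\<bar>t\<bar> \<le> 2 * N")
        case True
        then have "\<bar>l t - p t\<bar> < e / 4" by (intro p(2)) auto
        then have "p t \<le> e + l t" using e by linarith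
        then have "exp (p t) \<le> exp e * exp (l t)" by (simp add: exp_add[symmetric])
        moreover have "(1 - \<theta> t) * exp (p t) \<le> 1 * exp (p t)" using \<theta>01[of t] by (intro mult_right_mono) auto
        ultimately show ?thesis by linarith
      qed (use \<theta>1[of t] in simp)
      moreover have "\<theta> t * exp (log_deriv_model \<bar>t\<bar>) \<le> 1 * exp (log_deriv_model \<bar>t\<bar>)"
        using \<theta>01[of t] by (intro mult_right_mono) auto
      ultimately show ?thesis by linarith
    qed
    show ?thesis using sm end_W inc mid tail by (intro exI[of _ W]) simp
  qed
  then show ?thesis unfolding eventually_at_top_linorder by (intro exI[of _ N0] allI impI ex)
qed

section \<open>Parametrizations close to a given one\<close>

lemma DERIV_mono:
  fixes F G :: "real \<Rightarrow> real"
  assumes "x \<le> y" "\<And>t. x \<le> t \<Longrightarrow> t \<le> y \<Longrightarrow> (F has_real_derivative F' t) (at t)"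
    "\<And>t. x \<le> t \<Longrightarrow> t \<le> y \<Longrightarrow> (G has_real_derivative G' t) (at t)"
    "\<And>t. x \<le> t \<Longrightarrow> t \<le> y \<Longrightarrow> F' t \<le> G' t"
  shows "F y - F x \<le> G y - G x"
proof -
  have "G x - F x \<le> G y - F y"
  proof (rule DERIV_nonneg_imp_nondecreasing[OF assms(1)])
    fix t assume t: "x \<le> t" "t \<le> y"
    show "\<exists>D. ((\<lambda>t. G t - F t) has_real_derivative D) (at t) \<and> 0 \<le> D"
      by (rule exI[of _ "G' t - F' t"]) (use t assms in \<open>auto intro: DERIV_diff\<close>)
  qed
  then show ?thesis by linarith
qed

text \<open>
  Up to \<open>N\<close> the two functions grow at nearly the same rate.  Beyond \<open>N\<close> neither has much room left: \<open>\<phi>\<close> is bounded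
  by \<open>B\<close>, and \<open>\<psi>\<close> grows at most like \<open>(1 + c) \<phi> - 1 / ln (ln t)\<close>.
\<close>

lemma half_line_estimate:
  assumes \<phi>: "\<And>t. (\<phi> has_real_derivative u t) (at t)" and \<psi>: "\<And>t. (\<psi> has_real_derivative v t) (at t)"
    and pos: "\<And>t. 0 < u t" "\<And>t. 0 < v t" and eq: "\<psi> 0 = \<phi> 0" and c: "0 \<le> c"
    and N: "exp 1 < N"
    and mid: "\<And>t. 0 \<le> t \<Longrightarrow> t \<le> N \<Longrightarrow> \<bar>v t - u t\<bar> \<le> c * u t"
    and tail: "\<And>t. N \<le> t \<Longrightarrow> v t \<le> (1 + c) * u t + exp (log_deriv_model t)"
    and bound: "\<And>t. \<phi> t \<le> B" and t: "0 \<le> t"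
  shows "\<bar>\<psi> t - \<phi> t\<bar> \<le> c * (\<phi> N - \<phi> 0) + ((1 + c) * (B - \<phi> N) + 1 / ln (ln N))"
proof -
  have N0: "0 \<le> N" using iterated_ln_pos(1)[OF N] by simp
  have \<phi>_mono: "\<phi> x \<le> \<phi> y" if "x \<le> y" for x y
    using DERIV_mono[OF that, of "\<lambda>_. 0" "\<lambda>_. 0" \<phi> u] \<phi> pos(1) by (auto simp: less_imp_le)
  have \<psi>_mono: "\<psi> x \<le> \<psi> y" if "x \<le> y" for x y
    using DERIV_mono[OF that, of "\<lambda>_. 0" "\<lambda>_. 0" \<psi> v] \<psi> pos(2) by (auto simp: less_imp_le)
  have tail_nonneg: "0 \<le> (1 + c) * (B - \<phi> N) + 1 / ln (ln N)"
    using bound[of N] c iterated_ln_pos(3)[OF N] by simp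
  have near: "\<bar>\<psi> s - \<phi> s\<bar> \<le> c * (\<phi> s - \<phi> 0)" if s: "0 \<le> s" "s \<le> N" for s
  proof -
    have 1: "\<psi> s - \<psi> 0 \<le> (1 + c) * \<phi> s - (1 + c) * \<phi> 0"
    proof (rule DERIV_mono[OF s(1) \<psi>])
      show "((\<lambda>t. (1 + c) * \<phi> t) has_real_derivative (1 + c) * u t) (at t)" for t
        by (rule DERIV_cmult[OF \<phi>])
      show "v t \<le> (1 + c) * u t" if "0 \<le> t" "t \<le> s" for t
        using mid[of t] that s by (simp add: abs_le_iff algebra_simps)
    qed
    have 2: "(1 - c) * \<phi> s - (1 - c) * \<phi> 0 \<le> \<psi> s - \<psi> 0"
    proof (rule DERIV_mono[OF s(1) _ \<psi>])
      show "((\<lambda>t. (1 - c) * \<phi> t) has_real_derivative (1 - c) * u t) (at t)" for t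
        by (rule DERIV_cmult[OF \<phi>])
      show "(1 - c) * u t \<le> v t" if "0 \<le> t" "t \<le> s" for t
        using mid[of t] that s by (simp add: abs_le_iff algebra_simps)
    qed
    show ?thesis using 1 2 eq by (simp add: abs_le_iff algebra_simps)
  qed
  show ?thesis
  proof (cases "t \<le> N")
    case True
    have "c * (\<phi> t - \<phi> 0) \<le> c * (\<phi> N - \<phi> 0)" using c \<phi>_mono[OF True] by (intro mult_left_mono) auto
    then show ?thesis using near[OF t True] tail_nonneg by linarith
  next
    case False
    then have Nt: "N \<le> t" by simp
    have "\<psi> t - \<psi> N \<le> ((1 + c) * \<phi> t + - 1 / ln (ln t)) - ((1 + c) * \<phi> N + - 1 / ln (ln N))"
    proof (rule DERIV_mono[OF Nt \<psi>])
      fix s assume s: "N \<le> s"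
      then have "exp 1 < s" using N by linarith
      then show "((\<lambda>t. (1 + c) * \<phi> t + - 1 / ln (ln t)) has_real_derivative (1 + c) * u s + exp (log_deriv_model s)) (at s)"
        by (intro DERIV_add DERIV_cmult \<phi> DERIV_model)
      show "v s \<le> (1 + c) * u s + exp (log_deriv_model s)" by (rule tail[OF s])
    qed
    moreover have "0 < 1 / ln (ln t)" using iterated_ln_pos(3)[of t] N Nt by simp
    moreover have "(1 + c) * \<phi> t \<le> (1 + c) * B" using bound[of t] c by (intro mult_left_mono) auto
    ultimately have 1: "\<psi> t - \<psi> N \<le> (1 + c) * (B - \<phi> N) + 1 / ln (ln N)"
      unfolding right_diff_distrib minus_divide_left[symmetric] by linarith
    have "0 \<le> c * (B - \<phi> N)" "0 < 1 / ln (ln N)"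
      using c bound[of N] iterated_ln_pos(3)[OF N] by simp_all
    moreover have "(1 + c) * (B - \<phi> N) = (B - \<phi> N) + c * (B - \<phi> N)" by (simp add: algebra_simps)
    ultimately have 2: "\<phi> t - \<phi> N \<le> (1 + c) * (B - \<phi> N) + 1 / ln (ln N)"
      using bound[of t] by linarith
    show ?thesis using 1 2 near[OF N0 order_refl] \<psi>_mono[OF Nt] \<phi>_mono[OF Nt] by linarith
  qed
qed

lemma exists_primitive:
  assumes "continuous_on UNIV (v :: real \<Rightarrow> real)"
  obtains \<psi> where "\<And>t. (\<psi> has_real_derivative v t) (at t)" "\<psi> 0 = c"
proof -
  have "\<exists>F. \<forall>x::real. - \<infinity> < ereal x \<longrightarrow> ereal x < \<infinity> \<longrightarrow> (F has_vector_derivative v x) (at x)"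
    by (rule einterval_antiderivative) (use assms in \<open>auto simp: continuous_on_eq_continuous_at\<close>)
  then obtain F where F: "\<And>x. (F has_real_derivative v x) (at x)"
    by (auto simp: has_real_derivative_iff_has_vector_derivative)
  have "((\<lambda>x. F x - F 0 + c) has_real_derivative v x) (at x)" for x
    by (auto intro!: derivative_eq_intros F)
  then show ?thesis using that[of "\<lambda>x. F x - F 0 + c"] by simp
qed

text \<open>
  A primitive \<open>\<psi>\<close> of \<open>exp W\<close>, for \<open>W\<close> obtained from \<open>interpolate_to_model\<close>, is uniformly close to \<open>\<phi>\<close>, but its range is
  an interval \<open>(A, B)\<close> only close to \<open>(a, b)\<close>.  The affine map from \<open>(A, B)\<close> onto \<open>(a, b)\<close> corrects this; it adds
  a constant to the logarithm of the derivative and hence does not change its increments.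
\<close>

lemma approximating_compactification:
  assumes ab: "a < b" and \<phi>: "\<And>t. (\<phi> has_real_derivative u t) (at t)" and pos: "\<And>t. 0 < u t"
    and cont: "continuous_on UNIV u" and top: "(\<phi> \<longlongrightarrow> b) at_top" and bot: "(\<phi> \<longlongrightarrow> a) at_bot"
    and inc_top: "(increment (\<lambda>t. ln (u t)) \<longlongrightarrow> 0) at_top"
    and inc_bot: "(increment (\<lambda>t. ln (u t)) \<longlongrightarrow> 0) at_bot" and \<eta>: "0 < \<eta>"
  obtains \<kappa> \<Phi> W where "compactification a b \<kappa> \<Phi>" "\<And>t. deriv \<Phi> t = \<kappa> * exp (W t)"
    "\<And>t. \<bar>increment W t - increment (\<lambda>t. ln (u t)) t\<bar> \<le> \<eta>" "\<And>t. \<bar>\<Phi> t - \<phi> t\<bar> \<le> \<eta>"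
proof -
  \<comment> \<open>The relative error \<open>c\<close> of the speed up to \<open>N\<close> contributes at most \<open>c (b - a)\<close> to the distance.\<close>
  define c where "c = Min {1, \<eta>, \<eta> / (8 * (b - a))}"
  have c: "0 < c" "c \<le> 1" "c \<le> \<eta>" "c * (b - a) \<le> \<eta> / 8"
  proof -
    show "0 < c" "c \<le> 1" "c \<le> \<eta>" using ab \<eta> by (auto simp: c_def)
    have "c \<le> \<eta> / (8 * (b - a))" by (simp add: c_def)
    then show "c * (b - a) \<le> \<eta> / 8" using ab by (simp add: field_simps)
  qed
  define e where "e = ln (1 + c)"
  have e: "0 < e" "e \<le> c" "exp e = 1 + c" using c ln_add_one_self_le_self[of c] by (auto simp: e_def)
  have \<phi>_strict: "\<phi> s < \<phi> t" if "s < t" for s t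
    by (rule DERIV_pos_imp_increasing[OF that]) (use \<phi> pos in blast)
  then have \<phi>_le: "\<phi> s \<le> \<phi> t" if "s \<le> t" for s t
    using that by (cases "s = t") (auto simp: less_imp_le)
  have \<phi>_less: "\<phi> t < b" for t
  proof -
    have "\<phi> (t + 1) \<le> b"
    proof (rule tendsto_lowerbound[OF top])
      show "\<forall>\<^sub>F s in at_top. \<phi> (t + 1) \<le> \<phi> s"
        using eventually_ge_at_top[of "t + 1"] by eventually_elim (rule \<phi>_le)
    qed simp
    then show ?thesis using \<phi>_strict[of t "t + 1"] by simp
  qed
  have \<phi>_greater: "a < \<phi> t" for t
  proof -
    have "a \<le> \<phi> (t - 1)"
    proof (rule tendsto_upperbound[OF bot])
      show "\<forall>\<^sub>F s in at_bot. \<phi> s \<le> \<phi> (t - 1)"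
        using eventually_le_at_bot[of "t - 1"] by eventually_elim (rule \<phi>_le)
    qed simp
    then show ?thesis using \<phi>_strict[of "t - 1" t] by simp
  qed
  have lncont: "continuous_on UNIV (\<lambda>t. ln (u t))"
    by (intro continuous_intros cont) (use pos in \<open>simp add: less_imp_neq[symmetric]\<close>)
  have botN: "\<forall>\<^sub>F N in at_top. \<phi> (- N) < a + \<eta> / 16"
    using order_tendstoD(2)[OF bot, of "a + \<eta> / 16"] \<eta> by (simp add: at_bot_mirror eventually_filtermap)
  have ev: "\<forall>\<^sub>F N in at_top. (\<exists>W. smooth_on UNIV W \<and> (\<forall>t. 2 * N \<le> \<bar>t\<bar> \<longrightarrow> W t = log_deriv_model \<bar>t\<bar>)
    \<and> (\<forall>t. \<bar>increment W t - increment (\<lambda>t. ln (u t)) t\<bar> \<le> e) \<and> (\<forall>t. \<bar>t\<bar> \<le> N \<longrightarrow> \<bar>W t - ln (u t)\<bar> \<le> e)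
    \<and> (\<forall>t. N \<le> \<bar>t\<bar> \<longrightarrow> exp (W t) \<le> exp e * exp (ln (u t)) + exp (log_deriv_model \<bar>t\<bar>)))
    \<and> exp 1 < N \<and> b - \<eta> / 16 < \<phi> N \<and> \<phi> (- N) < a + \<eta> / 16 \<and> 1 / ln (ln N) < \<eta> / 16"
  proof (intro eventually_conj interpolate_to_model lncont inc_top inc_bot e(1) eventually_gt_at_top botN)
    show "\<forall>\<^sub>F N in at_top. b - \<eta> / 16 < \<phi> N" using \<eta> by (intro order_tendstoD(1)[OF top]) simp
    have "((\<lambda>N::real. 1 / ln (ln N)) \<longlongrightarrow> 0) at_top" by real_asymp
    then show "\<forall>\<^sub>F N in at_top. 1 / ln (ln N) < \<eta> / 16" by (rule order_tendstoD(2)) (use \<eta> in simp)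
  qed
  from eventually_happens'[OF trivial_limit_at_top_linorder ev]
  obtain N W where N: "exp 1 < N" "b - \<eta> / 16 < \<phi> N" "\<phi> (- N) < a + \<eta> / 16" "1 / ln (ln N) < \<eta> / 16"
    and W1: "smooth_on UNIV W" "\<forall>t. 2 * N \<le> \<bar>t\<bar> \<longrightarrow> W t = log_deriv_model \<bar>t\<bar>"
      "\<forall>t. \<bar>increment W t - increment (\<lambda>t. ln (u t)) t\<bar> \<le> e"
      "\<forall>t. \<bar>t\<bar> \<le> N \<longrightarrow> \<bar>W t - ln (u t)\<bar> \<le> e"
      "\<forall>t. N \<le> \<bar>t\<bar> \<longrightarrow> exp (W t) \<le> exp e * exp (ln (u t)) + exp (log_deriv_model \<bar>t\<bar>)"
    by (elim exE conjE) (rule that)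
  have W: "smooth_on UNIV W" "\<And>t. 2 * N \<le> \<bar>t\<bar> \<Longrightarrow> W t = log_deriv_model \<bar>t\<bar>"
    "\<And>t. \<bar>increment W t - increment (\<lambda>t. ln (u t)) t\<bar> \<le> e"
    "\<And>t. \<bar>t\<bar> \<le> N \<Longrightarrow> \<bar>W t - ln (u t)\<bar> \<le> e"
    "\<And>t. N \<le> \<bar>t\<bar> \<Longrightarrow> exp (W t) \<le> (1 + c) * u t + exp (log_deriv_model \<bar>t\<bar>)"
    using W1 by (simp_all add: pos e(3))
  have N0: "0 < N" by (rule iterated_ln_pos(1)[OF N(1)])
  have expW: "smooth_on UNIV (\<lambda>t. exp (W t))" by (intro smooth_intros W(1))
  obtain \<psi> where \<psi>: "\<And>t. (\<psi> has_real_derivative exp (W t)) (at t)" "\<psi> 0 = \<phi> 0"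
    using exists_primitive[OF smooth_on_imp_continuous_on[OF open_UNIV expW], of "\<phi> 0"] by metis
  have mid: "\<bar>exp (W t) - u t\<bar> \<le> c * u t" if "\<bar>t\<bar> \<le> N" for t
  proof -
    have "exp (W t) \<le> exp (e + ln (u t))" "exp (- e + ln (u t)) \<le> exp (W t)"
      unfolding exp_le_cancel_iff using W(4)[OF that] by linarith+
    moreover have "exp (e + ln (u t)) = (1 + c) * u t" "exp (- e + ln (u t)) = u t / (1 + c)"
      using pos[of t] unfolding exp_add exp_minus e(3) by (simp_all add: divide_inverse mult.commute)
    ultimately have 1: "exp (W t) \<le> (1 + c) * u t" and 2: "u t / (1 + c) \<le> exp (W t)"
      by (simp_all only:)
    have "(1 - c) * u t \<le> u t / (1 + c)"
    proof -
      have "(1 - c) * (1 + c) * u t \<le> 1 * u t"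
        using pos[of t] by (intro mult_right_mono) (auto simp: algebra_simps)
      then show ?thesis using c by (simp add: field_simps)
    qed
    then show ?thesis using 1 2 by (simp add: abs_le_iff algebra_simps)
  qed
  have right: "\<bar>\<psi> t - \<phi> t\<bar> \<le> \<eta> / 2" if "0 \<le> t" for t
  proof -
    have "\<bar>\<psi> t - \<phi> t\<bar> \<le> c * (\<phi> N - \<phi> 0) + ((1 + c) * (b - \<phi> N) + 1 / ln (ln N))"
    proof (rule half_line_estimate[OF \<phi> \<psi>(1) pos _ \<psi>(2) _ N(1) _ _ _ that])
      show "exp (W t) \<le> (1 + c) * u t + exp (log_deriv_model t)" if "N \<le> t" for t
        using W(5)[of t] that N0 by simp
    qed (use c mid \<phi>_less in \<open>auto simp: less_imp_le\<close>)
    moreover have "c * (\<phi> N - \<phi> 0) \<le> c * (b - a)"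
      using c \<phi>_less[of N] \<phi>_greater[of 0] by (intro mult_left_mono) auto
    moreover have "(1 + c) * (b - \<phi> N) \<le> 2 * (\<eta> / 16)"
      using c N(2) \<phi>_less[of N] by (intro mult_mono) auto
    ultimately show ?thesis using c(4) N(4) \<eta> by linarith
  qed
  have left: "\<bar>\<psi> (- t) - \<phi> (- t)\<bar> \<le> \<eta> / 2" if "0 \<le> t" for t
  proof -
    have "\<bar>- \<psi> (- t) - - \<phi> (- t)\<bar> \<le> c * (- \<phi> (- N) - - \<phi> (- 0)) + ((1 + c) * (- a - - \<phi> (- N)) + 1 / ln (ln N))"
    proof (rule half_line_estimate[where u = "\<lambda>t. u (- t)" and v = "\<lambda>t. exp (W (- t))"])
      show "((\<lambda>t. - \<phi> (- t)) has_real_derivative u (- t)) (at t)" for t by (rule DERIV_compose_reflect[OF \<phi>])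
      show "((\<lambda>t. - \<psi> (- t)) has_real_derivative exp (W (- t))) (at t)" for t by (rule DERIV_compose_reflect[OF \<psi>(1)])
      show "exp (W (- t)) \<le> (1 + c) * u (- t) + exp (log_deriv_model t)" if "N \<le> t" for t
        using W(5)[of "- t"] that N0 by simp
      show "\<bar>exp (W (- t)) - u (- t)\<bar> \<le> c * u (- t)" if "0 \<le> t" "t \<le> N" for t
        using mid[of "- t"] that by simp
    qed (use c pos \<psi>(2) N(1) \<phi>_greater that in \<open>auto simp: less_imp_le\<close>)
    moreover have "c * (- \<phi> (- N) - - \<phi> (- 0)) \<le> c * (b - a)"
      using c \<phi>_greater[of "- N"] \<phi>_less[of 0] by (intro mult_left_mono) auto
    moreover have "(1 + c) * (- a - - \<phi> (- N)) \<le> 2 * (\<eta> / 16)"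
      using c N(3) \<phi>_greater[of "- N"] by (intro mult_mono) auto
    ultimately show ?thesis using c(4) N(4) \<eta> by linarith
  qed
  have close: "\<bar>\<psi> t - \<phi> t\<bar> \<le> \<eta> / 2" for t
    using right[of t] left[of "- t"] by (cases "0 \<le> t") auto
  have \<psi>_strict: "\<psi> s < \<psi> t" if "s < t" for s t
    by (rule DERIV_pos_imp_increasing[OF that]) (use \<psi> exp_gt_zero in blast)
  define B where "B = \<psi> (2 * N) + 1 / ln (ln (2 * N))"
  define A where "A = \<psi> (- (2 * N)) - 1 / ln (ln (2 * N))"
  have e2N: "exp 1 < 2 * N" using N(1) N0 by linarith
  have \<psi>_top: "\<psi> t = B - 1 / ln (ln t)" if "2 * N \<le> t" for t
  proof -
    have "\<psi> t - \<psi> (2 * N) \<le> - 1 / ln (ln t) - - 1 / ln (ln (2 * N))"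
      by (rule DERIV_mono[OF that \<psi>(1) DERIV_model]) (use e2N W(2) N0 in auto)
    moreover have "- 1 / ln (ln t) - - 1 / ln (ln (2 * N)) \<le> \<psi> t - \<psi> (2 * N)"
      by (rule DERIV_mono[OF that DERIV_model \<psi>(1)]) (use e2N W(2) N0 in auto)
    ultimately show ?thesis by (simp add: B_def)
  qed
  have \<psi>_bot: "\<psi> (- t) = A + 1 / ln (ln t)" if "2 * N \<le> t" for t
  proof -
    have D: "((\<lambda>t. - \<psi> (- t)) has_real_derivative exp (W (- t))) (at t)" for t by (rule DERIV_compose_reflect[OF \<psi>(1)])
    have "- \<psi> (- t) - - \<psi> (- (2 * N)) \<le> - 1 / ln (ln t) - - 1 / ln (ln (2 * N))"
      by (rule DERIV_mono[OF that D DERIV_model]) (use e2N W(2) N0 in auto)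
    moreover have "- 1 / ln (ln t) - - 1 / ln (ln (2 * N)) \<le> - \<psi> (- t) - - \<psi> (- (2 * N))"
      by (rule DERIV_mono[OF that DERIV_model D]) (use e2N W(2) N0 in auto)
    ultimately show ?thesis by (simp add: A_def)
  qed
  have loglog0: "((\<lambda>t::real. 1 / ln (ln t)) \<longlongrightarrow> 0) at_top" by real_asymp
  have B_close: "\<bar>B - b\<bar> \<le> \<eta> / 2"
  proof (rule tendsto_upperbound)
    have "((\<lambda>t. \<bar>(B - 1 / ln (ln t)) - \<phi> t\<bar>) \<longlongrightarrow> \<bar>(B - 0) - b\<bar>) at_top"
      by (intro tendsto_intros loglog0 top)
    then show "((\<lambda>t. \<bar>(B - 1 / ln (ln t)) - \<phi> t\<bar>) \<longlongrightarrow> \<bar>B - b\<bar>) at_top" by simp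
    show "\<forall>\<^sub>F t in at_top. \<bar>(B - 1 / ln (ln t)) - \<phi> t\<bar> \<le> \<eta> / 2"
      using eventually_ge_at_top[of "2 * N"] by eventually_elim (metis \<psi>_top close)
  qed simp
  have A_close: "\<bar>A - a\<bar> \<le> \<eta> / 2"
  proof (rule tendsto_upperbound)
    have "((\<lambda>t. \<phi> (- t)) \<longlongrightarrow> a) at_top" using bot by (simp add: at_bot_mirror filterlim_filtermap)
    then have "((\<lambda>t. \<bar>(A + 1 / ln (ln t)) - \<phi> (- t)\<bar>) \<longlongrightarrow> \<bar>(A + 0) - a\<bar>) at_top"
      by (intro tendsto_intros loglog0)
    then show "((\<lambda>t. \<bar>(A + 1 / ln (ln t)) - \<phi> (- t)\<bar>) \<longlongrightarrow> \<bar>A - a\<bar>) at_top" by simp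
    show "\<forall>\<^sub>F t in at_top. \<bar>(A + 1 / ln (ln t)) - \<phi> (- t)\<bar> \<le> \<eta> / 2"
      using eventually_ge_at_top[of "2 * N"] by eventually_elim (metis \<psi>_bot close)
  qed simp
  have \<psi>_range: "A < \<psi> t" "\<psi> t < B" for t
  proof -
    define s where "s = max (\<bar>t\<bar> + 1) (2 * N)"
    have s: "2 * N \<le> s" "t < s" "- s < t" by (auto simp: s_def)
    have "0 < 1 / ln (ln s)" using iterated_ln_pos(3)[of s] e2N s by simp
    then show "A < \<psi> t" "\<psi> t < B" 
      using \<psi>_top[OF s(1)] \<psi>_bot[OF s(1)] \<psi>_strict[OF s(2)] \<psi>_strict[OF s(3)] by linarith+
  qed
  have AB: "A < B" using \<psi>_range[of 0] by linarith
  define \<kappa> where "\<kappa> = (b - a) / (B - A)"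
  have \<kappa>: "0 < \<kappa>" "\<kappa> * (B - A) = b - a" using ab AB by (simp_all add: \<kappa>_def)
  define \<Phi> where "\<Phi> = (\<lambda>t. a + \<kappa> * (\<psi> t - A))"
  have D: "(\<Phi> has_real_derivative \<kappa> * exp (W t)) (at t)" for t
    unfolding \<Phi>_def by (auto intro!: derivative_eq_intros \<psi>)
  have dPhi: "deriv \<Phi> t = \<kappa> * exp (W t)" for t by (rule DERIV_imp_deriv[OF D])
  show ?thesis
  proof (rule that[OF _ dPhi])
    have "smooth_on UNIV \<Phi>" by (rule smooth_onI_deriv[OF D]) (intro smooth_intros W(1))
    moreover have "\<forall>\<^sub>F t in at_top. \<Phi> t = b - \<kappa> / ln (ln t) \<and> \<Phi> (- t) = a + \<kappa> / ln (ln t)"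
      using eventually_ge_at_top[of "2 * N"]
    proof eventually_elim
      case (elim t)
      have "\<Phi> t = a + \<kappa> * (B - A) - \<kappa> / ln (ln t)" by (simp add: \<Phi>_def \<psi>_top[OF elim] algebra_simps)
      moreover have "\<Phi> (- t) = a + \<kappa> / ln (ln t)" by (simp add: \<Phi>_def \<psi>_bot[OF elim])
      ultimately show ?case using \<kappa> by simp
    qed
    ultimately show "compactification a b \<kappa> \<Phi>" using \<kappa>(1) by (simp add: compactification_def dPhi)
    show "\<bar>increment W t - increment (\<lambda>t. ln (u t)) t\<bar> \<le> \<eta>" for t using W(3)[of t] e c by linarith
    show "\<bar>\<Phi> t - \<phi> t\<bar> \<le> \<eta>" for t
    proof -
      \<comment> \<open>Both \<open>\<psi> t\<close> and \<open>\<Phi> t\<close> divide their ranges in the ratio \<open>s\<close>, so they differ by at most the larger of the two end errors.\<close>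
      define s where "s = (\<psi> t - A) / (B - A)"
      have s: "0 \<le> s" "s \<le> 1" "\<psi> t = A + s * (B - A)" using \<psi>_range[of t] AB by (simp_all add: s_def)
      have "\<Phi> t = a + s * (b - a)" by (simp add: \<Phi>_def \<kappa>_def s_def)
      then have "\<Phi> t - \<psi> t = (1 - s) * (a - A) + s * (b - B)" unfolding s(3) by (simp add: algebra_simps)
      moreover have scale: "\<bar>r * x\<bar> \<le> r * (\<eta> / 2)" if "0 \<le> r" "\<bar>x\<bar> \<le> \<eta> / 2" for r x
        using mult_left_mono[OF that(2,1)] that(1) by (simp add: abs_mult)
      moreover have "\<bar>(1 - s) * (a - A)\<bar> \<le> (1 - s) * (\<eta> / 2)" "\<bar>s * (b - B)\<bar> \<le> s * (\<eta> / 2)"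
        using A_close B_close s(1,2) by (intro scale; simp add: abs_minus_commute)+
      moreover have "(1 - s) * (\<eta> / 2) + s * (\<eta> / 2) = \<eta> / 2" by (simp add: field_simps)
      ultimately have "\<bar>\<Phi> t - \<psi> t\<bar> \<le> \<eta> / 2" by linarith
      then show ?thesis using close[of t] by linarith
    qed
  qed
qed

section \<open>Approximation between two consecutive fixed points\<close>

definition conjugate_to_powers :: "real \<Rightarrow> real \<Rightarrow> (real \<Rightarrow> real) \<Rightarrow> bool" where
  "conjugate_to_powers a b g \<longleftrightarrow> supported_diffeo a b g \<and>
     (\<forall>k::nat. 1 \<le> k \<longrightarrow> (\<exists>h. supported_diffeo a b h \<and> (\<forall>x. h (g x) = (g ^^ k) (h x))))"

lemma supported_diffeo_deriv:
  assumes "supported_diffeo a b g"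
  shows "(g has_real_derivative deriv g x) (at x)" "0 < deriv g x" "x \<notin> {a<..<b} \<Longrightarrow> deriv g x = 1"
    "x \<notin> {a<..<b} \<Longrightarrow> g x = x" "smooth_on UNIV g" "strict_mono g"
proof -
  show sm: "smooth_on UNIV g" and pos: "0 < deriv g x" for x using assms by (simp_all add: supported_diffeo_def)
  show "(g has_real_derivative deriv g x) (at x)" using smooth_on_deriv(1)[OF open_UNIV sm] by simp
  show out: "x \<notin> {a<..<b} \<Longrightarrow> g x = x" for x using assms unfolding supported_diffeo_def by blast
  show "x \<notin> {a<..<b} \<Longrightarrow> deriv g x = 1" by (rule deriv_eq_1_outside[OF sm out])
  show "strict_mono g" by (rule strict_mono_of_deriv_pos[OF sm pos])
qed

lemma supported_diffeo_maps:
  assumes "supported_diffeo a b g" "x \<in> {a<..<b}" shows "g x \<in> {a<..<b}"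
proof -
  have "g a = a" "g b = b" by (auto intro!: supported_diffeo_deriv(4)[OF assms(1)])
  then show ?thesis
    using strict_monoD[OF supported_diffeo_deriv(6)[OF assms(1)], of a x]
      strict_monoD[OF supported_diffeo_deriv(6)[OF assms(1)], of x b] assms(2) by auto
qed

text \<open>
  At the point \<open>\<Phi> t\<close> the derivative of the transported translation is \<open>exp\<close> of an increment of \<open>ln \<Phi>'\<close>, while
  \<open>f' (\<phi> t)\<close> is \<open>exp\<close> of the corresponding increment of \<open>ln \<phi>'\<close>; the points \<open>\<Phi> t\<close> and \<open>\<phi> t\<close> are close.
\<close>

lemma approximate_pushing_map:
  assumes "pushing_map a b f f'" and closed_cont': "continuous_on {a..b} f'" and par: "f' a = 1" "f' b = 1"
    and \<epsilon>: "0 < \<epsilon>"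
  shows "\<exists>g. conjugate_to_powers a b g \<and> (\<forall>x\<in>{a<..<b}. g x \<noteq> x) \<and> (\<forall>x\<in>{a..b}. \<bar>deriv g x - f' x\<bar> \<le> \<epsilon>)"
proof -
  interpret pushing_map a b f f' by (rule assms(1))
  define l where "l = (\<lambda>t. ln (deriv \<phi> t))"
  have inc: "increment l t = ln (f' (\<phi> t))" for t
    using \<phi>_deriv(2)[of t] pos[OF \<phi>_maps[of t]] by (simp add: increment_def l_def \<phi>'_plus_1 ln_mult)
  have in_ab: "\<phi> t \<in> {a..b}" for t using \<phi>_maps[of t] by auto
  have inc_top: "(increment l \<longlongrightarrow> 0) at_top"
  proof -
    have "((\<lambda>t. f' (\<phi> t)) \<longlongrightarrow> f' b) at_top"
      by (rule continuous_on_tendsto_compose[OF closed_cont' \<phi>_at_top]) (use ab in_ab in auto)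
    then have "((\<lambda>t. ln (f' (\<phi> t))) \<longlongrightarrow> ln 1) at_top" unfolding par by (intro tendsto_ln) auto
    then show ?thesis by (simp add: inc[abs_def])
  qed
  have inc_bot: "(increment l \<longlongrightarrow> 0) at_bot"
  proof -
    have "((\<lambda>t. f' (\<phi> t)) \<longlongrightarrow> f' a) at_bot"
      by (rule continuous_on_tendsto_compose[OF closed_cont' \<phi>_at_bot]) (use ab in_ab in auto)
    then have "((\<lambda>t. ln (f' (\<phi> t))) \<longlongrightarrow> ln 1) at_bot" unfolding par by (intro tendsto_ln) auto
    then show ?thesis by (simp add: inc[abs_def])
  qed
  have "compact (f' ` {a..b})" by (intro compact_continuous_image closed_cont') auto
  then obtain M where M: "\<And>x. x \<in> {a..b} \<Longrightarrow> \<bar>f' x\<bar> \<le> M"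
    by (metis bounded_iff compact_imp_bounded image_eqI real_norm_def)
  have M1: "1 \<le> M" using M[of a] par ab by simp
  have "uniformly_continuous_on {a..b} f'" by (rule compact_uniformly_continuous[OF closed_cont']) simp
  then obtain \<delta> where \<delta>: "0 < \<delta>" "\<And>x y. x \<in> {a..b} \<Longrightarrow> y \<in> {a..b} \<Longrightarrow> \<bar>y - x\<bar> < \<delta> \<Longrightarrow> \<bar>f' y - f' x\<bar> < \<epsilon> / 2"
    using \<epsilon> unfolding uniformly_continuous_on_def dist_real_def by (metis half_gt_zero)
  \<comment> \<open>The first bound keeps \<open>\<Phi> t\<close> and \<open>\<phi> t\<close> within \<open>\<delta>\<close>, the second keeps the quotient of the derivatives within \<open>\<epsilon> / (2 M)\<close> of \<open>1\<close>.\<close>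
  define \<eta> where "\<eta> = min (\<delta> / 2) (ln (1 + \<epsilon> / (2 * M)))"
  have "0 < \<epsilon> / (2 * M)" using \<epsilon> M1 by simp
  then have "0 < ln (1 + \<epsilon> / (2 * M))" by (intro ln_gt_zero) simp
  then have \<eta>: "0 < \<eta>" "\<eta> < \<delta>" using \<delta>(1) by (auto simp: \<eta>_def)
  have exp_\<eta>: "M * (exp \<eta> - 1) \<le> \<epsilon> / 2"
  proof -
    have p: "0 < 1 + \<epsilon> / (2 * M)" using \<epsilon> M1 by (simp add: add_pos_pos)
    have "exp \<eta> \<le> exp (ln (1 + \<epsilon> / (2 * M)))" by (simp add: \<eta>_def)
    also have "\<dots> = 1 + \<epsilon> / (2 * M)" using p by simp
    finally show ?thesis using M1 by (simp add: field_simps)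
  qed
  obtain \<kappa> \<Phi> W where C: "compactification a b \<kappa> \<Phi>" and d\<Phi>: "\<And>t. deriv \<Phi> t = \<kappa> * exp (W t)"
    and W: "\<And>t. \<bar>increment W t - increment l t\<bar> \<le> \<eta>" and close: "\<And>t. \<bar>\<Phi> t - \<phi> t\<bar> \<le> \<eta>"
    by (rule approximating_compactification[OF ab \<phi>_deriv \<phi>'_cont \<phi>_at_top \<phi>_at_bot
          inc_top[unfolded l_def] inc_bot[unfolded l_def] \<eta>(1), folded l_def]) (rule that)
  define g where "g = transport a b \<Phi> (\<lambda>t. t + 1)"
  note T = transport_conjugacy[OF C, folded g_def]
  have close': "\<bar>deriv g x - f' x\<bar> \<le> \<epsilon>" if x: "x \<in> {a..b}" for x
  proof (rule transport_cases[OF C, of x])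
    fix t assume t: "x = \<Phi> t"
    have "deriv g x = deriv \<Phi> (t + 1) / deriv \<Phi> t" unfolding t by (rule DERIV_imp_deriv[OF T(2)])
    also have "\<dots> = exp (increment W t)" using compactificationD(1)[OF C] by (simp add: d\<Phi> increment_def exp_diff)
    finally have dg: "deriv g x = exp (increment W t)" .
    define y where "y = f' (\<phi> t)"
    have y: "0 < y" "y \<le> M" using pos[OF \<phi>_maps] M[OF in_ab[of t]] by (auto simp: y_def)
    define z where "z = increment W t - ln y"
    have z: "\<bar>z\<bar> \<le> \<eta>" using W[of t] by (simp add: z_def y_def inc)
    have W_z: "exp (increment W t) = y * exp z" using y(1) by (simp add: z_def exp_diff)
    have "\<bar>exp z - 1\<bar> \<le> exp \<eta> - 1"
    proof -
      have "exp z \<le> exp \<eta>" "exp (- \<eta>) \<le> exp z" using z by auto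
      moreover have "2 \<le> exp \<eta> + exp (- \<eta>)"
        using exp_ge_add_one_self[of \<eta>] exp_ge_add_one_self[of "- \<eta>"] by linarith
      ultimately show ?thesis by linarith
    qed
    from this have "y * \<bar>exp z - 1\<bar> \<le> M * (exp \<eta> - 1)" using y by (intro mult_mono) auto
    moreover have "\<bar>y * exp z - y\<bar> = y * \<bar>exp z - 1\<bar>"
      using y(1) abs_mult[of y "exp z - 1"] by (simp add: right_diff_distrib)
    ultimately have "\<bar>deriv g x - f' (\<phi> t)\<bar> \<le> \<epsilon> / 2" using exp_\<eta> unfolding dg W_z y_def[symmetric] by linarith
    moreover have "\<bar>f' x - f' (\<phi> t)\<bar> < \<epsilon> / 2"
      by (rule \<delta>(2)[OF in_ab x]) (use close[of t] \<eta> t in linarith)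
    ultimately show ?thesis by linarith
  next
    assume "x \<notin> {a<..<b}"
    then have "x = a \<or> x = b" using x by auto
    then show ?thesis using supported_diffeo_deriv(3)[OF T(1) \<open>x \<notin> {a<..<b}\<close>] par \<epsilon> by auto
  qed
  have "conjugate_to_powers a b g" unfolding conjugate_to_powers_def using T(1,4) by simp
  then show ?thesis using T(3) close' by (intro exI[of _ g]) simp
qed

lemma supported_diffeo_reflect:
  assumes "supported_diffeo a b g" shows "supported_diffeo (- b) (- a) (\<lambda>x. - g (- x))"
  unfolding supported_diffeo_def
proof (intro conjI allI impI)
  note S = supported_diffeo_deriv[OF assms]
  show "smooth_on UNIV (\<lambda>x. - g (- x))" using smooth_on_reflect[OF S(5)] by (simp add: surj_uminus)
  show "0 < deriv (\<lambda>x. - g (- x)) x" for x using S(2) by (simp add: deriv_reflect[OF S(5)])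
  show "- g (- x) = x" if "x \<notin> {- b<..<- a}" for x
    using S(4)[of "- x"] that by force
qed

lemma conjugate_to_powers_reflect:
  assumes "conjugate_to_powers a b g" shows "conjugate_to_powers (- b) (- a) (\<lambda>x. - g (- x))"
  unfolding conjugate_to_powers_def
proof (intro conjI allI impI)
  show "supported_diffeo (- b) (- a) (\<lambda>x. - g (- x))"
    using assms by (auto simp: conjugate_to_powers_def intro: supported_diffeo_reflect)
  fix k :: nat assume "1 \<le> k"
  then obtain h where h: "supported_diffeo a b h" "\<And>x. h (g x) = (g ^^ k) (h x)"
    using assms unfolding conjugate_to_powers_def by blast
  have it: "((\<lambda>x. - g (- x)) ^^ n) x = - (g ^^ n) (- x)" for n x
    by (induction n) simp_all
  show "\<exists>h. supported_diffeo (- b) (- a) h \<and> (\<forall>x. h (- g (- x)) = ((\<lambda>x. - g (- x)) ^^ k) (h x))"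
    by (rule exI[of _ "\<lambda>x. - h (- x)"]) (simp add: it h supported_diffeo_reflect)
qed

text \<open>
  Either \<open>f x > x\<close> throughout the interval or \<open>f x < x\<close> throughout; conjugation by \<open>x \<mapsto> - x\<close> reduces the second case
  to the first.
\<close>

lemma approximate_between_fixed_points:
  assumes ab: "a < b" and cont: "continuous_on {a..b} f" and fixed: "f a = a" "f b = b"
    and deriv: "\<And>x. x \<in> {a<..<b} \<Longrightarrow> (f has_real_derivative f' x) (at x)"
    and pos: "\<And>x. x \<in> {a<..<b} \<Longrightarrow> 0 < f' x"
    and cont': "continuous_on {a..b} f'" and par: "f' a = 1" "f' b = 1"
    and free: "\<And>x. x \<in> {a<..<b} \<Longrightarrow> f x \<noteq> x" and \<epsilon>: "0 < \<epsilon>"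
  shows "\<exists>g. conjugate_to_powers a b g \<and> (\<forall>x\<in>{a<..<b}. g x \<noteq> x) \<and> (\<forall>x\<in>{a..b}. \<bar>deriv g x - f' x\<bar> \<le> \<epsilon>)"
proof -
  have cont_open: "continuous_on {a<..<b} (\<lambda>x. f x - x)"
    by (intro continuous_intros continuous_on_subset[OF cont]) auto
  have "(\<forall>x\<in>{a<..<b}. x < f x) \<or> (\<forall>x\<in>{a<..<b}. f x < x)"
  proof (rule ccontr)
    assume "\<not> ?thesis"
    then obtain x y where xy: "x \<in> {a<..<b}" "y \<in> {a<..<b}" "f x < x" "y < f y"
      using free by (metis linorder_neqE_linordered_idom)
    have "connected ((\<lambda>x. f x - x) ` {a<..<b})" by (intro connected_continuous_image cont_open) simp
    then have "0 \<in> (\<lambda>x. f x - x) ` {a<..<b}"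
      by (rule connectedD_interval[of _ "f x - x" "f y - y"]) (use xy in auto)
    then show False using free by auto
  qed
  then show ?thesis
  proof
    assume "\<forall>x\<in>{a<..<b}. x < f x"
    then have "pushing_map a b f f'"
      using ab cont fixed deriv pos continuous_on_subset[OF cont', of "{a<..<b}", OF greaterThanLessThan_subseteq_atLeastAtMost_iff[THEN iffD2]]
      by unfold_locales auto
    then show ?thesis by (rule approximate_pushing_map[OF _ cont' par \<epsilon>])
  next
    assume below: "\<forall>x\<in>{a<..<b}. f x < x"
    have neg: "continuous_on {- b..- a} (\<lambda>x. k (- x))" if "continuous_on {a..b} k" for k :: "real \<Rightarrow> real"
      by (rule continuous_on_compose2[OF that]) (auto intro: continuous_intros)
    have "pushing_map (- b) (- a) (\<lambda>x. - f (- x)) (\<lambda>x. f' (- x))"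
    proof
      show "((\<lambda>x. - f (- x)) has_real_derivative f' (- x)) (at x)" if "x \<in> {- b<..<- a}" for x
        by (rule DERIV_compose_reflect[OF deriv]) (use that in auto)
      show "x < - f (- x)" if "x \<in> {- b<..<- a}" for x
        using bspec[OF below, of "- x"] that by auto
      show "continuous_on {- b<..<- a} (\<lambda>x. f' (- x))"
        by (rule continuous_on_subset[OF neg[OF cont']]) auto
      show "continuous_on {- b..- a} (\<lambda>x. - f (- x))"
        by (intro continuous_on_minus neg cont)
    qed (use ab fixed pos in auto)
    from approximate_pushing_map[OF this neg[OF cont'] _ _ \<epsilon>] par
    obtain g where g: "conjugate_to_powers (- b) (- a) g" "\<forall>x\<in>{- b<..<- a}. g x \<noteq> x"
      "\<forall>x\<in>{- b..- a}. \<bar>deriv g x - f' (- x)\<bar> \<le> \<epsilon>" by auto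
    have sm: "smooth_on UNIV g" using g(1) by (simp add: conjugate_to_powers_def supported_diffeo_def)
    show ?thesis
    proof (intro exI[of _ "\<lambda>x. - g (- x)"] conjI ballI)
      show "conjugate_to_powers a b (\<lambda>x. - g (- x))" using conjugate_to_powers_reflect[OF g(1)] by simp
      show "- g (- x) \<noteq> x" if "x \<in> {a<..<b}" for x
      proof -
        have "g (- x) \<noteq> - x" using bspec[OF g(2), of "- x"] that by simp
        then show ?thesis by linarith
      qed
      show "\<bar>deriv (\<lambda>x. - g (- x)) x - f' x\<bar> \<le> \<epsilon>" if "x \<in> {a..b}" for x
        using g(3)[rule_format, of "- x"] that by (simp add: deriv_reflect[OF sm])
    qed
  qed
qed

section \<open>Placing diffeomorphisms side by side\<close>

text \<open>
  For \<open>g c\<close> supported on disjoint intervals \<open>(fst c, snd c)\<close> this is \<open>g c\<close> on the interval of \<open>c\<close> and the identity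
  elsewhere.  As a sum it is visibly smooth, even where two of the intervals share an end point.
\<close>

definition patch :: "(real \<times> real) set \<Rightarrow> (real \<times> real \<Rightarrow> real \<Rightarrow> real) \<Rightarrow> real \<Rightarrow> real" where
  "patch C g x = x + (\<Sum>c\<in>C. g c x - x)"

locale disjoint_intervals =
  fixes C :: "(real \<times> real) set"
  assumes fin: "finite C"
    and disj: "\<And>c c' x. c \<in> C \<Longrightarrow> c' \<in> C \<Longrightarrow> x \<in> {fst c<..<snd c} \<Longrightarrow> x \<in> {fst c'<..<snd c'} \<Longrightarrow> c = c'"
begin

abbreviation family :: "(real \<times> real \<Rightarrow> real \<Rightarrow> real) \<Rightarrow> bool" where
  "family g \<equiv> (\<forall>c\<in>C. supported_diffeo (fst c) (snd c) (g c))"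

lemma sum_inside:
  fixes F :: "real \<times> real \<Rightarrow> real"
  assumes "c \<in> C" "x \<in> {fst c<..<snd c}" "\<And>c'. c' \<in> C \<Longrightarrow> x \<notin> {fst c'<..<snd c'} \<Longrightarrow> F c' = 0"
  shows "(\<Sum>c'\<in>C. F c') = F c"
proof -
  have "F c' = 0" if "c' \<in> C - {c}" for c'
    using assms(3)[of c'] disj[OF assms(1) _ assms(2), of c'] that by blast
  then have "(\<Sum>c'\<in>C - {c}. F c') = 0" by (simp add: sum.neutral)
  then show ?thesis using sum.remove[OF fin assms(1), of F] by simp
qed

lemma patch_inside:
  assumes "family g" "c \<in> C" "x \<in> {fst c<..<snd c}"
  shows "patch C g x = g c x"
proof -
  have "(\<Sum>c'\<in>C. g c' x - x) = g c x - x"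
    by (rule sum_inside[OF assms(2,3)]) (use assms(1) supported_diffeo_deriv(4) in \<open>metis diff_self\<close>)
  then show ?thesis by (simp add: patch_def)
qed

lemma patch_outside:
  assumes "family g" "\<And>c. c \<in> C \<Longrightarrow> x \<notin> {fst c<..<snd c}"
  shows "patch C g x = x"
proof -
  have "g c x - x = 0" if "c \<in> C" for c
    using supported_diffeo_deriv(4)[OF bspec[OF assms(1) that] assms(2)[OF that]] by simp
  then show ?thesis by (simp add: patch_def)
qed

lemma deriv_patch:
  assumes "family g"
  shows "deriv (patch C g) x = 1 + (\<Sum>c\<in>C. deriv (g c) x - 1)"
proof (rule DERIV_imp_deriv)
  have "((\<lambda>x. x + (\<Sum>c\<in>C. g c x - x)) has_real_derivative 1 + (\<Sum>c\<in>C. deriv (g c) x - 1)) (at x)"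
    by (intro DERIV_add DERIV_ident DERIV_sum DERIV_diff supported_diffeo_deriv(1)) (use assms in blast)
  then show "(patch C g has_real_derivative 1 + (\<Sum>c\<in>C. deriv (g c) x - 1)) (at x)"
    by (simp add: patch_def[abs_def])
qed

lemma deriv_patch_inside:
  assumes "family g" "c \<in> C" "x \<in> {fst c<..<snd c}"
  shows "deriv (patch C g) x = deriv (g c) x"
proof -
  have "(\<Sum>c'\<in>C. deriv (g c') x - 1) = deriv (g c) x - 1"
    by (rule sum_inside[OF assms(2,3)]) (use assms(1) supported_diffeo_deriv(3) in \<open>metis diff_self\<close>)
  then show ?thesis by (simp add: deriv_patch[OF assms(1)])
qed

lemma deriv_patch_outside:
  assumes "family g" "\<And>c. c \<in> C \<Longrightarrow> x \<notin> {fst c<..<snd c}"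
  shows "deriv (patch C g) x = 1"
proof -
  have "deriv (g c) x - 1 = 0" if "c \<in> C" for c
    using supported_diffeo_deriv(3)[OF bspec[OF assms(1) that] assms(2)[OF that]] by simp
  then show ?thesis by (simp add: deriv_patch[OF assms(1)])
qed

lemma supported_diffeo_patch:
  assumes "family g" "\<And>c. c \<in> C \<Longrightarrow> a \<le> fst c \<and> snd c \<le> b"
  shows "supported_diffeo a b (patch C g)"
  unfolding supported_diffeo_def
proof (intro conjI allI impI)
  show "smooth_on UNIV (patch C g)" unfolding patch_def[abs_def]
    by (intro smooth_intros supported_diffeo_deriv(5)) (use assms in blast)
  show "0 < deriv (patch C g) x" for x
  proof (cases "\<exists>c\<in>C. x \<in> {fst c<..<snd c}")
    case True
    then obtain c where c: "c \<in> C" "x \<in> {fst c<..<snd c}" ..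
    show ?thesis
      using supported_diffeo_deriv(2)[OF bspec[OF assms(1) c(1)]] by (simp add: deriv_patch_inside[OF assms(1) c])
  next
    case False
    then show ?thesis using deriv_patch_outside[OF assms(1)] by simp
  qed
  show "patch C g x = x" if "x \<notin> {a<..<b}" for x
    by (rule patch_outside[OF assms(1)]) (use assms(2) that in force)
qed

text \<open>
  Each \<open>g c\<close> preserves its own interval, so the conjugacies of the pieces can be placed side by side too.
\<close>

lemma conjugate_to_powers_patch:
  assumes "\<And>c. c \<in> C \<Longrightarrow> conjugate_to_powers (fst c) (snd c) (g c)" "\<And>c. c \<in> C \<Longrightarrow> a \<le> fst c \<and> snd c \<le> b"
  shows "conjugate_to_powers a b (patch C g)"
  unfolding conjugate_to_powers_def
proof (intro conjI allI impI)
  have g: "family g" using assms(1) by (simp add: conjugate_to_powers_def)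
  show "supported_diffeo a b (patch C g)" by (rule supported_diffeo_patch[OF g assms(2)])
  fix k :: nat assume k: "1 \<le> k"
  have "\<exists>h. supported_diffeo (fst c) (snd c) h \<and> (\<forall>x. h (g c x) = (g c ^^ k) (h x))" if "c \<in> C" for c
    using assms(1)[OF that] k by (simp add: conjugate_to_powers_def)
  then obtain h where h: "\<And>c. c \<in> C \<Longrightarrow> supported_diffeo (fst c) (snd c) (h c)"
    "\<And>c x. c \<in> C \<Longrightarrow> h c (g c x) = (g c ^^ k) (h c x)" by metis
  have hf: "family h" using h(1) by blast
  have conj: "patch C h (patch C g x) = (patch C g ^^ k) (patch C h x)" for x
  proof (cases "\<exists>c\<in>C. x \<in> {fst c<..<snd c}")
    case True
    then obtain c where c: "c \<in> C" "x \<in> {fst c<..<snd c}" ..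
    note gc = bspec[OF g c(1)]
    have it: "(patch C g ^^ n) y = (g c ^^ n) y \<and> (g c ^^ n) y \<in> {fst c<..<snd c}" if "y \<in> {fst c<..<snd c}" for n y
      by (induction n) (use that patch_inside[OF g c(1)] supported_diffeo_maps[OF gc] in auto)
    have "patch C h (patch C g x) = h c (g c x)"
      using patch_inside[OF g c] patch_inside[OF hf c(1) supported_diffeo_maps[OF gc c(2)]] by simp
    also have "\<dots> = (g c ^^ k) (h c x)" by (rule h(2)[OF c(1)])
    also have "\<dots> = (patch C g ^^ k) (patch C h x)"
      using it[OF supported_diffeo_maps[OF h(1)[OF c(1)] c(2)]] patch_inside[OF hf c] by simp
    finally show ?thesis .
  next
    case False
    then have "patch C g x = x" "patch C h x = x" using patch_outside[OF g] patch_outside[OF hf] by simp_all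
    moreover from this have "(patch C g ^^ k) x = x" by (induction k) simp_all
    ultimately show ?thesis by simp
  qed
  show "\<exists>h. supported_diffeo a b h \<and> (\<forall>x. h (patch C g x) = (patch C g ^^ k) (h x))"
    by (rule exI[of _ "patch C h"]) (simp add: conj supported_diffeo_patch[OF hf assms(2)])
qed

end

section \<open>Diffeomorphisms of the unit interval\<close>

lemma D01_eqI:
  assumes "(F has_real_derivative D) (at x)" "\<And>y. y \<in> I01 \<Longrightarrow> f y = F y" "x \<in> I01"
  shows "(f has_real_derivative D) (at x within I01)" "D01 f x = D"
proof -
  show f: "(f has_real_derivative D) (at x within I01)"
    by (rule has_field_derivative_transform_within[OF has_field_derivative_at_within[OF assms(1)], of 1])
       (use assms(2,3) in auto)
  have "at x within I01 \<noteq> bot" using assms(3) by (simp add: trivial_limit_within)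
  then show "D01 f x = D"
    using f unfolding D01_def has_real_derivative_iff_has_vector_derivative
    by (intro vector_derivative_within)
qed

lemma C_diff_on_smooth:
  assumes "smooth_on UNIV F" "\<And>x. x \<in> I01 \<Longrightarrow> f x = F x"
  shows "C_diff_on r f"
proof -
  have iter: "\<exists>G. smooth_on UNIV G \<and> (\<forall>x\<in>I01. (D01 ^^ i) f x = G x)" for i
  proof (induction i)
    case 0
    then show ?case using assms by (intro exI[of _ F]) simp
  next
    case (Suc i)
    then obtain G where G: "smooth_on UNIV G" "\<And>x. x \<in> I01 \<Longrightarrow> (D01 ^^ i) f x = G x" by metis
    have "D01 ((D01 ^^ i) f) x = deriv G x" if "x \<in> I01" for x
      by (rule D01_eqI(2)[OF smooth_on_deriv(1)[OF open_UNIV G(1)] G(2) that]) auto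
    then show ?case using smooth_on_deriv(2)[OF open_UNIV G(1)] by (intro exI[of _ "deriv G"]) simp
  qed
  have "(D01 ^^ i) f differentiable_on I01 \<and> continuous_on I01 ((D01 ^^ i) f)" for i
  proof -
    obtain G where G: "smooth_on UNIV G" "\<And>x. x \<in> I01 \<Longrightarrow> (D01 ^^ i) f x = G x" using iter by metis
    have "((D01 ^^ i) f has_real_derivative deriv G x) (at x within I01)" if "x \<in> I01" for x
      by (rule D01_eqI(1)[OF smooth_on_deriv(1)[OF open_UNIV G(1)] G(2) that]) auto
    then have "(D01 ^^ i) f differentiable_on I01"
      unfolding differentiable_on_def by (meson has_field_derivative_imp_has_derivative differentiableI)
    then show ?thesis using differentiable_imp_continuous_on by blast
  qed
  then show ?thesis unfolding C_diff_on_def by blast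
qed

lemma supported_diffeo_inverse:
  assumes "supported_diffeo a b g" "a \<le> b"
  shows "bij g" "smooth_on UNIV (inv g)" "bij_betw g {a..b} {a..b}"
proof -
  note S = supported_diffeo_deriv[OF assms(1)]
  have fix_ends: "g x = x" if "x \<le> a \<or> b \<le> x" for x using that by (intro S(4)) auto
  have surj: "range g = UNIV"
  proof -
    have "y \<in> range g" for y
    proof -
      have cont: "continuous_on S g" for S
        using smooth_on_imp_continuous_on[OF open_UNIV S(5)] continuous_on_subset by blast
      have "g (min y a) \<le> y" "y \<le> g (max y b)" "min y a \<le> max y b"
        using fix_ends[of "min y a"] fix_ends[of "max y b"] assms(2) by auto
      then show ?thesis using IVT'[of g "min y a" y "max y b", OF _ _ _ cont] by auto
    qed
    then show ?thesis by blast
  qed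
  show bij: "bij g" using strict_mono_imp_inj_on[OF S(6)] surj by (simp add: bij_def)
  show "smooth_on UNIV (inv g)" by (rule smooth_on_inv[OF S(5,2)]) (simp_all add: surj)
  show "bij_betw g {a..b} {a..b}"
  proof (rule bij_betw_imageI)
    show "inj_on g {a..b}" using strict_mono_imp_inj_on[OF S(6)] inj_on_subset by blast
    have ab: "g a = a" "g b = b" using fix_ends by auto
    have le: "g x \<le> g y \<longleftrightarrow> x \<le> y" for x y using strict_mono_less_eq[OF S(6)] .
    show "g ` {a..b} = {a..b}"
    proof
      show "g ` {a..b} \<subseteq> {a..b}" using le[of a] le[of _ b] ab by auto
      show "{a..b} \<subseteq> g ` {a..b}"
      proof
        fix y assume y: "y \<in> {a..b}"
        obtain x where x: "y = g x" using surj by (metis surjD)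
        then have "x \<in> {a..b}" using y le[of a x] le[of x b] ab by simp
        then show "y \<in> g ` {a..b}" using x by blast
      qed
    qed
  qed
qed

lemma restrict_in_Diff_plus:
  assumes "supported_diffeo 0 1 g"
  shows "restrict g I01 \<in> Diff_plus r"
    and "\<And>y. y \<in> I01 \<Longrightarrow> inv_into I01 (restrict g I01) y = inv g y"
    and "\<And>x. x \<in> I01 \<Longrightarrow> D01 (restrict g I01) x = deriv g x"
proof -
  note S = supported_diffeo_deriv[OF assms] and I = supported_diffeo_inverse[OF assms zero_le_one]
  have bij: "bij_betw (restrict g I01) I01 I01"
    using I(3) by (subst bij_betw_cong[of _ _ g]) simp_all
  show inv: "inv_into I01 (restrict g I01) y = inv g y" if y: "y \<in> I01" for y
  proof -
    have "y \<in> g ` I01" using I(3) y by (simp add: bij_betw_def)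
    then obtain x where x: "x \<in> I01" "y = g x" by blast
    have "inv_into I01 (restrict g I01) (restrict g I01 x) = x"
      using bij x(1) by (intro inv_into_f_f) (auto simp: bij_betw_def)
    then show ?thesis using x I(1) by (simp add: bij_is_inj)
  qed
  have "strict_mono_on I01 (restrict g I01)"
    using S(6) by (auto simp: strict_mono_on_def strict_mono_def)
  moreover have "C_diff_on r (restrict g I01)" by (rule C_diff_on_smooth[OF S(5)]) simp
  moreover have "C_diff_on r (inv_into I01 (restrict g I01))" by (rule C_diff_on_smooth[OF I(2) inv])
  ultimately show "restrict g I01 \<in> Diff_plus r" using bij by (simp add: Diff_plus_def)
  show "D01 (restrict g I01) x = deriv g x" if "x \<in> I01" for x
    by (rule D01_eqI(2)[OF S(1) _ that]) simp
qed

lemma conjugates_to_restrict: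
  assumes g: "supported_diffeo 0 1 g" and h: "supported_diffeo 0 1 h" and conj: "\<And>x. h (g x) = (g ^^ k) (h x)"
  shows "conjugates_to (restrict h I01) (restrict g I01) (restrict g I01 ^^ k)"
  unfolding conjugates_to_def
proof
  fix y assume y: "y \<in> I01"
  note gI = supported_diffeo_inverse(3)[OF g zero_le_one] and hI = supported_diffeo_inverse(1,3)[OF h zero_le_one]
  have it: "(restrict g I01 ^^ n) y = (g ^^ n) y \<and> (g ^^ n) y \<in> I01" for n
    by (induction n) (use y bij_betwE[OF gI] in auto)
  have "y \<in> h ` I01" using hI(2) y by (simp add: bij_betw_def)
  then obtain x where x: "x \<in> I01" "y = h x" by blast
  have pre: "inv_into I01 (restrict h I01) y = x"
    unfolding restrict_in_Diff_plus(2)[OF h y] unfolding x(2) by (rule inv_f_f[OF bij_is_inj[OF hI(1)]])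
  have "g x \<in> I01" by (rule bij_betwE[OF gI, rule_format, OF x(1)])
  then have "restrict h I01 (restrict g I01 (inv_into I01 (restrict h I01) y)) = h (g x)"
    unfolding pre by (simp only: restrict_apply' x(1))
  also have "\<dots> = (restrict g I01 ^^ k) y" using it[of k] unfolding conj x(2) by (elim conjE) (rule sym)
  finally show "restrict h I01 (restrict g I01 (inv_into I01 (restrict h I01) y)) = (restrict g I01 ^^ k) y" .
qed

text \<open>
  The derivative of a diffeomorphism does not vanish, since the inverse is differentiable; it is \<open>1\<close> at the
  fixed point \<open>0\<close>, so it is positive everywhere.
\<close>

lemma Diff1_P_deriv_pos:
  assumes "f \<in> Diff1_P" "x \<in> I01" shows "0 < D01 f x"
proof (rule ccontr)
  have f: "f \<in> Diff_plus 1" using assms(1) by (simp add: Diff1_P_def)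
  note F = Diff_plus_1D[OF f]
  have "C_diff_on 1 (inv_into I01 f)" using f by (simp add: Diff_plus_def)
  then have "(D01 ^^ 0) (inv_into I01 f) differentiable_on I01"
    unfolding C_diff_on_def by (auto simp: one_enat_def)
  then have inv_diff: "inv_into I01 f differentiable_on I01" by simp
  have nz: "D01 f y \<noteq> 0" if y: "y \<in> I01" for y
  proof
    assume z: "D01 f y = 0"
    have fy: "f y \<in> I01" using bij_betwE[OF F(2)] y by blast
    obtain E where E: "(inv_into I01 f has_real_derivative E) (at (f y) within I01)"
      using inv_diff fy unfolding differentiable_on_def by (metis real_differentiableE)
    have "f ` I01 = I01" using F(2) by (simp add: bij_betw_def)
    with E have "(inv_into I01 f has_real_derivative E) (at (f y) within f ` I01)" by simp
    from DERIV_image_chain[OF this Diff_plus_1_has_derivative[OF f y]]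
    have "(inv_into I01 f \<circ> f has_real_derivative 0) (at y within I01)" by (simp add: z)
    then have "((\<lambda>x. x) has_real_derivative 0) (at y within I01)"
      by (rule has_field_derivative_transform_within[of _ _ _ _ 1])
         (use y F(2) in \<open>auto simp: bij_betw_def inv_into_f_f\<close>)
    moreover have "((\<lambda>x. x) has_real_derivative 1) (at y within I01)" by (rule DERIV_ident)
    moreover have "at y within I01 \<noteq> bot" using y by (simp add: trivial_limit_within)
    ultimately show False
      unfolding has_real_derivative_iff_has_vector_derivative using vector_derivative_unique_within by fastforce
  qed
  have one: "D01 f 0 = 1" using assms(1) Diff_plus_fixes_endpoints(1)[OF f] by (simp add: Diff1_P_def)
  assume "\<not> ?thesis"
  then have "\<exists>y\<ge>0. y \<le> x \<and> D01 f y = 0"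
    using assms(2) one by (intro IVT2' continuous_on_subset[OF F(5)]) auto
  then show False using nz assms(2) by auto
qed

section \<open>Density\<close>

lemma gap_around:
  assumes cont: "continuous_on I01 f" and ends: "f 0 = 0" "f 1 = (1::real)" and x: "x \<in> I01" "f x \<noteq> x"
  obtains a b where "0 \<le> a" "a < x" "x < b" "b \<le> 1" "f a = a" "f b = b" "\<And>y. y \<in> {a<..<b} \<Longrightarrow> f y \<noteq> y"
proof -
  define A where "A = {y \<in> {0..x}. f y - y = 0}"
  define B where "B = {y \<in> {x..1}. f y - y = 0}"
  have "closed A" unfolding A_def
    by (rule continuous_closed_preimage_constant)
       (use x in \<open>auto intro!: continuous_intros continuous_on_subset[OF cont]\<close>)
  moreover have "bounded A" by (rule bounded_subset[of "{0..x}"]) (auto simp: A_def)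
  ultimately have A: "compact A" by (simp add: compact_eq_bounded_closed)
  have "closed B" unfolding B_def
    by (rule continuous_closed_preimage_constant)
       (use x in \<open>auto intro!: continuous_intros continuous_on_subset[OF cont]\<close>)
  moreover have "bounded B" by (rule bounded_subset[of "{x..1}"]) (auto simp: B_def)
  ultimately have B: "compact B" by (simp add: compact_eq_bounded_closed)
  have "A \<noteq> {}" "B \<noteq> {}" using ends x by (auto simp: A_def B_def)
  then obtain a b where a: "a \<in> A" "\<And>y. y \<in> A \<Longrightarrow> y \<le> a" and b: "b \<in> B" "\<And>y. y \<in> B \<Longrightarrow> b \<le> y"
    using compact_attains_sup[OF A] compact_attains_inf[OF B] by metis
  show ?thesis
  proof (rule that[of a b])
    have "a \<noteq> x" "b \<noteq> x" using a(1) b(1) x(2) by (auto simp: A_def B_def)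
    then show "0 \<le> a" "a < x" "x < b" "b \<le> 1" "f a = a" "f b = b" using a(1) b(1) by (auto simp: A_def B_def)
    show "f y \<noteq> y" if "y \<in> {a<..<b}" for y
    proof
      assume "f y = y"
      then have "y \<le> x \<Longrightarrow> y \<in> A" "x \<le> y \<Longrightarrow> y \<in> B" 
        using that a(1) b(1) by (auto simp: A_def B_def)
      then show False using a(2)[of y] b(2)[of y] that by (cases "y \<le> x") auto
    qed
  qed
qed

text \<open>
  The approximating map is the identity except on the gaps between consecutive fixed points that have
  length at least \<open>\<delta>\<close>, of which there are finitely many.  A point of a shorter gap has a fixed point, where \<open>D01 f\<close> equals \<open>1\<close>, at distance less than \<open>\<delta>\<close>.
\<close>

lemma approximation:
  assumes f: "f \<in> Diff1_P" and \<epsilon>: "0 < \<epsilon>"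
  obtains g where "conjugate_to_powers 0 1 g" "\<And>x. g x = x \<Longrightarrow> deriv g x = 1"
    "\<And>x. x \<in> I01 \<Longrightarrow> \<bar>D01 f x - deriv g x\<bar> \<le> \<epsilon>"
proof -
  have f1: "f \<in> Diff_plus 1" using f by (simp add: Diff1_P_def)
  note F = Diff_plus_1D[OF f1] and ends = Diff_plus_fixes_endpoints[OF f1]
  have cont: "continuous_on I01 f" by (rule differentiable_imp_continuous_on[OF F(4)])
  have par: "D01 f a = 1" if "a \<in> I01" "f a = a" for a using f that by (simp add: Diff1_P_def)
  have "uniformly_continuous_on I01 (D01 f)" by (rule compact_uniformly_continuous[OF F(5)]) simp
  then obtain \<delta> where \<delta>: "0 < \<delta>" "\<And>x y. x \<in> I01 \<Longrightarrow> y \<in> I01 \<Longrightarrow> \<bar>y - x\<bar> < \<delta> \<Longrightarrow> \<bar>D01 f y - D01 f x\<bar> < \<epsilon>"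
    using \<epsilon> unfolding uniformly_continuous_on_def dist_real_def by metis
  define C where "C = {(a, b). 0 \<le> a \<and> b \<le> 1 \<and> f a = a \<and> f b = b \<and> (\<forall>x\<in>{a<..<b}. f x \<noteq> x) \<and> \<delta> \<le> b - a}"
  have C: "0 \<le> fst c" "snd c \<le> 1" "f (fst c) = fst c" "f (snd c) = snd c" "\<And>x. x \<in> {fst c<..<snd c} \<Longrightarrow> f x \<noteq> x"
    "\<delta> \<le> snd c - fst c" "fst c < snd c" if "c \<in> C" for c
    using that \<delta>(1) by (auto simp: C_def)
  have same: "c = c'" if c: "c \<in> C" "c' \<in> C" and overlap: "fst c < snd c'" "fst c' < snd c" for c c'
  proof -
    have "\<not> fst c < fst c'" "\<not> fst c' < fst c" "\<not> snd c < snd c'" "\<not> snd c' < snd c"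
      using C(3,4,5)[OF c(1)] C(3,4,5)[OF c(2)] overlap C(7)[OF c(1)] C(7)[OF c(2)] by (metis greaterThanLessThan_iff)+
    then show ?thesis by (simp add: prod_eq_iff)
  qed
  have finC: "finite C"
  proof (rule inj_on_finite)
    \<comment> \<open>Gaps of length at least \<open>\<delta>\<close> whose left ends are less than \<open>\<delta>\<close> apart overlap, and overlapping gaps coincide.\<close>
    show "inj_on (\<lambda>c. \<lfloor>fst c / \<delta>\<rfloor>) C"
    proof (rule inj_onI)
      fix c c' assume c: "c \<in> C" "c' \<in> C" "\<lfloor>fst c / \<delta>\<rfloor> = \<lfloor>fst c' / \<delta>\<rfloor>"
      then have "\<bar>fst c / \<delta> - fst c' / \<delta>\<bar> < 1" by linarith
      then have "\<bar>fst c - fst c'\<bar> < \<delta>" using \<delta>(1) by (simp add: diff_divide_distrib[symmetric] abs_divide)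
      then show "c = c'" using C(6)[OF c(1)] C(6)[OF c(2)] by (intro same[OF c(1,2)]) auto
    qed
    show "(\<lambda>c. \<lfloor>fst c / \<delta>\<rfloor>) ` C \<subseteq> {0..\<lfloor>1 / \<delta>\<rfloor>}"
    proof (intro image_subsetI)
      fix c assume c: "c \<in> C"
      have "0 \<le> fst c" "fst c \<le> 1" using C(1,2,7)[OF c] by auto
      then have "0 \<le> fst c / \<delta>" "fst c / \<delta> \<le> 1 / \<delta>" using \<delta>(1) by (simp_all add: divide_right_mono)
      then show "\<lfloor>fst c / \<delta>\<rfloor> \<in> {0..\<lfloor>1 / \<delta>\<rfloor>}" by (simp add: floor_mono)
    qed
  qed simp
  interpret disjoint_intervals C
    by unfold_locales (use finC same in auto)
  have "\<exists>g. conjugate_to_powers (fst c) (snd c) g \<and> (\<forall>x\<in>{fst c<..<snd c}. g x \<noteq> x)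
      \<and> (\<forall>x\<in>{fst c..snd c}. \<bar>deriv g x - D01 f x\<bar> \<le> \<epsilon>)" if c: "c \<in> C" for c
  proof (rule approximate_between_fixed_points[OF C(7)[OF c] _ C(3,4)[OF c] _ _ _ _ _ C(5)[OF c] \<epsilon>])
    note c01 = C(1,2,7)[OF c]
    show "continuous_on {fst c..snd c} f" "continuous_on {fst c..snd c} (D01 f)"
      using c01 by (auto intro: continuous_on_subset[OF cont] continuous_on_subset[OF F(5)])
    show "D01 f (fst c) = 1" "D01 f (snd c) = 1" using c01 C(3,4)[OF c] by (auto intro: par)
    fix x assume x: "x \<in> {fst c<..<snd c}"
    then have "x \<in> interior I01" "x \<in> I01" using c01 by auto
    then show "(f has_real_derivative D01 f x) (at x)"
      using Diff_plus_1_has_derivative[OF f1 \<open>x \<in> I01\<close>] at_within_interior[of x I01] by (simp only:)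
    show "0 < D01 f x" using x c01 by (intro Diff1_P_deriv_pos[OF f]) auto
  qed
  then obtain g where g: "\<And>c. c \<in> C \<Longrightarrow> conjugate_to_powers (fst c) (snd c) (g c)"
    "\<And>c x. c \<in> C \<Longrightarrow> x \<in> {fst c<..<snd c} \<Longrightarrow> g c x \<noteq> x"
    "\<And>c x. c \<in> C \<Longrightarrow> x \<in> {fst c..snd c} \<Longrightarrow> \<bar>deriv (g c) x - D01 f x\<bar> \<le> \<epsilon>" by metis
  have fam: "family g" using g(1) by (simp add: conjugate_to_powers_def)
  show ?thesis
  proof (rule that[of "patch C g"])
    show "conjugate_to_powers 0 1 (patch C g)" by (rule conjugate_to_powers_patch) (use g(1) C in auto)
    show "deriv (patch C g) x = 1" if "patch C g x = x" for x
      using deriv_patch_outside[OF fam, of x] patch_inside[OF fam, of _ x] g(2)[of _ x] that by metis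
    show "\<bar>D01 f x - deriv (patch C g) x\<bar> \<le> \<epsilon>" if x: "x \<in> I01" for x
    proof (cases "\<exists>c\<in>C. x \<in> {fst c<..<snd c}")
      case True
      then obtain c where c: "c \<in> C" "x \<in> {fst c<..<snd c}" ..
      then show ?thesis using g(3)[of c x] by (simp add: deriv_patch_inside[OF fam c] abs_minus_commute)
    next
      case False
      then have 1: "deriv (patch C g) x = 1" by (intro deriv_patch_outside[OF fam]) blast
      have "\<bar>D01 f x - 1\<bar> \<le> \<epsilon>"
      proof (cases "f x = x")
        case True
        then show ?thesis using par[OF x] \<epsilon> by simp
      next
        case moved: False
        obtain a b where ab: "0 \<le> a" "a < x" "x < b" "b \<le> 1" "f a = a" "f b = b" "\<And>y. y \<in> {a<..<b} \<Longrightarrow> f y \<noteq> y"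
          using gap_around[OF cont ends x moved] by metis
        have "(a, b) \<notin> C" using False ab by force
        then have "b - a < \<delta>" using ab by (auto simp: C_def)
        then have "\<bar>D01 f x - D01 f a\<bar> < \<epsilon>" using ab x by (intro \<delta>(2)) auto
        then show ?thesis using par[of a] ab x by simp
      qed
      then show ?thesis by (simp add: 1)
    qed
  qed
qed

theorem theorem1:
  shows "Diff1_P_topology closure_of
           {f \<in> Diff1_P \<inter> Diff_plus \<infinity>.
              \<forall>k::nat. k \<ge> 1 \<longrightarrow> (\<exists>h \<in> Diff_plus \<infinity>. conjugates_to h f (f ^^ k))}
         = Diff1_P"
proof
  let ?S = "{f \<in> Diff1_P \<inter> Diff_plus \<infinity>.
              \<forall>k::nat. k \<ge> 1 \<longrightarrow> (\<exists>h \<in> Diff_plus \<infinity>. conjugates_to h f (f ^^ k))}"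
  interpret M: Metric_space "Diff_plus 1" C1_dist by (rule Metric_space_Diff_plus_1)
  show "Diff1_P_topology closure_of ?S \<subseteq> Diff1_P"
    using closure_of_subset_topspace[of Diff1_P_topology ?S] by (simp add: topspace_Diff1_P_topology)
  show "Diff1_P \<subseteq> Diff1_P_topology closure_of ?S"
  proof
    fix f assume f: "f \<in> Diff1_P"
    have f1: "f \<in> Diff_plus 1" using f by (simp add: Diff1_P_def)
    show "f \<in> Diff1_P_topology closure_of ?S"
      unfolding in_closure_of topspace_Diff1_P_topology
    proof (intro conjI allI impI f)
      fix T assume T: "f \<in> T \<and> openin Diff1_P_topology T"
      then obtain U where U: "openin M.mtopology U" "T = U \<inter> Diff1_P"
        unfolding Diff1_P_topology_def Diff1_topology_def openin_subtopology by blast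
      then obtain r where r: "0 < r" "M.mball f r \<subseteq> U"
        using T unfolding M.openin_mtopology by blast
      obtain g where g: "conjugate_to_powers 0 1 g" "\<And>x. g x = x \<Longrightarrow> deriv g x = 1"
        "\<And>x. x \<in> I01 \<Longrightarrow> \<bar>D01 f x - deriv g x\<bar> \<le> r / 2"
        using approximation[OF f, of "r / 2"] r(1) by (metis half_gt_zero)
      have sg: "supported_diffeo 0 1 g" using g(1) by (simp add: conjugate_to_powers_def)
      note G = restrict_in_Diff_plus[OF sg]
      let ?g = "restrict g I01"
      have "(SUP x\<in>I01. \<bar>D01 f x - D01 ?g x\<bar>) \<le> r / 2"
        by (rule cSUP_least) (use G(3) g(3) in auto)
      then have "C1_dist f ?g \<le> r / 2" using f1 G(1) by (simp add: C1_dist_def)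
      then have "?g \<in> M.mball f r" using r(1) f1 G(1) by (simp add: M.in_mball)
      moreover have gP: "?g \<in> Diff1_P" using G(1) G(3) g(2) by (simp add: Diff1_P_def)
      ultimately have "?g \<in> T" using r(2) U(2) by blast
      moreover have "\<exists>h \<in> Diff_plus \<infinity>. conjugates_to h ?g (?g ^^ k)" if "1 \<le> k" for k :: nat
      proof -
        obtain h where h: "supported_diffeo 0 1 h" "\<And>x. h (g x) = (g ^^ k) (h x)"
          using g(1) \<open>1 \<le> k\<close> unfolding conjugate_to_powers_def by blast
        show ?thesis
          by (rule bexI[of _ "restrict h I01"], rule conjugates_to_restrict[OF sg h], rule restrict_in_Diff_plus(1)[OF h(1)])
      qed
      then have "?g \<in> ?S" using gP G(1) by simp
      ultimately show "\<exists>y. y \<in> ?S \<and> y \<in> T" by blast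
    qed
  qed
qed

end
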